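(* There exists a biggest growing mode over all $(m,k)\in\mathbb{Z}\times\mathbb{Z}$: there is $(m_*,k_* )\in\mathcal{B}$ such that $\mu_{m,k}\le\mu_{m_*,k_*}$ for all $(m,k)\in\mathcal{B}$.
   Context: **Equilibrium.** $0<r_0<r_w$, $A>0$, $\gamma>1$ and the viscosities $\varepsilon>0$, $\delta>0$ are constants. The pressure $p:[0,r_0]\to\mathbb{R}$ is admissible: $p\in C^{2,1}([0,r_0])$, $p\ge 0$, $p(r)=0$ if and only if $r=r_0$, $p'\le 0$ on some interval $(r_0-\epsilon,r_0]$ with $\epsilon>0$, $-\int_0^r s^2p'(s)\,ds\ge 0$ for all $r\in[0,r_0]$, and $\lim_{r\to r_0}p(r)/p'(r)=0$. Put $B_\theta(r)=\big(-\frac{2}{r^2}\int_0^rs^2p'(s)\,ds\big)^{1/2}$ on $[0,r_0]$, $\widehat B_\theta(r)=B_\theta(r_0)\frac{r_0}{r}$ on $[r_0,r_w]$, $\rho=(p/A)^{1/\gamma}$. A prime is $d/dr$. **Energies.** For $(m,k)\in\mathbb{Z}^2$ let $$D_{m,k}(\xi,\eta,\zeta)=2\pi^2\int_0^{r_0}\varepsilon\Big[\tfrac29\big(-2\xi'+\tfrac{\xi}{r}+\tfrac mr\zeta-k\eta\big)^2+\tfrac29\big(\xi'-\tfrac{2\xi}{r}-\tfrac{2m}{r}\zeta-k\eta\big)^2+\tfrac29\big(\xi'+\tfrac{\xi}{r}+\tfrac mr\zeta+2k\eta\big)^2+\big(-\zeta'+\tfrac{\zeta}{r}+\tfrac mr\xi\big)^2+(\eta'+k\xi)^2+\big(\tfrac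 mr\eta-k\zeta\big)^2\Big]r\,dr+2\pi^2\int_0^{r_0}\delta\big(\xi'+\tfrac{\xi}{r}+\tfrac mr\zeta-k\eta\big)^2r\,dr.$$ For $s>0$, $$E_{0,k}(\xi,\eta,\zeta;s)=2\pi^2\int_0^{r_0}\Big\{\tfrac{2p'\xi^2}{r}+B_\theta^2\big[k\eta-\tfrac1r((r\xi)'-2\xi)\big]^2+\gamma p\big[\tfrac1r(r\xi)'-k\eta\big]^2\Big\}r\,dr+sD_{0,k}(\xi,\eta,\zeta),$$ and for $m\ne0$, $$E_{m,k}(\xi,\eta,\zeta,\widehat Q_r;s)=2\pi^2\int_0^{r_0}\Big\{(m^2+k^2r^2)\Big[\tfrac{B_\theta}{r}\eta+\tfrac{-kB_\theta(r\xi)'+2kB_\theta\xi}{m^2+k^2r^2}\Big]^2+\gamma p\big[\tfrac1r(r\xi)'-k\eta+\tfrac{m\zeta}{r}\big]^2\Big\}r\,dr+2\pi^2\int_0^{r_0}\tfrac{m^2B_\theta^2}{r(m^2+k^2r^2)}(\xi-r\xi')^2dr+2\pi^2\int_0^{r_0}\big[2p'+\tfrac{m^2B_\theta^2}{r}\big]\xi^2dr+2\pi^2\int_{r_0}^{r_w}\Big[|\widehat Q_r|^2+\tfrac{1}{m^2+k^2r^2}|(r\widehat Q_r)'|^2\Big]r\,dr+sD_{m,k}(\xi,\eta,\zeta).$$ Let $\mathcal{J}(\xi,\eta,\zeta)=2\pi^2\int_0^{r_0}\rho(\xi^2+\eta^2+\zeta^2)r\,dr$. **Spaces.** Let $N_{m,k}(\xi,\eta,\zeta)$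 be the quantity obtained from $D_{m,k}$ by replacing $2\pi^2$, $\varepsilon$, $\delta$ and $\tfrac29$ by $1$. $X_k$ is the completion of $\{(\xi,\eta,\zeta)\in C^\infty([0,r_0])^3:\xi(0)=\zeta(0)=0\}$ with respect to $\|\cdot\|_{X_k}^2=N_{0,k}+\int_0^{r_0}\rho(\xi^2+\eta^2+\zeta^2)r\,dr$. For $m\neq0$, $Y_{m,k}$ is the completion of $\{(\xi,\eta,\zeta)\in C^\infty([0,r_0])^3:\xi(0)=\eta(0)=\zeta(0)=0\}$ with respect to $\|\cdot\|_{Y_{m,k}}^2=N_{m,k}+\int_0^{r_0}\rho(\xi^2+\eta^2+\zeta^2)r\,dr$. Set $\mathcal{A}_1=\{(\xi,\eta,\zeta)\in X_k:\mathcal{J}=1\}$ and $\mathcal{A}_2=\{((\xi,\eta,\zeta),\widehat Q_r)\in Y_{m,k}\times H^1(r_0,r_w):\mathcal{J}(\xi,\eta,\zeta)=1,\ m\widehat B_\theta\xi=r\widehat Q_r\text{ at }r=r_0,\ \widehat Q_r=0\text{ at }r=r_w\}$. **Growing modes.** $\lambda_{0,k}(s)=\inf_{\mathcal{A}_1}E_{0,k}(\cdot;s)$ and, for $m\ne0$, $\lambda_{m,k}(s)=\inf_{\mathcal{A}_2}E_{m,k}(\cdot;s)$. $\mathcal{B}$ is the set of $(m,k)\in\mathbb{Z}^2$ for which there is $s>0$ with $\lambda_{m,k}(s)<0$ and $s=\sqrt{-\lambda_{m,k}(s)}$ (such $s$ is unique because $\lambda_{m,k}(\cdot)$ is nondecreasing);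 for $(m,k)\in\mathcal{B}$ the growing mode (growth rate) is $\mu_{m,k}:=s$. *)

theory Defs
  imports "HOL-Analysis.Analysis"
begin

section \<open>Regularity on a compact interval\<close>

definition interval_deriv :: "real \<Rightarrow> real \<Rightarrow> (real \<Rightarrow> real) \<Rightarrow> real \<Rightarrow> real" where
  "interval_deriv a b f r = vector_derivative f (at r within {a..b})"

text \<open>\<open>C\<^sup>2\<^sup>,\<^sup>1([a,b])\<close>; derivatives at the end points are one-sided.\<close>

definition C21_on :: "real \<Rightarrow> real \<Rightarrow> (real \<Rightarrow> real) \<Rightarrow> bool" where
  "C21_on a b f \<longleftrightarrow> (\<exists>f1 f2 L.
     (\<forall>r\<in>{a..b}. (f has_real_derivative f1 r) (at r within {a..b})) \<and>
     (\<forall>r\<in>{a..b}. (f1 has_real_derivative f2 r) (at r within {a..b})) \<and>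
     L-lipschitz_on {a..b} f2)"

definition Cinf_on :: "real \<Rightarrow> real \<Rightarrow> (real \<Rightarrow> real) set" where
  "Cinf_on a b = {f. \<exists>D :: nat \<Rightarrow> real \<Rightarrow> real. D 0 = f \<and>
     (\<forall>n. \<forall>r\<in>{a..b}. (D n has_real_derivative D (Suc n) r) (at r within {a..b}))}"


section \<open>Weak derivatives in one dimension\<close>

text \<open>
  On an interval \<open>I\<close>, a locally integrable function with locally integrable weak derivative \<open>g\<close>
  is represented by its continuous representative \<open>f\<close>, which is an indefinite integral of \<open>g\<close>.
  In particular the trace at an end point belonging to \<open>I\<close> is the value of \<open>f\<close> there. The weak
  derivative is unique up to null sets, and it only enters under integrals below, so the
  choice in \<open>wderiv\<close> is immaterial.
\<close>

definition has_wderiv :: "real set \<Rightarrow> (real \<Rightarrow> real) \<Rightarrow> (real \<Rightarrow> real) \<Rightarrow> bool" where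
  "has_wderiv I f g \<longleftrightarrow> (\<forall>a b. a \<le> b \<and> {a..b} \<subseteq> I \<longrightarrow>
     set_integrable lborel {a..b} g \<and> f b - f a = (LBINT r:{a..b}. g r))"

definition wdifferentiable :: "real set \<Rightarrow> (real \<Rightarrow> real) \<Rightarrow> bool" where
  "wdifferentiable I f \<longleftrightarrow> (\<exists>g. has_wderiv I f g)"

definition wderiv :: "real set \<Rightarrow> (real \<Rightarrow> real) \<Rightarrow> real \<Rightarrow> real" where
  "wderiv I f = (SOME g. has_wderiv I f g)"

definition H1 :: "real \<Rightarrow> real \<Rightarrow> (real \<Rightarrow> real) set" where
  "H1 a b = {f. wdifferentiable {a..b} f \<and>
     set_integrable lborel {a..b} (\<lambda>r. (f r)\<^sup>2) \<and>
     set_integrable lborel {a..b} (\<lambda>r. (wderiv {a..b} f r)\<^sup>2)}"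


section \<open>The z-pinch equilibrium\<close>

text \<open>
  The condition \<open>p' \<noteq> 0\<close> near \<open>r0\<close> only says that the quotient \<open>p / p'\<close>, whose limit is
  taken, is defined there (in HOL, \<open>x / 0 = 0\<close>).
\<close>

definition admissible_pressure :: "real \<Rightarrow> (real \<Rightarrow> real) \<Rightarrow> bool" where
  "admissible_pressure r0 p \<longleftrightarrow>
     C21_on 0 r0 p \<and>
     (\<forall>r\<in>{0..r0}. p r \<ge> 0) \<and>
     (\<forall>r\<in>{0..r0}. p r = 0 \<longleftrightarrow> r = r0) \<and>
     (\<exists>e>0. e \<le> r0 \<and> (\<forall>r\<in>{r0 - e<..r0}. interval_deriv 0 r0 p r \<le> 0)) \<and>
     (\<forall>r\<in>{0..r0}. - (LBINT s:{0..r}. s\<^sup>2 * interval_deriv 0 r0 p s) \<ge> 0) \<and>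
     (\<forall>\<^sub>F r in at_left r0. interval_deriv 0 r0 p r \<noteq> 0) \<and>
     ((\<lambda>r. p r / interval_deriv 0 r0 p r) \<longlongrightarrow> 0) (at_left r0)"

locale z_pinch =
  fixes r0 rw A \<gamma> \<epsilon> \<delta> :: real and p :: "real \<Rightarrow> real"
  assumes r0_pos: "0 < r0" and r0_less_rw: "r0 < rw"
    and A_pos: "A > 0" and gamma_gt_1: "\<gamma> > 1"
    and epsilon_pos: "\<epsilon> > 0" and delta_pos: "\<delta> > 0"
    and admissible: "admissible_pressure r0 p"
begin

definition p' :: "real \<Rightarrow> real" where
  "p' = interval_deriv 0 r0 p"

definition B\<theta> :: "real \<Rightarrow> real" where
  "B\<theta> r = sqrt (- (2 / r\<^sup>2) * (LBINT s:{0..r}. s\<^sup>2 * p' s))"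

definition Bhat :: "real \<Rightarrow> real" where
  "Bhat r = B\<theta> r0 * (r0 / r)"

definition \<rho> :: "real \<Rightarrow> real" where
  "\<rho> r = (p r / A) powr (1 / \<gamma>)"


subsection \<open>Energies\<close>

text \<open>
  \<open>d\<close> and \<open>dv\<close> are the derivatives in the plasma, up to and including the interface \<open>r = r0\<close>
  but without the axis \<open>r = 0\<close>, and in the vacuum.
\<close>

definition d :: "(real \<Rightarrow> real) \<Rightarrow> real \<Rightarrow> real" where
  "d = wderiv {0<..r0}"

definition dv :: "(real \<Rightarrow> real) \<Rightarrow> real \<Rightarrow> real" where
  "dv = wderiv {r0..rw}"

text \<open>The integrands of \<open>D\<close>, with \<open>q\<close> in place of \<open>2/9\<close>.\<close>

definition shear_sq ::
  "real \<Rightarrow> int \<Rightarrow> int \<Rightarrow> (real \<Rightarrow> real) \<Rightarrow> (real \<Rightarrow> real) \<Rightarrow> (real \<Rightarrow> real) \<Rightarrow> real \<Rightarrow> real" where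
  "shear_sq q m k \<xi> \<eta> \<zeta> r =
     q * (- 2 * d \<xi> r + \<xi> r / r + m / r * \<zeta> r - k * \<eta> r)\<^sup>2
   + q * (d \<xi> r - 2 * \<xi> r / r - 2 * m / r * \<zeta> r - k * \<eta> r)\<^sup>2
   + q * (d \<xi> r + \<xi> r / r + m / r * \<zeta> r + 2 * k * \<eta> r)\<^sup>2
   + (- d \<zeta> r + \<zeta> r / r + m / r * \<xi> r)\<^sup>2
   + (d \<eta> r + k * \<xi> r)\<^sup>2
   + (m / r * \<eta> r - k * \<zeta> r)\<^sup>2"

definition div_sq ::
  "int \<Rightarrow> int \<Rightarrow> (real \<Rightarrow> real) \<Rightarrow> (real \<Rightarrow> real) \<Rightarrow> (real \<Rightarrow> real) \<Rightarrow> real \<Rightarrow> real" where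
  "div_sq m k \<xi> \<eta> \<zeta> r = (d \<xi> r + \<xi> r / r + m / r * \<zeta> r - k * \<eta> r)\<^sup>2"

definition D ::
  "int \<Rightarrow> int \<Rightarrow> (real \<Rightarrow> real) \<Rightarrow> (real \<Rightarrow> real) \<Rightarrow> (real \<Rightarrow> real) \<Rightarrow> real" where
  "D m k \<xi> \<eta> \<zeta> =
     2 * pi\<^sup>2 * (LBINT r:{0<..<r0}. \<epsilon> * shear_sq (2/9) m k \<xi> \<eta> \<zeta> r * r)
   + 2 * pi\<^sup>2 * (LBINT r:{0<..<r0}. \<delta> * div_sq m k \<xi> \<eta> \<zeta> r * r)"

definition E0 ::
  "int \<Rightarrow> (real \<Rightarrow> real) \<Rightarrow> (real \<Rightarrow> real) \<Rightarrow> (real \<Rightarrow> real) \<Rightarrow> real \<Rightarrow> real" where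
  "E0 k \<xi> \<eta> \<zeta> s =
     2 * pi\<^sup>2 * (LBINT r:{0<..<r0}.
       (2 * p' r * (\<xi> r)\<^sup>2 / r
        + (B\<theta> r)\<^sup>2 * (k * \<eta> r - 1 / r * (d (\<lambda>t. t * \<xi> t) r - 2 * \<xi> r))\<^sup>2
        + \<gamma> * p r * (1 / r * d (\<lambda>t. t * \<xi> t) r - k * \<eta> r)\<^sup>2) * r)
   + s * D 0 k \<xi> \<eta> \<zeta>"

definition E ::
  "int \<Rightarrow> int \<Rightarrow> (real \<Rightarrow> real) \<Rightarrow> (real \<Rightarrow> real) \<Rightarrow> (real \<Rightarrow> real) \<Rightarrow> (real \<Rightarrow> real) \<Rightarrow> real \<Rightarrow> real"
where
  "E m k \<xi> \<eta> \<zeta> Q s =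
     2 * pi\<^sup>2 * (LBINT r:{0<..<r0}.
       ((m\<^sup>2 + k\<^sup>2 * r\<^sup>2) *
          (B\<theta> r / r * \<eta> r
           + (- k * B\<theta> r * d (\<lambda>t. t * \<xi> t) r + 2 * k * B\<theta> r * \<xi> r) / (m\<^sup>2 + k\<^sup>2 * r\<^sup>2))\<^sup>2
        + \<gamma> * p r * (1 / r * d (\<lambda>t. t * \<xi> t) r - k * \<eta> r + m * \<zeta> r / r)\<^sup>2) * r)
   + 2 * pi\<^sup>2 * (LBINT r:{0<..<r0}.
       m\<^sup>2 * (B\<theta> r)\<^sup>2 / (r * (m\<^sup>2 + k\<^sup>2 * r\<^sup>2)) * (\<xi> r - r * d \<xi> r)\<^sup>2)
   + 2 * pi\<^sup>2 * (LBINT r:{0<..<r0}. (2 * p' r + m\<^sup>2 * (B\<theta> r)\<^sup>2 / r) * (\<xi> r)\<^sup>2)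
   + 2 * pi\<^sup>2 * (LBINT r:{r0<..<rw}.
       (\<bar>Q r\<bar>\<^sup>2 + 1 / (m\<^sup>2 + k\<^sup>2 * r\<^sup>2) * \<bar>dv (\<lambda>t. t * Q t) r\<bar>\<^sup>2) * r)
   + s * D m k \<xi> \<eta> \<zeta>"

definition J :: "(real \<Rightarrow> real) \<Rightarrow> (real \<Rightarrow> real) \<Rightarrow> (real \<Rightarrow> real) \<Rightarrow> real" where
  "J \<xi> \<eta> \<zeta> = 2 * pi\<^sup>2 * (LBINT r:{0<..<r0}. \<rho> r * ((\<xi> r)\<^sup>2 + (\<eta> r)\<^sup>2 + (\<zeta> r)\<^sup>2) * r)"


subsection \<open>Function spaces\<close>

text \<open>
  The squared norm of \<open>X\<^sub>k\<close> (for \<open>m = 0\<close>) and of \<open>Y\<^sub>m\<^sub>,\<^sub>k\<close> (for \<open>m \<noteq> 0\<close>), with values in the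
  extended nonnegative reals so that it makes sense for every weakly differentiable triple.
\<close>

definition sqnorm ::
  "int \<Rightarrow> int \<Rightarrow> (real \<Rightarrow> real) \<Rightarrow> (real \<Rightarrow> real) \<Rightarrow> (real \<Rightarrow> real) \<Rightarrow> ennreal" where
  "sqnorm m k \<xi> \<eta> \<zeta> =
     (\<integral>\<^sup>+r\<in>{0<..<r0}. ennreal (shear_sq 1 m k \<xi> \<eta> \<zeta> r * r) \<partial>lborel)
   + (\<integral>\<^sup>+r\<in>{0<..<r0}. ennreal (div_sq m k \<xi> \<eta> \<zeta> r * r) \<partial>lborel)
   + (\<integral>\<^sup>+r\<in>{0<..<r0}. ennreal (\<rho> r * ((\<xi> r)\<^sup>2 + (\<eta> r)\<^sup>2 + (\<zeta> r)\<^sup>2) * r) \<partial>lborel)"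

text \<open>
  The norm bounds the weak derivatives of \<open>\<xi>\<close>, \<open>\<eta>\<close>, \<open>\<zeta>\<close> in \<open>L\<^sup>2(a, r0)\<close> for every \<open>a > 0\<close>, and
  \<open>\<rho> > 0\<close> in the interior. Hence a Cauchy sequence of smooth triples has a limit triple
  of functions on \<open>(0, r0]\<close>, unique there, and the completion of a space \<open>S\<close> of smooth triples
  is the set of all weakly differentiable triples on \<open>(0, r0]\<close> that are norm limits of
  sequences in \<open>S\<close>. Triples that agree on \<open>(0, r0]\<close> represent the same element.
\<close>

definition completion ::
  "int \<Rightarrow> int \<Rightarrow> ((real \<Rightarrow> real) \<times> (real \<Rightarrow> real) \<times> (real \<Rightarrow> real)) set
   \<Rightarrow> ((real \<Rightarrow> real) \<times> (real \<Rightarrow> real) \<times> (real \<Rightarrow> real)) set" where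
  "completion m k S = {(\<xi>, \<eta>, \<zeta>).
     wdifferentiable {0<..r0} \<xi> \<and> wdifferentiable {0<..r0} \<eta> \<and> wdifferentiable {0<..r0} \<zeta> \<and>
     (\<exists>\<xi>n \<eta>n \<zeta>n. (\<forall>n::nat. (\<xi>n n, \<eta>n n, \<zeta>n n) \<in> S) \<and>
       (\<lambda>n. sqnorm m k (\<lambda>r. \<xi>n n r - \<xi> r) (\<lambda>r. \<eta>n n r - \<eta> r) (\<lambda>r. \<zeta>n n r - \<zeta> r))
         \<longlonglongrightarrow> 0)}"

definition X :: "int \<Rightarrow> ((real \<Rightarrow> real) \<times> (real \<Rightarrow> real) \<times> (real \<Rightarrow> real)) set" where
  "X k = completion 0 k {(\<xi>, \<eta>, \<zeta>).
     \<xi> \<in> Cinf_on 0 r0 \<and> \<eta> \<in> Cinf_on 0 r0 \<and> \<zeta> \<in> Cinf_on 0 r0 \<and> \<xi> 0 = 0 \<and> \<zeta> 0 = 0}"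

definition Y :: "int \<Rightarrow> int \<Rightarrow> ((real \<Rightarrow> real) \<times> (real \<Rightarrow> real) \<times> (real \<Rightarrow> real)) set" where
  "Y m k = completion m k {(\<xi>, \<eta>, \<zeta>).
     \<xi> \<in> Cinf_on 0 r0 \<and> \<eta> \<in> Cinf_on 0 r0 \<and> \<zeta> \<in> Cinf_on 0 r0 \<and>
     \<xi> 0 = 0 \<and> \<eta> 0 = 0 \<and> \<zeta> 0 = 0}"

definition A1 :: "int \<Rightarrow> ((real \<Rightarrow> real) \<times> (real \<Rightarrow> real) \<times> (real \<Rightarrow> real)) set" where
  "A1 k = {(\<xi>, \<eta>, \<zeta>). (\<xi>, \<eta>, \<zeta>) \<in> X k \<and> J \<xi> \<eta> \<zeta> = 1}"

definition A2 ::
  "int \<Rightarrow> int \<Rightarrow> (((real \<Rightarrow> real) \<times> (real \<Rightarrow> real) \<times> (real \<Rightarrow> real)) \<times> (real \<Rightarrow> real)) set" where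
  "A2 m k = {((\<xi>, \<eta>, \<zeta>), Q). (\<xi>, \<eta>, \<zeta>) \<in> Y m k \<and> Q \<in> H1 r0 rw \<and> J \<xi> \<eta> \<zeta> = 1 \<and>
     m * Bhat r0 * \<xi> r0 = r0 * Q r0 \<and> Q rw = 0}"


subsection \<open>Growing modes\<close>

text \<open>
  The infima are taken in the reals: the constraint sets are nonempty and, for \<open>s > 0\<close>, the
  energies are bounded below on them. Only \<open>s > 0\<close> is used.
\<close>

definition lam :: "int \<Rightarrow> int \<Rightarrow> real \<Rightarrow> real" where
  "lam m k s = (if m = 0
     then INF (\<xi>, \<eta>, \<zeta>) \<in> A1 k. E0 k \<xi> \<eta> \<zeta> s
     else INF ((\<xi>, \<eta>, \<zeta>), Q) \<in> A2 m k. E m k \<xi> \<eta> \<zeta> Q s)"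

definition is_growth_rate :: "int \<Rightarrow> int \<Rightarrow> real \<Rightarrow> bool" where
  "is_growth_rate m k s \<longleftrightarrow> s > 0 \<and> lam m k s < 0 \<and> s = sqrt (- lam m k s)"

definition growing_modes :: "(int \<times> int) set" where
  "growing_modes = {(m, k). \<exists>s. is_growth_rate m k s}"

definition \<mu> :: "int \<Rightarrow> int \<Rightarrow> real" where
  "\<mu> m k = (THE s. is_growth_rate m k s)"

end

end

(*
  Dropping nonnegative terms, the energy is bounded below by s D - C * int xi^2, where C bounds |p'|, so
  everything rests on controlling int xi^2 by D and J uniformly in (m, k). The dissipation controls
  int xi'^2 r, so by a weighted Cauchy-Schwarz inequality int xi^2 over small neighbourhoods of the axis and
  of the interface is at most tau D plus a multiple of int xi^2 over a compact interior interval. There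
  J controls all components, and since eta' + k xi and zeta' - zeta/r - m xi/r are controlled by D, integrating by
  parts against a cut-off gains a factor 1 / (|m| + |k|). Hence lam m k s0 tends to a nonnegative limit as
  |m| + |k| grows, so only finitely many growth rates exceed any given s0 > 0; the set of
  growing modes is nonempty, as an explicit monomial triple has negative energy for (m, k) = (0, 1).
*)
theory Submission
  imports Defs
begin

text \<open>The negative term is \<open>2 * p' r * (\<xi> r)^2\<close> after the factor
  \<open>r\<close> cancels, so \<open>\<xi>\<close> is needed in the unweighted L2 norm. The
  constraint \<open>J = 1\<close> cannot give this alone: its weight \<open>\<rho> r * r\<close>
  degenerates on the axis and at the interface. The dissipation bounds variation but not size, hence
  the combination of both. The gain in |m| + |k| is a cancellation:
  \<open>d \<eta> r + k * \<xi> r\<close> stays bounded even where \<open>k * \<xi> r\<close> is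
  large, so there \<open>k * \<xi>\<close> is nearly the derivative of a function that
  \<open>J\<close> bounds. The same holds for \<open>m\<close> and \<open>\<zeta>\<close>. A growth
  rate is a zero of \<open>lam m k s + s^2\<close>. Since the energy is affine in \<open>s\<close>
  with slope \<open>D\<close>, \<open>lam m k\<close> is concave and nondecreasing, which yields
  existence and uniqueness of the zero. A rate \<open>s \<ge> s0\<close> would force
  \<open>lam m k s0 \<le> - s0^2\<close>, so a lower bound of \<open>- s0^2 / 2\<close> excludes it.
  A Bochner integral without integrability has the value 0. Finite dissipation therefore has to be
  extracted from the completion, integrability of the density of \<open>J\<close> from
  \<open>J = 1\<close>, and the other energy terms are bounded below in a way that covers both
  cases.\<close>

section \<open>Integration on Borel subsets of the line\<close>

abbreviation lborel_on :: "real set \<Rightarrow> real measure" where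
  "lborel_on S \<equiv> restrict_space lborel S"

lemma set_integral_lborel_on:
  fixes f :: "real \<Rightarrow> real"
  assumes "S \<in> sets borel"
  shows "(LBINT x:S. f x) = integral\<^sup>L (lborel_on S) f"
    and "set_integrable lborel S f \<longleftrightarrow> integrable (lborel_on S) f"
  using assms by (auto simp: set_lebesgue_integral_def set_integrable_def
      integral_restrict_space integrable_restrict_space)

lemma integrable_mult_bounded:
  fixes f g :: "'a \<Rightarrow> real"
  assumes "integrable M f" "g \<in> borel_measurable M" "\<And>x. x \<in> space M \<Longrightarrow> \<bar>g x\<bar> \<le> B"
  shows "integrable M (\<lambda>x. g x * f x)"
proof (rule Bochner_Integration.integrable_bound)
  show "integrable M (\<lambda>x. B * f x)" using assms(1) by simp
  show "AE x in M. norm (g x * f x) \<le> norm (B * f x)"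
  proof (rule AE_I2)
    fix x assume "x \<in> space M"
    then have "\<bar>g x\<bar> \<le> \<bar>B\<bar>" using assms(3) by fastforce
    then show "norm (g x * f x) \<le> norm (B * f x)" by (simp add: abs_mult mult_right_mono)
  qed
qed (use assms in measurable)

lemma measurable_lborel_on_continuous:
  fixes f :: "real \<Rightarrow> real"
  assumes "continuous_on S f" "S \<in> sets borel"
  shows "f \<in> borel_measurable (lborel_on S)"
  using assms by (metis borel_measurable_continuous_on_restrict measurable_cong_sets
      sets_lborel sets_restrict_space_cong)

lemma integrable_Icc_mult_continuous:
  fixes f g :: "real \<Rightarrow> real"
  assumes "integrable (lborel_on {a..b}) f" "continuous_on {a..b} g"
  shows "integrable (lborel_on {a..b}) (\<lambda>x. g x * f x)"
proof -
  obtain B where "\<And>x. x \<in> {a..b} \<Longrightarrow> \<bar>g x\<bar> \<le> B"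
    using compact_imp_bounded[OF compact_continuous_image[OF assms(2) compact_Icc]]
    unfolding bounded_iff by (metis imageI real_norm_def)
  then show ?thesis
    by (intro integrable_mult_bounded[where B = B] assms measurable_lborel_on_continuous)
       (auto simp: space_restrict_space)
qed

lemma integrable_Icc_continuous:
  fixes f :: "real \<Rightarrow> real"
  assumes "continuous_on {a..b} f"
  shows "integrable (lborel_on {a..b}) f"
  using borel_integrable_atLeastAtMost'[OF assms] by (simp add: set_integral_lborel_on)

text \<open>The positive and negative parts of \<open>h\<close> are densities of two measures with
  the same finite mass on every open half-line. Half-lines determine the measure, and the measure
  determines its density up to a null set.\<close>

lemma AE_eq_0_if_integral_greaterThan_eq_0:
  fixes h :: "real \<Rightarrow> real"
  assumes h[measurable]: "integrable lborel h" and zero: "\<And>x. (LBINT y:{x<..}. h y) = 0"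
  shows "AE x in lborel. h x = 0"
proof -
  define P where "P = (\<lambda>x. max (h x) 0)"
  define N where "N = (\<lambda>x. max (- h x) 0)"
  have iP: "integrable lborel P" and iN: "integrable lborel N" unfolding P_def N_def using h by auto
  have [measurable]: "P \<in> borel_measurable borel" "N \<in> borel_measurable borel" using iP iN by auto
  have eqPN: "emeasure (density lborel P) {x<..} = emeasure (density lborel N) {x<..}"
    and fin: "emeasure (density lborel P) {x<..} < \<infinity>" for x
  proof -
    have s: "set_integrable lborel {x<..} P" "set_integrable lborel {x<..} N"
      unfolding set_integrable_def by (intro integrable_mult_indicator iP iN; simp)+
    have "h = (\<lambda>x. P x - N x)" by (auto simp: P_def N_def)
    then have "(LBINT y:{x<..}. P y) - (LBINT y:{x<..}. N y) = 0"
      using zero[of x] set_integral_diff(2)[OF s] by simp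
    moreover have e: "emeasure (density lborel F) {x<..} = ennreal (LBINT y:{x<..}. F y)"
      if [measurable]: "F \<in> borel_measurable borel" and "set_integrable lborel {x<..} F" and "\<And>y. F y \<ge> 0" for F
    proof -
      have "emeasure (density lborel F) {x<..} = (\<integral>\<^sup>+y. ennreal (indicator {x<..} y * F y) \<partial>lborel)"
        by (auto simp: emeasure_density indicator_def intro!: nn_integral_cong)
      also have "\<dots> = ennreal (LBINT y:{x<..}. F y)"
        using that unfolding set_lebesgue_integral_def set_integrable_def
        by (subst nn_integral_eq_integral) auto
      finally show ?thesis .
    qed
    moreover have "P y \<ge> 0" "N y \<ge> 0" for y by (auto simp: P_def N_def)
    ultimately have "emeasure (density lborel P) {x<..} = ennreal (LBINT y:{x<..}. P y)"
      "emeasure (density lborel N) {x<..} = ennreal (LBINT y:{x<..}. P y)"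
      using s by auto
    then show "emeasure (density lborel P) {x<..} = emeasure (density lborel N) {x<..}"
      "emeasure (density lborel P) {x<..} < \<infinity>"
      by auto
  qed
  have "density lborel P = density lborel N"
    by (rule measure_eqI_lessThan) (use eqPN fin in auto)
  then have "AE x in lborel. ennreal (P x) = ennreal (N x)"
    using sigma_finite_measure.density_unique_iff[OF sigma_finite_lborel, of P N] by simp
  then show ?thesis by eventually_elim (auto simp: P_def N_def max_def split: if_splits)
qed

section \<open>Calculus of weak derivatives\<close>

lemma has_wderiv_mono: "has_wderiv I f g \<Longrightarrow> J \<subseteq> I \<Longrightarrow> has_wderiv J f g"
  unfolding has_wderiv_def by blast

lemma has_wderiv_wderiv: "wdifferentiable I f \<Longrightarrow> has_wderiv I f (wderiv I f)"
  unfolding wdifferentiable_def wderiv_def by (erule someI_ex)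

lemma has_wderiv_Icc:
  assumes "has_wderiv I f g" "{a..b} \<subseteq> I" "a \<le> b"
  shows "integrable (lborel_on {a..b}) g" "f b - f a = integral\<^sup>L (lborel_on {a..b}) g"
  using assms unfolding has_wderiv_def by (auto simp: set_integral_lborel_on)

lemma has_wderiv_Icc_HK:
  assumes "has_wderiv I f g" "{a..b} \<subseteq> I" "a \<le> b"
  shows "g integrable_on {a..b}" "f b - f a = integral {a..b} g"
  using assms set_borel_integral_eq_integral[of "{a..b}" g] unfolding has_wderiv_def by auto

lemma has_wderiv_diff:
  assumes "has_wderiv I f f'" "has_wderiv I g g'"
  shows "has_wderiv I (\<lambda>x. f x - g x) (\<lambda>x. f' x - g' x)"
  unfolding has_wderiv_def
proof (intro allI impI)
  fix a b assume "a \<le> b \<and> {a..b} \<subseteq> I"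
  then have "set_integrable lborel {a..b} f'" "f b - f a = (LBINT r:{a..b}. f' r)"
    "set_integrable lborel {a..b} g'" "g b - g a = (LBINT r:{a..b}. g' r)"
    using assms unfolding has_wderiv_def by blast+
  then show "set_integrable lborel {a..b} (\<lambda>x. f' x - g' x) \<and>
      f b - g b - (f a - g a) = (LBINT r:{a..b}. f' r - g' r)"
    using set_integral_diff[of lborel "{a..b}" f' g'] by simp
qed

lemma has_wderiv_DERIV:
  assumes "\<And>x. x \<in> I \<Longrightarrow> (f has_real_derivative g x) (at x within I)" "continuous_on I g"
  shows "has_wderiv I f g"
  unfolding has_wderiv_def
proof (intro allI impI)
  fix a b assume ab: "a \<le> b \<and> {a..b} \<subseteq> I"
  then have c: "continuous_on {a..b} g" using assms(2) continuous_on_subset by blast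
  have "(LBINT r:{a..b}. g r) = f b - f a" unfolding set_lebesgue_integral_def
  proof (rule integral_FTC_atLeastAtMost)
    fix x assume "a \<le> x" "x \<le> b"
    then have "(f has_real_derivative g x) (at x within {a..b})"
      using assms(1)[of x] ab by (meson DERIV_subset atLeastAtMost_iff subsetD)
    then show "(f has_vector_derivative g x) (at x within {a..b})"
      by (simp add: has_real_derivative_iff_has_vector_derivative)
  qed (use ab c in auto)
  then show "set_integrable lborel {a..b} g \<and> f b - f a = (LBINT r:{a..b}. g r)"
    using borel_integrable_atLeastAtMost'[OF c] by simp
qed

lemma has_wderiv_continuous_Icc:
  assumes "has_wderiv {a..b} f g"
  shows "continuous_on {a..b} f"
proof (cases "a \<le> b")
  case True
  have "f x = f a + integral {a..x} g" if "x \<in> {a..b}" for x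
    using has_wderiv_Icc_HK(2)[OF assms, of a x] that by auto
  moreover have "continuous_on {a..b} (\<lambda>x. f a + integral {a..x} g)"
    using has_wderiv_Icc_HK(1)[OF assms order_refl True]
    by (intro continuous_intros indefinite_integral_continuous_1)
  ultimately show ?thesis using continuous_on_cong by (metis (no_types, lifting))
qed auto

text \<open>Continuity is local, and near a point \<open>x > 0\<close> the half-open interval
  coincides with the compact interval \<open>{x/2..c}\<close>.\<close>

lemma has_wderiv_continuous_Ioc:
  assumes "has_wderiv {0<..c} f g"
  shows "continuous_on {0<..c} f"
proof (rule continuous_on_eq_continuous_within[THEN iffD2], rule ballI)
  fix x assume x: "x \<in> {0<..c}"
  have "continuous_on {x/2..c} f"
    by (rule has_wderiv_continuous_Icc, rule has_wderiv_mono[OF assms]) (use x in auto)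
  then have c: "continuous (at x within {x/2..c}) f" using x by (auto simp: continuous_on_eq_continuous_within)
  have "at x within {0<..c} = at x within {x/2..c}"
    by (rule at_within_nhd[of _ "{x/2<..}"]) (use x in auto)
  with c show "continuous (at x within {0<..c}) f" by simp
qed

text \<open>Both candidates integrate to \<open>f b - f y\<close> over every \<open>{y..b}\<close>,
  so their difference, cut off outside \<open>{a..b}\<close>, has integral 0 over every
  half-line.\<close>

lemma has_wderiv_unique_Icc:
  assumes "has_wderiv {a..b} f g" "has_wderiv {a..b} f g'"
  shows "AE x in lborel. x \<in> {a..b} \<longrightarrow> g x = g' x"
proof (cases "a \<le> b")
  case True
  define h where "h = (\<lambda>x. indicator {a..b} x *\<^sub>R (g x - g' x))"
  have i: "set_integrable lborel {a..b} (\<lambda>x. g x - g' x)"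
    using assms True unfolding has_wderiv_def by (auto intro: set_integral_diff)
  have "AE x in lborel. h x = 0"
  proof (rule AE_eq_0_if_integral_greaterThan_eq_0)
    show "integrable lborel h" using i unfolding h_def set_integrable_def .
    fix x
    define y where "y = max x a"
    show "(LBINT y:{x<..}. h y) = 0"
    proof (cases "y \<le> b")
      case True
      have "(LBINT y:{x<..}. h y) = (LBINT z:{y..b}. g z - g' z)"
        unfolding set_lebesgue_integral_def
      proof (rule integral_cong_AE)
        \<comment> \<open>Inside \<open>{a..b}\<close> the half-line \<open>{x<..}\<close> and
          \<open>{y..b}\<close> differ at most in their left end point.\<close>
        show "AE z in lborel. indicator {x<..} z *\<^sub>R h z = indicator {y..b} z *\<^sub>R (g z - g' z)"
          using AE_lborel_singleton[of y] AE_lborel_singleton[of x]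
          by eventually_elim (auto simp: h_def y_def indicator_def)
        show "(\<lambda>z. indicat_real {x<..} z *\<^sub>R h z) \<in> borel_measurable lborel"
          using i unfolding h_def set_integrable_def by measurable
        show "(\<lambda>x. indicat_real {y..b} x *\<^sub>R (g x - g' x)) \<in> borel_measurable lborel"
          using set_integrable_subset[OF i, of "{y..b}"] unfolding set_integrable_def
          by (intro borel_measurable_integrable) (auto simp: y_def)
      qed
      also have "\<dots> = (f b - f y) - (f b - f y)"
      proof -
        have "{y..b} \<subseteq> {a..b}" by (auto simp: y_def)
        with assms True have "set_integrable lborel {y..b} g" "f b - f y = (LBINT r:{y..b}. g r)"
          "set_integrable lborel {y..b} g'" "f b - f y = (LBINT r:{y..b}. g' r)"
          unfolding has_wderiv_def by blast+
        then show ?thesis using set_integral_diff(2)[of lborel "{y..b}" g g'] by simp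
      qed
      finally show ?thesis by simp
    next
      case False
      then have "(\<lambda>z. indicator {x<..} z *\<^sub>R h z) = (\<lambda>z. 0)" using \<open>a \<le> b\<close> by (auto simp: h_def y_def indicator_def max_def split: if_splits)
      then show ?thesis unfolding set_lebesgue_integral_def by simp
    qed
  qed
  then show ?thesis by eventually_elim (auto simp: h_def indicator_def)
qed auto

text \<open>The interval is a countable union of compact intervals starting at 1/(n+1), each with
  its own null set of exceptions.\<close>

lemma has_wderiv_unique_Ioc:
  assumes "has_wderiv {0<..c} f g" "has_wderiv {0<..c} f g'"
  shows "AE x in lborel. x \<in> {0<..c} \<longrightarrow> g x = g' x"
proof -
  have "AE x in lborel. \<forall>n. x \<in> {inverse (real (Suc n))..c} \<longrightarrow> g x = g' x"
    unfolding AE_all_countable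
  proof
    fix n
    have "0 < inverse (real (Suc n))" by simp
    then have "{inverse (real (Suc n))..c} \<subseteq> {0<..c}"
      by (metis atLeastAtMost_iff greaterThanAtMost_iff less_le_trans subsetI)
    then show "AE x in lborel. x \<in> {inverse (real (Suc n))..c} \<longrightarrow> g x = g' x"
      using assms by (intro has_wderiv_unique_Icc[where f=f]) (blast intro: has_wderiv_mono)+
  qed
  then show ?thesis
  proof eventually_elim
    case (elim x)
    show ?case
    proof
      assume x: "x \<in> {0<..c}"
      then obtain n where "inverse (real (Suc n)) < x"
        using reals_Archimedean[of x] by auto
      with x have "x \<in> {inverse (real (Suc n))..c}" by simp
      with elim show "g x = g' x" by blast
    qed
  qed
qed

text \<open>
  The defect of the product rule is additive over adjacent intervals and, by continuity of \<open>f\<close> and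
  \<open>g\<close>, locally at most \<open>e\<close> times the integral of \<open>\<bar>f'\<bar> + \<bar>g'\<bar>\<close>; Bolzano's lemma makes this global.
\<close>

lemma has_wderiv_mult:
  assumes f: "has_wderiv {a..b} f f'" and g: "has_wderiv {a..b} g g'"
  shows "has_wderiv {a..b} (\<lambda>x. f x * g x) (\<lambda>x. f x * g' x + g x * f' x)"
  unfolding has_wderiv_def
proof (intro allI impI)
  fix x y assume xy: "x \<le> y \<and> {x..y} \<subseteq> {a..b}"
  let ?h = "\<lambda>x. f x * g' x + g x * f' x"
  have f: "has_wderiv {x..y} f f'" and g: "has_wderiv {x..y} g g'"
    using xy f g has_wderiv_mono by blast+
  have int: "integrable (lborel_on {u..v}) ?h" "integrable (lborel_on {u..v}) f'" "integrable (lborel_on {u..v}) g'"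
     "continuous_on {u..v} f" "continuous_on {u..v} g"
     "f v - f u = integral\<^sup>L (lborel_on {u..v}) f'" "g v - g u = integral\<^sup>L (lborel_on {u..v}) g'"
    if "x \<le> u" "u \<le> v" "v \<le> y" for u v
  proof -
    have "has_wderiv {u..v} f f'" "has_wderiv {u..v} g g'"
      using that by (auto intro!: has_wderiv_mono[OF f] has_wderiv_mono[OF g])
    then show "integrable (lborel_on {u..v}) ?h" "integrable (lborel_on {u..v}) f'" "integrable (lborel_on {u..v}) g'"
     "continuous_on {u..v} f" "continuous_on {u..v} g"
     "f v - f u = integral\<^sup>L (lborel_on {u..v}) f'" "g v - g u = integral\<^sup>L (lborel_on {u..v}) g'"
      using that by (auto intro!: integrable_Icc_mult_continuous has_wderiv_continuous_Icc dest: has_wderiv_Icc[OF _ order_refl])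
  qed
  define W where "W = (\<lambda>s. \<bar>f' s\<bar> + \<bar>g' s\<bar>)"
  define I where "I = (\<lambda>(F :: real \<Rightarrow> real) u v. integral\<^sup>L (lborel_on {u..v}) F)"
  have comb: "I F u w = I F u v + I F v w" if "integrable (lborel_on {u..w}) F" "u \<le> v" "v \<le> w" for F u v w
  proof -
    have sub: "set_integrable lborel {u'..v'} F" if "u \<le> u'" "v' \<le> w" for u' v'
      using \<open>integrable (lborel_on {u..w}) F\<close> that by (auto intro: set_integrable_subset simp: set_integral_lborel_on(2)[symmetric])
    have "I F u w = integral {u..w} F" "I F u v = integral {u..v} F" "I F v w = integral {v..w} F"
      unfolding I_def using that sub by (auto simp: set_integral_lborel_on(1)[symmetric] set_borel_integral_eq_integral)
    moreover have "F integrable_on {u..w}" using sub set_borel_integral_eq_integral by blast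
    ultimately show ?thesis using that Henstock_Kurzweil_Integration.integral_combine[of u v w F] by simp
  qed
  define \<Delta> where "\<Delta> = (\<lambda>u v. f v * g v - f u * g u - I ?h u v)"
  have small: "\<bar>\<Delta> x y\<bar> \<le> e * I W x y" if "e > 0" for e
  proof -
    have "x \<le> y" using xy by simp
    \<comment> \<open>Bolzano's lemma ranges over all intervals, also those leaving
      \<open>{x..y}\<close>; the premise inside \<open>P\<close> makes these vacuous.\<close>
    define P where "P = (\<lambda>u v. x \<le> u \<and> v \<le> y \<longrightarrow> \<bar>\<Delta> u v\<bar> \<le> e * I W u v)"
    from \<open>x \<le> y\<close> have "P x y"
    proof (rule Bolzano)
      fix u v w assume trans: "P u v" "P v w" "u \<le> v" "v \<le> w"
      show "P u w" unfolding P_def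
      proof
        assume r: "x \<le> u \<and> w \<le> y"
        then have "\<bar>\<Delta> u v\<bar> \<le> e * I W u v" "\<bar>\<Delta> v w\<bar> \<le> e * I W v w"
          using trans by (auto simp: P_def)
        moreover have "\<Delta> u w = \<Delta> u v + \<Delta> v w"
          unfolding \<Delta>_def using comb[of u w ?h v] int(1)[of u w] r trans by linarith
        moreover have "I W u w = I W u v + I W v w"
          using r trans int(2,3)[of u w] by (intro comb) (auto simp: W_def)
        ultimately show "\<bar>\<Delta> u w\<bar> \<le> e * I W u w" by (simp add: distrib_left)
      qed
    next
      fix z assume local: "x \<le> z" "z \<le> y"
      have cf: "continuous (at z within {x..y}) f" "continuous (at z within {x..y}) g"
        using int(4,5)[of x y] local by (auto simp: continuous_on_eq_continuous_within)
      obtain d1 where d1: "d1 > 0" "\<And>t. t \<in> {x..y} \<Longrightarrow> \<bar>t - z\<bar> < d1 \<Longrightarrow> \<bar>f t - f z\<bar> < e/2"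
        using cf(1)[unfolded continuous_within_eps_delta, rule_format, of "e/2"] \<open>e > 0\<close>
        by (auto simp: dist_real_def)
      obtain d2 where d2: "d2 > 0" "\<And>t. t \<in> {x..y} \<Longrightarrow> \<bar>t - z\<bar> < d2 \<Longrightarrow> \<bar>g t - g z\<bar> < e/2"
        using cf(2)[unfolded continuous_within_eps_delta, rule_format, of "e/2"] \<open>e > 0\<close>
        by (auto simp: dist_real_def)
      show "\<exists>d>0. \<forall>u v. u \<le> z \<and> z \<le> v \<and> v - u < d \<longrightarrow> P u v" unfolding P_def
      proof (intro exI conjI allI impI)
        show "min d1 d2 > 0" using d1 d2 by simp
        fix u v assume uv: "u \<le> z \<and> z \<le> v \<and> v - u < min d1 d2" "x \<le> u \<and> v \<le> y"
        have near: "\<bar>f s - f u\<bar> \<le> e" "\<bar>g v - g s\<bar> \<le> e" if "s \<in> {u..v}" for s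
        proof -
          have "s \<in> {x..y}" "u \<in> {x..y}" "v \<in> {x..y}" "\<bar>s - z\<bar> < d1" "\<bar>s - z\<bar> < d2" "\<bar>u - z\<bar> < d1" "\<bar>v - z\<bar> < d2"
            using that uv by auto
          then show "\<bar>f s - f u\<bar> \<le> e" "\<bar>g v - g s\<bar> \<le> e"
            using d1(2)[of s] d1(2)[of u] d2(2)[of s] d2(2)[of v] by linarith+
        qed
        have ui: "x \<le> u" "u \<le> v" "v \<le> y" using uv by auto
        \<comment> \<open>Freezing the coefficients at opposite ends, \<open>g\<close> at
          \<open>v\<close> and \<open>f\<close> at \<open>u\<close>, makes the difference of
          products telescope with no second-order remainder.\<close>
        have "\<Delta> u v = g v * (f v - f u) + f u * (g v - g u) - I ?h u v" 
          unfolding \<Delta>_def by (simp only: right_diff_distrib) (simp add: mult.commute)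
        also have "\<dots> = integral\<^sup>L (lborel_on {u..v}) (\<lambda>s. g v * f' s + f u * g' s - ?h s)"
        proof -
          have "integral\<^sup>L (lborel_on {u..v}) (\<lambda>s. g v * f' s + f u * g' s - ?h s)
              = g v * integral\<^sup>L (lborel_on {u..v}) f' + f u * integral\<^sup>L (lborel_on {u..v}) g' - I ?h u v"
            unfolding I_def using int(1-3)[OF ui]
            by (subst Bochner_Integration.integral_diff) auto
          then show ?thesis using int(6,7)[OF ui] by simp
        qed
        finally have "\<bar>\<Delta> u v\<bar> = \<bar>integral\<^sup>L (lborel_on {u..v}) (\<lambda>s. g v * f' s + f u * g' s - ?h s)\<bar>"
          by (rule arg_cong)
        also have "\<dots> \<le> integral\<^sup>L (lborel_on {u..v}) (\<lambda>s. \<bar>g v * f' s + f u * g' s - ?h s\<bar>)"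
          by (rule integral_abs_bound)
        also have "\<dots> \<le> integral\<^sup>L (lborel_on {u..v}) (\<lambda>s. e * W s)"
        proof (rule integral_mono)
          fix s assume "s \<in> space (lborel_on {u..v})"
          then have s: "s \<in> {u..v}" by (simp add: space_restrict_space)
          have "g v * f' s + f u * g' s - ?h s = (g v - g s) * f' s - (f s - f u) * g' s"
            by (simp add: algebra_simps)
          then have "\<bar>g v * f' s + f u * g' s - ?h s\<bar> \<le> \<bar>g v - g s\<bar> * \<bar>f' s\<bar> + \<bar>f s - f u\<bar> * \<bar>g' s\<bar>"
            by (metis abs_mult abs_triangle_ineq4)
          also have "\<dots> \<le> e * \<bar>f' s\<bar> + e * \<bar>g' s\<bar>" by (intro add_mono mult_right_mono near s) auto
          finally show "\<bar>g v * f' s + f u * g' s - ?h s\<bar> \<le> e * W s" by (simp add: W_def distrib_left)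
        qed (use int[OF ui] in \<open>auto simp: W_def\<close>)
        also have "\<dots> = e * I W u v" unfolding I_def by simp
        finally show "\<bar>\<Delta> u v\<bar> \<le> e * I W u v" .
      qed
    qed
    then show ?thesis by (simp add: P_def)
  qed
  have "\<Delta> x y = 0"
  proof (rule ccontr)
    assume nz: "\<Delta> x y \<noteq> 0"
    have W0: "I W x y \<ge> 0" unfolding I_def W_def by (rule Bochner_Integration.integral_nonneg) auto
    \<comment> \<open>The summand 1 in the denominator covers \<open>I W x y = 0\<close>; the bound
      \<open>small\<close> would then give a defect smaller than itself.\<close>
    define e where "e = \<bar>\<Delta> x y\<bar> / (2 * (I W x y + 1))"
    have "e > 0" using nz W0 by (simp add: e_def)
    moreover have "e * (2 * (I W x y + 1)) = \<bar>\<Delta> x y\<bar>" using W0 by (simp add: e_def)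
    moreover have "e * I W x y < e * (2 * (I W x y + 1))"
      using \<open>e > 0\<close> W0 by (intro mult_strict_left_mono) auto
    ultimately show False using small[of e] by linarith
  qed
  then have "f y * g y - f x * g x = integral\<^sup>L (lborel_on {x..y}) ?h"
    unfolding \<Delta>_def I_def by linarith
  moreover have "integrable (lborel_on {x..y}) ?h" using int(1)[of x y] xy by simp
  moreover have "{x..y} \<in> sets borel" by simp
  ultimately show "set_integrable lborel {x..y} ?h \<and> f y * g y - f x * g x = (LBINT r:{x..y}. ?h r)"
    using set_integral_lborel_on[of "{x..y}" ?h] by presburger
qed

section \<open>Changing the domain of integration\<close>

lemma integrable_lborel_on_subset:
  fixes F :: "real \<Rightarrow> real"
  assumes "integrable (lborel_on T) F" "S \<subseteq> T" "S \<in> sets borel" "T \<in> sets borel"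
  shows "integrable (lborel_on S) F"
  using set_integrable_subset[of lborel T F S] assms by (simp add: set_integral_lborel_on)

lemma integral_lborel_on_mono_set:
  fixes F :: "real \<Rightarrow> real"
  assumes F: "integrable (lborel_on T) F" and S: "S \<subseteq> T" "S \<in> sets borel" "T \<in> sets borel"
    and nn: "\<And>x. x \<in> T \<Longrightarrow> F x \<ge> 0"
  shows "integral\<^sup>L (lborel_on S) F \<le> integral\<^sup>L (lborel_on T) F"
proof -
  have "integrable lborel (\<lambda>x. indicator T x *\<^sub>R F x)"
    using F S by (simp add: integrable_restrict_space)
  moreover have "integrable lborel (\<lambda>x. indicator S x *\<^sub>R F x)"
    using integrable_lborel_on_subset[OF F S] S by (simp add: integrable_restrict_space)
  ultimately have "(\<integral>x. indicator S x *\<^sub>R F x \<partial>lborel) \<le> (\<integral>x. indicator T x *\<^sub>R F x \<partial>lborel)"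
    using nn S by (intro integral_mono) (auto simp: indicator_def)
  then show ?thesis using S by (simp add: integral_restrict_space)
qed

lemma integral_lborel_on_Un:
  fixes F :: "real \<Rightarrow> real"
  assumes F: "integrable (lborel_on (S \<union> T)) F" and S: "S \<inter> T = {}" "S \<in> sets borel" "T \<in> sets borel"
  shows "integral\<^sup>L (lborel_on (S \<union> T)) F = integral\<^sup>L (lborel_on S) F + integral\<^sup>L (lborel_on T) F"
proof -
  have "integrable (lborel_on S) F" "integrable (lborel_on T) F"
    using integrable_lborel_on_subset[OF F] S by auto
  then show ?thesis
    using set_integral_Un[of S T lborel F] S by (simp add: set_integral_lborel_on)
qed

text \<open>The two truncations of \<open>h\<close> differ by a function supported on at most two
  points, which is integrable with integral 0 for any \<open>h\<close>. The energies use open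
  intervals, the calculus of weak derivatives closed ones.\<close>

lemma lborel_on_Ioo_eq_Icc:
  fixes h :: "real \<Rightarrow> real"
  shows "integrable (lborel_on {a<..<b}) h \<longleftrightarrow> integrable (lborel_on {a..b}) h"
    and "integral\<^sup>L (lborel_on {a<..<b}) h = integral\<^sup>L (lborel_on {a..b}) h"
proof -
  define e where "e = (\<lambda>x. indicator {a..b} x * h x - indicator {a<..<b} x * h x)"
  have e_eq: "e = (\<lambda>x. (if a \<le> b then h a else 0) * indicator {a} x + (if a < b then h b else 0) * indicator {b} x)"
    by (auto simp: e_def indicator_def fun_eq_iff)
  have e: "integrable lborel e" unfolding e_eq by (intro Bochner_Integration.integrable_add integrable_mult_right) auto
  have e0: "integral\<^sup>L lborel e = 0" unfolding e_eq
    by (subst Bochner_Integration.integral_add) (auto simp: measure_def)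
  have 1: "(\<lambda>x. indicator {a..b} x * h x) = (\<lambda>x. indicator {a<..<b} x * h x + e x)"
    and 2: "(\<lambda>x. indicator {a<..<b} x * h x) = (\<lambda>x. indicator {a..b} x * h x - e x)"
    by (auto simp: e_def)
  show i: "integrable (lborel_on {a<..<b}) h \<longleftrightarrow> integrable (lborel_on {a..b}) h"
  proof
    assume "integrable (lborel_on {a<..<b}) h"
    then have "integrable lborel (\<lambda>x. indicator {a<..<b} x * h x + e x)"
      using e by (intro Bochner_Integration.integrable_add) (simp_all add: integrable_restrict_space)
    then show "integrable (lborel_on {a..b}) h" unfolding 1[symmetric] by (simp add: integrable_restrict_space)
  next
    assume "integrable (lborel_on {a..b}) h"
    then have "integrable lborel (\<lambda>x. indicator {a..b} x * h x - e x)"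
      using e by (intro Bochner_Integration.integrable_diff) (simp_all add: integrable_restrict_space)
    then show "integrable (lborel_on {a<..<b}) h" unfolding 2[symmetric] by (simp add: integrable_restrict_space)
  qed
  show "integral\<^sup>L (lborel_on {a<..<b}) h = integral\<^sup>L (lborel_on {a..b}) h"
  proof (cases "integrable (lborel_on {a<..<b}) h")
    case True
    then have "integrable lborel (\<lambda>x. indicator {a<..<b} x * h x)" by (simp add: integrable_restrict_space)
    then have "(\<integral>x. indicator {a<..<b} x * h x + e x \<partial>lborel) = (\<integral>x. indicator {a<..<b} x * h x \<partial>lborel)"
      using e e0 by simp
    then show ?thesis unfolding 1[symmetric] by (simp add: integral_restrict_space)
  next
    case False
    then show ?thesis using i by (simp add: not_integrable_integral_eq)
  qed
qed

lemma has_wderiv_Ioo: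
  assumes "has_wderiv I f g" "{a..b} \<subseteq> I" "a \<le> b"
  shows "integrable (lborel_on {a<..<b}) g" "f b - f a = integral\<^sup>L (lborel_on {a<..<b}) g"
  using has_wderiv_Icc[OF assms] by (simp_all add: lborel_on_Ioo_eq_Icc)

section \<open>Weighted and interior L2 estimates\<close>

text \<open>Splitting \<open>g s\<close> as \<open>(g s * sqrt s) * (1 / sqrt s)\<close> leaves the
  integral of \<open>1 / s\<close>, which is the logarithmic factor. The inequality is obtained by
  integrating the nonnegative function \<open>(g s * s - k)^2 / s\<close>.\<close>

lemma weighted_Cauchy_Schwarz:
  assumes f: "has_wderiv {0<..c} f g" and g: "integrable (lborel_on {0<..<c}) (\<lambda>s. (g s)\<^sup>2 * s)"
    and r: "0 < r" "r \<le> t" "t \<le> c"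
  shows "(f t - f r)\<^sup>2 \<le> (ln t - ln r) * (LINT s|lborel_on {0<..<c}. (g s)\<^sup>2 * s)"
proof (cases "r = t")
  case False
  then have "r < t" using r by simp
  define L where "L = ln t - ln r"
  have L: "L > 0" using r \<open>r < t\<close> by (simp add: L_def)
  \<comment> \<open>This value maximises \<open>2 * k * (f t - f r) - k^2 * L\<close>, the lower
    bound that the square yields.\<close>
  define k where "k = (f t - f r) / L"
  let ?N = "lborel_on {r<..<t}"
  have "{r..t} \<subseteq> {0<..c}" using r by auto
  note 1 = has_wderiv_Ioo[OF f this r(2)]
  have "has_wderiv {r..t} ln (\<lambda>s. 1 / s)"
  proof (rule has_wderiv_DERIV)
    show "continuous_on {r..t} (\<lambda>s. 1 / s)" using r by (intro continuous_intros) auto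
    fix x assume "x \<in> {r..t}"
    then have "x > 0" using r by simp
    then show "(ln has_real_derivative 1 / x) (at x within {r..t})"
      using DERIV_subset[OF DERIV_ln_divide] by blast
  qed
  note 2 = has_wderiv_Ioo[OF this order_refl r(2)]
  have 3: "integrable ?N (\<lambda>s. (g s)\<^sup>2 * s)"
    by (rule integrable_lborel_on_subset[OF g]) (use r in auto)
  have "(LINT s|?N. 2 * k * g s - k\<^sup>2 * (1 / s)) \<le> (LINT s|?N. (g s)\<^sup>2 * s)"
  proof (rule integral_mono)
    show "integrable ?N (\<lambda>s. 2 * k * g s - k\<^sup>2 * (1 / s))"
      using 1(1) 2(1) by (intro Bochner_Integration.integrable_diff integrable_mult_right)
    fix s assume "s \<in> space ?N"
    then have s: "s > 0" using r by (simp add: space_restrict_space)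
    have "0 \<le> (g s * s - k)\<^sup>2 / s" using s by simp
    also have "\<dots> = (g s)\<^sup>2 * s - (2 * k * g s - k\<^sup>2 * (1 / s))"
      using s by (simp add: field_simps power2_eq_square)
    finally show "2 * k * g s - k\<^sup>2 * (1 / s) \<le> (g s)\<^sup>2 * s" by simp
  qed (rule 3)
  also have "(LINT s|?N. 2 * k * g s - k\<^sup>2 * (1 / s)) = 2 * k * (f t - f r) - k\<^sup>2 * L"
    unfolding L_def 1(2) 2(2) integral_mult_right_zero[symmetric]
    using 1(1) 2(1) by (intro Bochner_Integration.integral_diff integrable_mult_right)
  also have "\<dots> = (f t - f r)\<^sup>2 / L" using L by (simp add: k_def field_simps power2_eq_square)
  also have "(LINT s|?N. (g s)\<^sup>2 * s) \<le> (LINT s|lborel_on {0<..<c}. (g s)\<^sup>2 * s)"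
    by (rule integral_lborel_on_mono_set[OF g]) (use r in auto)
  finally have "(f t - f r)\<^sup>2 / L \<le> (LINT s|lborel_on {0<..<c}. (g s)\<^sup>2 * s)" .
  then show ?thesis using L unfolding L_def[symmetric] by (simp add: field_simps)
qed simp

text \<open>For \<open>a = 0\<close> the integrand is unbounded, hence the improper form of the
  fundamental theorem, with one-sided limits of \<open>2 * sqrt r\<close> at the ends.\<close>

lemma inverse_sqrt_integral:
  assumes "0 \<le> a" "a < b"
  shows "integrable (lborel_on {a<..<b}) (\<lambda>r. 1 / sqrt r)"
    and "(LINT r|lborel_on {a<..<b}. 1 / sqrt r) = 2 * sqrt b - 2 * sqrt a"
proof -
  have D: "DERIV (\<lambda>r. 2 * sqrt r) x :> 1 / sqrt x" "isCont (\<lambda>r. 1 / sqrt r) x"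
    if "ereal a < ereal x" for x
  proof -
    have x: "x > 0" using that assms by simp
    then show "DERIV (\<lambda>r. 2 * sqrt r) x :> 1 / sqrt x"
      by (auto intro!: derivative_eq_intros simp: field_simps)
    show "isCont (\<lambda>r. 1 / sqrt r) x" using x by (intro continuous_intros) auto
  qed
  have "isCont (\<lambda>r. 2 * sqrt r) y" for y by (intro continuous_intros)
  then have "((\<lambda>r. 2 * sqrt r) \<longlongrightarrow> 2 * sqrt y) (at y within S)" for y S
    using continuous_at_imp_continuous_at_within continuous_within by blast
  then have l: "(((\<lambda>r. 2 * sqrt r) \<circ> real_of_ereal) \<longlongrightarrow> 2 * sqrt a) (at_right (ereal a))"
    "(((\<lambda>r. 2 * sqrt r) \<circ> real_of_ereal) \<longlongrightarrow> 2 * sqrt b) (at_left (ereal b))"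
    by (simp_all only: ereal_tendsto_simps)
  have "ereal a < ereal b" using assms by simp
  moreover have "AE x in lborel. ereal a < ereal x \<longrightarrow> ereal x < ereal b \<longrightarrow> 0 \<le> 1 / sqrt x"
    using assms by auto
  ultimately have *: "set_integrable lborel (einterval (ereal a) (ereal b)) (\<lambda>r. 1 / sqrt r)"
    "(LBINT r=ereal a..ereal b. 1 / sqrt r) = 2 * sqrt b - 2 * sqrt a"
    using interval_integral_FTC_nonneg[OF _ D(1) D(2) _ l] by auto
  show "integrable (lborel_on {a<..<b}) (\<lambda>r. 1 / sqrt r)"
    using *(1) by (simp add: set_integral_lborel_on)
  show "(LINT r|lborel_on {a<..<b}. 1 / sqrt r) = 2 * sqrt b - 2 * sqrt a"
    using *(2) assms by (simp add: interval_lebesgue_integral_def set_integral_lborel_on)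
qed

text \<open>The minimum of the square is at most its mean. This supplies a reference point at which
  \<open>f\<close> is controlled by an interior integral.\<close>

lemma exists_sq_le_integral:
  fixes f :: "real \<Rightarrow> real"
  assumes "a < b" "continuous_on {a..b} f"
  shows "\<exists>t\<in>{a..b}. (b - a) * (f t)\<^sup>2 \<le> (LINT r|lborel_on {a..b}. (f r)\<^sup>2)"
proof -
  have c: "continuous_on {a..b} (\<lambda>r. (f r)\<^sup>2)" using assms by (intro continuous_intros)
  obtain t where t: "t \<in> {a..b}" "\<And>r. r \<in> {a..b} \<Longrightarrow> (f t)\<^sup>2 \<le> (f r)\<^sup>2"
    using continuous_attains_inf[OF compact_Icc _ c] assms by auto
  have "(LINT r|lborel_on {a..b}. (f t)\<^sup>2) \<le> (LINT r|lborel_on {a..b}. (f r)\<^sup>2)"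
    by (intro integral_mono integrable_Icc_continuous c)
       (auto intro!: t(2) integrable_Icc_continuous simp: space_restrict_space)
  moreover have "(LINT r|lborel_on {a..b}. (f t)\<^sup>2) = (b - a) * (f t)\<^sup>2"
    using assms by (simp add: measure_restrict_space space_restrict_space)
  ultimately show ?thesis using t(1) by (intro bexI[of _ t]) auto
qed

text \<open>Moving from a reference point \<open>t\<close> costs only the square root of a
  logarithm. Bounding that logarithm by a multiple of \<open>1 / sqrt r\<close> gives an integrable
  majorant of the square of \<open>f\<close>, whose integral over the two end pieces is small when
  these are short.\<close>

lemma L2_norm_le_interior:
  fixes c \<tau> :: real
  assumes c: "c > 0" and \<tau>: "\<tau> > 0"
  shows "\<exists>a b. 0 < a \<and> a < b \<and> b < c \<and>
    (\<forall>f g. has_wderiv {0<..c} f g \<longrightarrow> integrable (lborel_on {0<..<c}) (\<lambda>s. (g s)\<^sup>2 * s) \<longrightarrow>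
      integrable (lborel_on {0<..<c}) (\<lambda>r. (f r)\<^sup>2) \<and>
      (LINT r|lborel_on {0<..<c}. (f r)\<^sup>2) \<le>
        \<tau> * (LINT s|lborel_on {0<..<c}. (g s)\<^sup>2 * s) + 2 * (LINT r|lborel_on {a<..<b}. (f r)\<^sup>2))"
proof -
  let ?w = "\<lambda>r::real. 1 / sqrt r"
  define q where "q = sqrt c"
  have q: "q > 0" "q * q = c" using c by (auto simp: q_def)
  \<comment> \<open>With \<open>sqrt a = \<eta>\<close> and \<open>sqrt b = q - \<eta>\<close> each
    end piece contributes \<open>2 * \<eta>\<close> to the integral of \<open>1 / sqrt r\<close>.
    The bound by \<open>q / 4\<close> keeps \<open>{c/4..c/2}\<close> inside
    \<open>{a<..<b}\<close>; the other two absorb the gradient part into \<open>\<tau> * I\<close>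
    and the value at \<open>t\<close> into \<open>X\<close>.\<close>
  define \<eta> where "\<eta> = min (q / 4) (min (\<tau> / (32 * q)) (q / 32))"
  have \<eta>: "\<eta> > 0" "\<eta> \<le> q / 4" "32 * q * \<eta> \<le> \<tau>" "32 * \<eta> \<le> q"
    using q \<tau> by (auto simp: \<eta>_def min_def field_simps)
  define a where "a = \<eta>\<^sup>2"
  define b where "b = (q - \<eta>)\<^sup>2"
  have sa: "sqrt a = \<eta>" and sb: "sqrt b = q - \<eta>" using \<eta> q by (auto simp: a_def b_def)
  have a: "0 < a" "a < c / 4"
  proof -
    have "\<eta>\<^sup>2 \<le> (q / 4)\<^sup>2" using \<eta> by (intro power_mono) auto
    then show "a < c / 4" using q c by (simp add: a_def power2_eq_square)
  qed (use \<eta> in \<open>simp add: a_def\<close>)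
  have b: "c / 2 < b" "b < c"
  proof -
    have "(3 * q / 4)\<^sup>2 \<le> (q - \<eta>)\<^sup>2" using \<eta> q by (intro power_mono) auto
    then show "c / 2 < b" using q c by (simp add: b_def power2_eq_square)
    have "(q - \<eta>)\<^sup>2 < q\<^sup>2" using \<eta> q by (intro power_strict_mono) auto
    then show "b < c" using q by (simp add: b_def power2_eq_square)
  qed
  show ?thesis
  proof (intro exI conjI allI impI)
    show "0 < a" "a < b" "b < c" using a b c by auto
    fix f g
    assume f: "has_wderiv {0<..c} f g" and g: "integrable (lborel_on {0<..<c}) (\<lambda>s. (g s)\<^sup>2 * s)"
    define I where "I = (LINT s|lborel_on {0<..<c}. (g s)\<^sup>2 * s)"
    define X where "X = (LINT r|lborel_on {a<..<b}. (f r)\<^sup>2)"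
    have "I \<ge> 0" unfolding I_def by (rule Bochner_Integration.integral_nonneg) (auto simp: space_restrict_space)
    have "X \<ge> 0" unfolding X_def by (rule Bochner_Integration.integral_nonneg) auto
    have cf: "continuous_on {0<..c} f" by (rule has_wderiv_continuous_Ioc[OF f])
    have cf2: "continuous_on {u..v} (\<lambda>r. (f r)\<^sup>2)" if "0 < u" "v \<le> c" for u v
      by (intro continuous_intros continuous_on_subset[OF cf]) (use that in auto)
    have "continuous_on {c/4..c/2} f" by (rule continuous_on_subset[OF cf]) (use c in auto)
    then obtain t where t: "t \<in> {c/4..c/2}" "(c/2 - c/4) * (f t)\<^sup>2 \<le> (LINT r|lborel_on {c/4..c/2}. (f r)\<^sup>2)"
      using exists_sq_le_integral[of "c/4" "c/2" f] c by auto
    have "(LINT r|lborel_on {c/4..c/2}. (f r)\<^sup>2) \<le> X" unfolding X_def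
    proof (rule integral_lborel_on_mono_set)
      have "integrable (lborel_on {a..b}) (\<lambda>r. (f r)\<^sup>2)"
        by (rule integrable_Icc_continuous[OF cf2]) (use a b in auto)
      then show "integrable (lborel_on {a<..<b}) (\<lambda>r. (f r)\<^sup>2)" by (simp add: lborel_on_Ioo_eq_Icc)
    qed (use a b in auto)
    with t have t2: "c * (f t)\<^sup>2 \<le> 4 * X" by simp
    \<comment> \<open>From \<open>(f r)^2 \<le> 2 * (f t)^2 + 2 * (f t - f r)^2\<close>, using
      \<open>1 \<le> q / sqrt r\<close> for the first term and the logarithm bound
      \<open>4 * q / sqrt r\<close> for the second.\<close>
    define H where "H = 2 * q * (f t)\<^sup>2 + 8 * q * I"
    have bound: "(f r)\<^sup>2 \<le> H * ?w r" if r: "r \<in> {0<..<c}" for r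
    proof -
      have t0: "t > 0" "t \<le> c / 2" "t \<ge> c / 4" using t c by auto
      have sr: "0 < sqrt r" "sqrt r \<le> q" using r by (auto simp: q_def)
      \<comment> \<open>A logarithm is twice the logarithm of the square root, and
        \<open>ln y \<le> y\<close>. The side condition allows both orders of \<open>r\<close> and
        \<open>t\<close>; for \<open>r\<close> beyond \<open>t\<close> it holds because
        \<open>sqrt t\<close> is at least \<open>q / 2\<close>.\<close>
      have ln_le: "ln u - ln v \<le> 4 * q * ?w r" if uv: "0 < u" "0 < v" "sqrt u * sqrt r \<le> 2 * q * sqrt v" for u v
      proof -
        have "ln u - ln v = 2 * ln (sqrt u / sqrt v)" using uv by (simp add: ln_div ln_sqrt)
        also have "ln (sqrt u / sqrt v) \<le> sqrt u / sqrt v"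
          using ln_le_minus_one[of "sqrt u / sqrt v"] uv by simp
        also have "\<dots> \<le> 2 * q * ?w r" using uv sr by (simp add: field_simps)
        finally show ?thesis by simp
      qed
      have st: "sqrt t \<le> q" "q \<le> 2 * sqrt t"
      proof -
        show "sqrt t \<le> q" using t0 c by (simp add: q_def)
        have "sqrt c \<le> sqrt (4 * t)" using t0 by (intro real_sqrt_le_mono) auto
        then show "q \<le> 2 * sqrt t" by (simp add: q_def real_sqrt_mult)
      qed
      have d: "(f t - f r)\<^sup>2 \<le> 4 * q * ?w r * I"
      proof (cases "r \<le> t")
        case True
        have "(f t - f r)\<^sup>2 \<le> (ln t - ln r) * I" unfolding I_def
          by (rule weighted_Cauchy_Schwarz[OF f g]) (use r t0 True in auto)
        also have "\<dots> \<le> 4 * q * ?w r * I"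
          using r t0 st sr q \<open>I \<ge> 0\<close> by (intro mult_right_mono ln_le) auto
        finally show ?thesis .
      next
        case False
        have "(f t - f r)\<^sup>2 = (f r - f t)\<^sup>2" by (rule power2_commute)
        also have "\<dots> \<le> (ln r - ln t) * I" unfolding I_def
          by (rule weighted_Cauchy_Schwarz[OF f g]) (use r t0 False in auto)
        also have "\<dots> \<le> 4 * q * ?w r * I"
        proof (intro mult_right_mono ln_le)
          have "sqrt r * sqrt r \<le> q * q" using sr q by (intro mult_mono) auto
          also have "\<dots> \<le> q * (2 * sqrt t)" using st q by (intro mult_left_mono) auto
          finally show "sqrt r * sqrt r \<le> 2 * q * sqrt t" by simp
        qed (use r t0 \<open>I \<ge> 0\<close> in auto)
        finally show ?thesis .
      qed
      have "f r = f t - (f t - f r)" by simp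
      then have "(f r)\<^sup>2 \<le> 2 * (f t)\<^sup>2 + 2 * (f t - f r)\<^sup>2"
        using sum_squares_bound[of "f t" "f t - f r"] zero_le_power2[of "f t + (f t - f r)"]
        by (simp add: power2_eq_square algebra_simps)
      also have "\<dots> \<le> 2 * (f t)\<^sup>2 * (q * ?w r) + 2 * (4 * q * ?w r * I)"
      proof (intro add_mono mult_left_mono d)
        have "1 \<le> q * ?w r" using sr by simp
        then show "2 * (f t)\<^sup>2 \<le> 2 * (f t)\<^sup>2 * (q * ?w r)"
          using mult_left_mono[of 1 "q * ?w r" "2 * (f t)\<^sup>2"] by simp
      qed auto
      also have "\<dots> = H * ?w r" by (simp add: H_def algebra_simps)
      finally show ?thesis .
    qed
    have w: "integrable (lborel_on {0<..<c}) ?w" "integrable (lborel_on {a<..<b}) ?w"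
      using inverse_sqrt_integral(1)[of 0 c] inverse_sqrt_integral(1)[of a b] a b c by auto
    show f2: "integrable (lborel_on {0<..<c}) (\<lambda>r. (f r)\<^sup>2)"
    proof (rule Bochner_Integration.integrable_bound)
      show "integrable (lborel_on {0<..<c}) (\<lambda>r. H * ?w r)" using w by (intro integrable_mult_right)
      have "continuous_on {0<..<c} f" by (rule continuous_on_subset[OF cf]) auto
      then have "f \<in> borel_measurable (lborel_on {0<..<c})" by (rule measurable_lborel_on_continuous) simp
      then show "(\<lambda>r. (f r)\<^sup>2) \<in> borel_measurable (lborel_on {0<..<c})" by measurable
      show "AE r in lborel_on {0<..<c}. norm ((f r)\<^sup>2) \<le> norm (H * ?w r)"
      proof (rule AE_I2)
        fix r assume "r \<in> space (lborel_on {0<..<c})"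
        then have "(f r)\<^sup>2 \<le> H * ?w r" by (intro bound) (simp add: space_restrict_space)
        then show "norm ((f r)\<^sup>2) \<le> norm (H * ?w r)"
          unfolding real_norm_def by (metis abs_ge_self abs_power2 order_trans)
      qed
    qed
    let ?T = "{0<..<c} - {a<..<b}"
    have un: "{0<..<c} = {a<..<b} \<union> ?T" using a b by auto
    have split: "integral\<^sup>L (lborel_on {0<..<c}) F
        = integral\<^sup>L (lborel_on {a<..<b}) F + integral\<^sup>L (lborel_on ?T) F"
      if "integrable (lborel_on {0<..<c}) F" for F :: "real \<Rightarrow> real"
      using integral_lborel_on_Un[of "{a<..<b}" ?T F] that un by auto
    have "(LINT r|lborel_on ?T. (f r)\<^sup>2) \<le> (LINT r|lborel_on ?T. H * ?w r)"
    proof (rule integral_mono)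
      show "integrable (lborel_on ?T) (\<lambda>r. (f r)\<^sup>2)"
        by (rule integrable_lborel_on_subset[OF f2]) auto
      show "integrable (lborel_on ?T) (\<lambda>r. H * ?w r)"
        by (intro integrable_mult_right integrable_lborel_on_subset[OF w(1)]) auto
    qed (rule bound, simp add: space_restrict_space)
    also have "\<dots> = H * (LINT r|lborel_on ?T. ?w r)" by (rule integral_mult_right_zero)
    also have "(LINT r|lborel_on ?T. ?w r) = 4 * \<eta>"
      using split[OF w(1)] inverse_sqrt_integral(2)[of 0 c] inverse_sqrt_integral(2)[of a b] a b c
      by (simp add: sa sb q_def[symmetric])
    \<comment> \<open>This \<open>X\<close> pays for the value at the reference point; together with
      the integral over \<open>{a<..<b}\<close> itself it makes the factor 2 of the
      statement.\<close>
    also have "H * (4 * \<eta>) \<le> \<tau> * I + X"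
    proof -
      have "8 * q * I * (4 * \<eta>) = (32 * q * \<eta>) * I" by simp
      also have "\<dots> \<le> \<tau> * I" using \<eta> \<open>I \<ge> 0\<close> by (intro mult_right_mono)
      finally have 1: "8 * q * I * (4 * \<eta>) \<le> \<tau> * I" .
      have "2 * q * (f t)\<^sup>2 * (4 * \<eta>) = 32 * \<eta> * (q * (f t)\<^sup>2) / 4" by simp
      also have "\<dots> \<le> q * (q * (f t)\<^sup>2) / 4"
        using \<eta> q by (intro divide_right_mono mult_right_mono) auto
      also have "\<dots> = c * (f t)\<^sup>2 / 4" using q by (metis mult.assoc)
      also have "\<dots> \<le> X" using t2 by simp
      finally show ?thesis using 1 unfolding H_def by (simp add: distrib_right)
    qed
    finally show "(LINT r|lborel_on {0<..<c}. (f r)\<^sup>2) \<le> \<tau> * I + 2 * X"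
      using split[OF f2] unfolding X_def by linarith
  qed
qed

text \<open>
  The integral of the derivative of \<open>\<phi> v \<xi>\<close> vanishes for the cut-off \<open>\<phi> r = (r - a') (b' - r)\<close>;
  substituting \<open>v' = \<kappa> w \<xi> + G\<close> isolates \<open>\<kappa> \<integral> \<phi> w \<xi>\<^sup>2\<close>.
\<close>

lemma interior_estimate:
  fixes a' a b b' w\<^sub>0 :: real and w :: "real \<Rightarrow> real"
  assumes ab: "a' < a" "a < b" "b < b'" and w: "continuous_on {a'..b'} w" "w\<^sub>0 > 0" "\<And>r. r \<in> {a'..b'} \<Longrightarrow> w r \<ge> w\<^sub>0"
  shows "\<exists>C>0. \<forall>\<kappa> \<xi> \<xi>' v v'. has_wderiv {a'..b'} \<xi> \<xi>' \<longrightarrow> has_wderiv {a'..b'} v v' \<longrightarrow>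
     integrable (lborel_on {a'..b'}) (\<lambda>r. (\<xi>' r)\<^sup>2) \<longrightarrow>
     integrable (lborel_on {a'..b'}) (\<lambda>r. (v' r - \<kappa> * w r * \<xi> r)\<^sup>2) \<longrightarrow>
     \<bar>\<kappa>\<bar> * (LINT r|lborel_on {a<..<b}. (\<xi> r)\<^sup>2) \<le>
       C * (LINT r|lborel_on {a'..b'}. (\<xi> r)\<^sup>2 + (v r)\<^sup>2 + (\<xi>' r)\<^sup>2 + (v' r - \<kappa> * w r * \<xi> r)\<^sup>2)"
proof -
  let ?N = "lborel_on {a'..b'}"
  define l where "l = b' - a'"
  have l: "l > 0" using ab by (simp add: l_def)
  define \<phi> where "\<phi> = (\<lambda>r. (r - a') * (b' - r))"
  define \<phi>' where "\<phi>' = (\<lambda>r. a' + b' - 2 * r)"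
  define \<phi>\<^sub>0 where "\<phi>\<^sub>0 = (a - a') * (b' - b)"
  have \<phi>0: "\<phi>\<^sub>0 > 0" using ab by (simp add: \<phi>\<^sub>0_def)
  have \<phi>_ge: "\<phi> r \<ge> \<phi>\<^sub>0" if "r \<in> {a<..<b}" for r
    unfolding \<phi>_def \<phi>\<^sub>0_def using that ab by (intro mult_mono) auto
  have \<phi>_bd: "0 \<le> \<phi> r" "\<phi> r \<le> l * l" "\<bar>\<phi>' r\<bar> \<le> l" if "r \<in> {a'..b'}" for r
    using that unfolding \<phi>_def \<phi>'_def l_def by (auto intro!: mult_mono)
  \<comment> \<open>The cut-off is at most \<open>l * l\<close> and its derivative at most
    \<open>l\<close> in modulus, so \<open>l * l + l\<close> bounds the error against
    \<open>Q\<close>; the factor 2 is slack.\<close>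
  define K where "K = 2 * (l * l + l)"
  have K: "K > 0" using l by (simp add: K_def add_pos_pos)
  have \<phi>: "has_wderiv {a'..b'} \<phi> \<phi>'" unfolding \<phi>_def \<phi>'_def
    by (rule has_wderiv_DERIV) (auto intro!: derivative_eq_intros continuous_intros)
  show ?thesis
  proof (intro exI[of _ "K / (w\<^sub>0 * \<phi>\<^sub>0)"] conjI allI impI)
    show "K / (w\<^sub>0 * \<phi>\<^sub>0) > 0" using K w \<phi>0 by simp
    fix \<kappa> :: real and \<xi> \<xi>' v v'
    assume \<xi>: "has_wderiv {a'..b'} \<xi> \<xi>'" and v: "has_wderiv {a'..b'} v v'"
      and \<xi>'2: "integrable ?N (\<lambda>r. (\<xi>' r)\<^sup>2)"
      and G2: "integrable ?N (\<lambda>r. (v' r - \<kappa> * w r * \<xi> r)\<^sup>2)"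
    define G where "G = (\<lambda>r. v' r - \<kappa> * w r * \<xi> r)"
    define R where "R = (\<lambda>r. \<phi> r * (v r * \<xi>' r + \<xi> r * v' r) + v r * \<xi> r * \<phi>' r)"
    define S where "S = (\<lambda>r. \<kappa> * (\<phi> r * w r * (\<xi> r)\<^sup>2))"
    define Q where "Q = (\<lambda>r. (\<xi> r)\<^sup>2 + (v r)\<^sup>2 + (\<xi>' r)\<^sup>2 + (G r)\<^sup>2)"
    have c: "continuous_on {a'..b'} \<xi>" "continuous_on {a'..b'} v" "continuous_on {a'..b'} \<phi>"
      using has_wderiv_continuous_Icc \<xi> v \<phi> by auto
    have R: "has_wderiv {a'..b'} (\<lambda>r. \<phi> r * (v r * \<xi> r)) R" unfolding R_def
      by (rule has_wderiv_mult[OF \<phi> has_wderiv_mult[OF v \<xi>]])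
    have iR: "integrable ?N R" using has_wderiv_Icc(1)[OF R] ab by simp
    have R0: "integral\<^sup>L ?N R = 0" using has_wderiv_Icc(2)[OF R order_refl] ab by (simp add: \<phi>_def)
    have iS: "integrable ?N S" unfolding S_def
      by (intro integrable_Icc_continuous continuous_intros c w)
    have iQ: "integrable ?N Q" unfolding Q_def G_def
      by (intro Bochner_Integration.integrable_add \<xi>'2 G2 integrable_Icc_continuous continuous_intros c)
    have i\<xi>: "integrable ?N (\<lambda>r. (\<xi> r)\<^sup>2)" "integrable ?N (\<lambda>r. \<phi> r * w r * (\<xi> r)\<^sup>2)"
      by (intro integrable_Icc_continuous continuous_intros c w)+
    have RS: "\<bar>R r - S r\<bar> \<le> K * Q r" if r: "r \<in> {a'..b'}" for r
    proof -
      have xy: "\<bar>x * y\<bar> \<le> x\<^sup>2 + y\<^sup>2" for x y :: real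
      proof -
        have "2 * (\<bar>x\<bar> * \<bar>y\<bar>) \<le> x\<^sup>2 + y\<^sup>2"
          using sum_squares_bound[of "\<bar>x\<bar>" "\<bar>y\<bar>"] by (simp add: mult.assoc)
        moreover have "0 \<le> \<bar>x\<bar> * \<bar>y\<bar>" by simp
        ultimately show ?thesis unfolding abs_mult by linarith
      qed
      have "R r - S r = \<phi> r * (v r * \<xi>' r) + \<phi> r * (\<xi> r * G r) + \<phi>' r * (v r * \<xi> r)"
        unfolding R_def S_def G_def by (simp add: algebra_simps power2_eq_square)
      also have "\<bar>\<dots>\<bar> \<le> \<phi> r * \<bar>v r * \<xi>' r\<bar> + \<phi> r * \<bar>\<xi> r * G r\<bar> + \<bar>\<phi>' r\<bar> * \<bar>v r * \<xi> r\<bar>"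
        using \<phi>_bd(1)[OF r] by (intro order_trans[OF abs_triangle_ineq] add_mono) (auto simp: abs_mult)
      also have "\<dots> \<le> l * l * ((v r)\<^sup>2 + (\<xi>' r)\<^sup>2) + l * l * ((\<xi> r)\<^sup>2 + (G r)\<^sup>2) + l * ((v r)\<^sup>2 + (\<xi> r)\<^sup>2)"
        using \<phi>_bd[OF r] l by (intro add_mono mult_mono xy) auto
      also have "\<dots> = l * l * Q r + l * ((v r)\<^sup>2 + (\<xi> r)\<^sup>2)" by (simp add: Q_def algebra_simps)
      also have "\<dots> \<le> l * l * Q r + l * Q r" using l by (intro add_mono mult_left_mono) (auto simp: Q_def)
      also have "\<dots> = (l * l + l) * Q r" by (simp add: algebra_simps)
      also have "\<dots> \<le> K * Q r" using l by (intro mult_right_mono) (auto simp: Q_def K_def)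
      finally show ?thesis .
    qed
    have "\<bar>integral\<^sup>L ?N S\<bar> = \<bar>LINT r|?N. R r - S r\<bar>" using iR iS R0 by simp
    also have "\<dots> \<le> (LINT r|?N. \<bar>R r - S r\<bar>)" by (rule integral_abs_bound)
    also have "\<dots> \<le> (LINT r|?N. K * Q r)"
      using iR iS iQ by (intro integral_mono RS) (auto simp: space_restrict_space)
    finally have 1: "\<bar>integral\<^sup>L ?N S\<bar> \<le> K * integral\<^sup>L ?N Q" by simp
    have "(LINT r|lborel_on {a<..<b}. w\<^sub>0 * \<phi>\<^sub>0 * (\<xi> r)\<^sup>2) \<le> (LINT r|lborel_on {a<..<b}. \<phi> r * w r * (\<xi> r)\<^sup>2)"
    proof (rule integral_mono)
      have "{a<..<b} \<subseteq> {a'..b'}" using ab by auto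
      note sub = integrable_lborel_on_subset[OF _ this]
      show "integrable (lborel_on {a<..<b}) (\<lambda>r. w\<^sub>0 * \<phi>\<^sub>0 * (\<xi> r)\<^sup>2)"
        by (intro integrable_mult_right sub i\<xi>) auto
      show "integrable (lborel_on {a<..<b}) (\<lambda>r. \<phi> r * w r * (\<xi> r)\<^sup>2)"
        by (intro sub i\<xi>) auto
      fix r assume "r \<in> space (lborel_on {a<..<b})"
      then have r: "r \<in> {a<..<b}" by (simp add: space_restrict_space)
      then have r': "r \<in> {a'..b'}" using ab by auto
      have "\<phi>\<^sub>0 * w\<^sub>0 \<le> \<phi> r * w r"
        using \<phi>_ge[OF r] w(2) w(3)[OF r'] \<phi>0 by (intro mult_mono) auto
      then show "w\<^sub>0 * \<phi>\<^sub>0 * (\<xi> r)\<^sup>2 \<le> \<phi> r * w r * (\<xi> r)\<^sup>2"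
        by (intro mult_right_mono) (auto simp: mult.commute)
    qed
    also have "\<dots> \<le> (LINT r|?N. \<phi> r * w r * (\<xi> r)\<^sup>2)"
    proof (rule integral_lborel_on_mono_set[OF i\<xi>(2)])
      fix r assume r: "r \<in> {a'..b'}"
      show "0 \<le> \<phi> r * w r * (\<xi> r)\<^sup>2"
        using \<phi>_bd(1)[OF r] w(2) w(3)[OF r] by (intro mult_nonneg_nonneg) auto
    qed (use ab in auto)
    finally have "w\<^sub>0 * \<phi>\<^sub>0 * (LINT r|lborel_on {a<..<b}. (\<xi> r)\<^sup>2) \<le> (LINT r|?N. \<phi> r * w r * (\<xi> r)\<^sup>2)" by simp
    then have "\<bar>\<kappa>\<bar> * (w\<^sub>0 * \<phi>\<^sub>0 * (LINT r|lborel_on {a<..<b}. (\<xi> r)\<^sup>2)) \<le> \<bar>\<kappa>\<bar> * (LINT r|?N. \<phi> r * w r * (\<xi> r)\<^sup>2)"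
      by (intro mult_left_mono) auto
    also have "\<dots> \<le> \<bar>integral\<^sup>L ?N S\<bar>" unfolding S_def by (simp add: abs_mult mult_left_mono)
    also note 1
    finally show "\<bar>\<kappa>\<bar> * (LINT r|lborel_on {a<..<b}. (\<xi> r)\<^sup>2) \<le>
       K / (w\<^sub>0 * \<phi>\<^sub>0) * (LINT r|?N. (\<xi> r)\<^sup>2 + (v r)\<^sup>2 + (\<xi>' r)\<^sup>2 + (v' r - \<kappa> * w r * \<xi> r)\<^sup>2)"
      unfolding Q_def G_def using w \<phi>0 by (simp add: field_simps)
  qed
qed

section \<open>Smooth functions and measurability\<close>

text \<open>The mean value theorem turns vanishing on the axis into the linear bound
  \<open>B * r\<close>, which keeps singular quotients such as \<open>f r / r\<close>
  bounded.\<close>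

lemma Cinf_on_deriv_bounds:
  assumes f: "f \<in> Cinf_on 0 c" and c: "c > 0"
  obtains f' B where "\<And>r. r \<in> {0..c} \<Longrightarrow> (f has_real_derivative f' r) (at r within {0..c})"
    "continuous_on {0..c} f'" "B \<ge> 0"
    "\<And>r. r \<in> {0..c} \<Longrightarrow> \<bar>f r\<bar> \<le> B" "\<And>r. r \<in> {0..c} \<Longrightarrow> \<bar>f' r\<bar> \<le> B"
    "\<And>r. f 0 = 0 \<Longrightarrow> r \<in> {0..c} \<Longrightarrow> \<bar>f r\<bar> \<le> B * r"
proof -
  obtain D where D: "D 0 = f" "\<And>n r. r \<in> {0..c} \<Longrightarrow> (D n has_real_derivative D (Suc n) r) (at r within {0..c})"
    using f unfolding Cinf_on_def by blast
  have cont: "continuous_on {0..c} (D n)" for n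
    using D(2) by (meson DERIV_continuous continuous_on_eq_continuous_within)
  have bd: "\<exists>B. \<forall>r\<in>{0..c}. \<bar>D n r\<bar> \<le> B" for n
    using compact_imp_bounded[OF compact_continuous_image[OF cont compact_Icc]]
    unfolding bounded_iff by (metis imageI real_norm_def)
  obtain B0 where B0: "\<And>r. r \<in> {0..c} \<Longrightarrow> \<bar>D 0 r\<bar> \<le> B0" using bd by blast
  obtain B1 where B1: "\<And>r. r \<in> {0..c} \<Longrightarrow> \<bar>D (Suc 0) r\<bar> \<le> B1" using bd by blast
  have d: "(f has_real_derivative D (Suc 0) r) (at r within {0..c})" if "r \<in> {0..c}" for r
    using D(2)[OF that, of 0] D(1) by simp
  have lin: "\<bar>f r\<bar> \<le> max B0 B1 * r" if "f 0 = 0" "r \<in> {0..c}" for r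
  proof -
    have "norm (f r - f 0) \<le> max B0 B1 * norm (r - 0)"
    proof (rule field_differentiable_bound)
      show "convex {0..c}" by simp
      fix z assume "z \<in> {0..c}"
      then show "(f has_field_derivative D (Suc 0) z) (at z within {0..c})" "norm (D (Suc 0) z) \<le> max B0 B1"
        using d B1 by (auto simp: le_max_iff_disj)
    qed (use that c in auto)
    then show ?thesis using that by simp
  qed
  show thesis
  proof (rule that[of "D (Suc 0)" "max B0 B1"])
    show "max B0 B1 \<ge> 0" using B0[of 0] c by (auto simp: le_max_iff_disj intro: order_trans[OF abs_ge_zero])
    show "\<bar>f r\<bar> \<le> max B0 B1" if "r \<in> {0..c}" for r using B0[OF that] D(1) by (simp add: le_max_iff_disj)
    show "\<bar>D (Suc 0) r\<bar> \<le> max B0 B1" if "r \<in> {0..c}" for r using B1[OF that] by (simp add: le_max_iff_disj)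
  qed (use d cont lin in auto)
qed

lemma has_wderiv_Ioc_DERIV:
  assumes "\<And>r. r \<in> {0..c} \<Longrightarrow> (f has_real_derivative f' r) (at r within {0..c})" "continuous_on {0..c} f'"
  shows "has_wderiv {0<..c} f f'"
proof (rule has_wderiv_DERIV)
  show "continuous_on {0<..c} f'" by (rule continuous_on_subset[OF assms(2)]) auto
  show "(f has_real_derivative f' x) (at x within {0<..c})" if "x \<in> {0<..c}" for x
    by (rule DERIV_subset[OF assms(1)]) (use that in auto)
qed

text \<open>\<open>f\<close> is continuous, and \<open>g\<close> is the pointwise limit of its
  truncations to compact intervals away from 0, each of which is integrable.\<close>

lemma has_wderiv_measurable:
  assumes f: "has_wderiv {0<..c} f g"
  shows "f \<in> borel_measurable (lborel_on {0<..<c})" "g \<in> borel_measurable (lborel_on {0<..<c})"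
proof -
  show "f \<in> borel_measurable (lborel_on {0<..<c})"
    by (intro measurable_lborel_on_continuous continuous_on_subset[OF has_wderiv_continuous_Ioc[OF f]]) auto
  show "g \<in> borel_measurable (lborel_on {0<..<c})"
  proof (rule borel_measurable_LIMSEQ_real)
    fix n
    let ?S = "{inverse (real (Suc n))..c}"
    have "0 < inverse (real (Suc n))" by simp
    then have "?S \<subseteq> {0<..c}" by (metis atLeastAtMost_iff greaterThanAtMost_iff less_le_trans subsetI)
    then have "integrable (lborel_on ?S) g"
    proof (cases "inverse (real (Suc n)) \<le> c")
      case True
      with \<open>?S \<subseteq> {0<..c}\<close> show ?thesis by (rule has_wderiv_Icc(1)[OF f])
    next
      case False
      then have "?S = {}" by simp
      then show ?thesis by (simp add: integrable_restrict_space)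
    qed
    then have "integrable lborel (\<lambda>r. indicator ?S r *\<^sub>R g r)" by (simp add: integrable_restrict_space)
    then show "(\<lambda>r. indicator ?S r *\<^sub>R g r) \<in> borel_measurable (lborel_on {0<..<c})"
      by (intro measurable_restrict_space1 borel_measurable_integrable)
  next
    fix r assume "r \<in> space (lborel_on {0<..<c})"
    then have r: "0 < r" "r < c" by (auto simp: space_restrict_space)
    have "\<forall>\<^sub>F n in sequentially. inverse (real (Suc n)) < r"
      using order_tendstoD(2)[OF LIMSEQ_inverse_real_of_nat r(1)] .
    then have "\<forall>\<^sub>F n in sequentially. indicator {inverse (real (Suc n))..c} r *\<^sub>R g r = g r"
      by eventually_elim (use r in \<open>auto simp: indicator_def\<close>)
    then show "(\<lambda>n. indicator {inverse (real (Suc n))..c} r *\<^sub>R g r) \<longlonglongrightarrow> g r"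
      by (rule tendsto_eventually)
  qed
qed

lemma sq_le_sq_if_abs_le: "\<bar>x\<bar> \<le> (y::real) \<Longrightarrow> x\<^sup>2 \<le> y\<^sup>2"
  by (metis abs_ge_zero power2_abs power_mono)

lemma power2_diff_le: "(x - y)\<^sup>2 \<le> 2 * x\<^sup>2 + 2 * (y::real)\<^sup>2"
  using zero_le_power2[of "x + y"] by (simp add: power2_sum power2_diff)

section \<open>Equilibrium profiles\<close>

context z_pinch begin

abbreviation plasma :: "real measure" where "plasma \<equiv> lborel_on {0<..<r0}"

lemma p_props:
  shows "continuous_on {0..r0} p" "p r0 = 0" "\<And>r. r \<in> {0..<r0} \<Longrightarrow> p r > 0"
    and p_deriv: "\<And>r. r \<in> {0..r0} \<Longrightarrow> (p has_real_derivative p' r) (at r within {0..r0})"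
    and p'_cont: "continuous_on {0..r0} p'"
proof -
  obtain f1 f2 where f: "\<And>r. r \<in> {0..r0} \<Longrightarrow> (p has_real_derivative f1 r) (at r within {0..r0})"
     "\<And>r. r \<in> {0..r0} \<Longrightarrow> (f1 has_real_derivative f2 r) (at r within {0..r0})"
    using admissible unfolding admissible_pressure_def C21_on_def by blast
  \<comment> \<open>The derivative within \<open>{0..r0}\<close> is unique, also at the end points,
    because the interval is nondegenerate.\<close>
  have eq: "p' r = f1 r" if "r \<in> {0..r0}" for r
    unfolding p'_def interval_deriv_def
    using vector_derivative_within_cbox[of 0 r0 r p "f1 r"] f(1)[OF that] that r0_pos
    by (auto simp: has_real_derivative_iff_has_vector_derivative)
  show "(p has_real_derivative p' r) (at r within {0..r0})" if "r \<in> {0..r0}" for r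
    using f(1)[OF that] eq[OF that] by simp
  then show "continuous_on {0..r0} p"
    by (meson DERIV_continuous continuous_on_eq_continuous_within)
  have "continuous_on {0..r0} f1"
    using f(2) by (meson DERIV_continuous continuous_on_eq_continuous_within)
  then show "continuous_on {0..r0} p'" using eq by (metis (no_types, lifting) continuous_on_cong)
  have ad: "\<forall>r\<in>{0..r0}. p r \<ge> 0" "\<forall>r\<in>{0..r0}. p r = 0 \<longleftrightarrow> r = r0"
    using admissible unfolding admissible_pressure_def by blast+
  show "p r0 = 0" using ad r0_pos by auto
  show "p r > 0" if "r \<in> {0..<r0}" for r
    using bspec[OF ad(1), of r] bspec[OF ad(2), of r] that by force
qed

lemma p'_bounded: "\<exists>P>0. \<forall>r\<in>{0..r0}. \<bar>p' r\<bar> \<le> P"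
proof -
  obtain P where "\<forall>r\<in>{0..r0}. \<bar>p' r\<bar> \<le> P"
    using compact_imp_bounded[OF compact_continuous_image[OF p'_cont compact_Icc]]
    unfolding bounded_iff by (metis imageI real_norm_def)
  then show ?thesis by (intro exI[of _ "max P 1"]) (auto simp: le_max_iff_disj)
qed

lemma rho_props: "continuous_on {0..r0} \<rho>" "\<And>r. r \<in> {0..<r0} \<Longrightarrow> \<rho> r > 0" "\<And>r. \<rho> r \<ge> 0"
proof -
  have "continuous_on {0..r0} (\<lambda>r. (p r / A) powr (1 / \<gamma>))"
  \<comment> \<open>At \<open>r0\<close> the base is 0, and the power is continuous there because
    the exponent \<open>1 / \<gamma>\<close> is positive.\<close>
  proof (rule continuous_on_powr')
    show "\<forall>x\<in>{0..r0}. p x / A \<ge> 0 \<and> (p x / A = 0 \<longrightarrow> 1 / \<gamma> > 0)"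
      using p_props(2,3) A_pos gamma_gt_1 by (force simp: less_eq_real_def)
  qed (use A_pos in \<open>auto intro!: continuous_intros p_props\<close>)
  then show "continuous_on {0..r0} \<rho>" unfolding \<rho>_def .
  show "\<rho> r > 0" if "r \<in> {0..<r0}" for r
    using p_props(3)[OF that] A_pos unfolding \<rho>_def by simp
  show "\<rho> r \<ge> 0" for r unfolding \<rho>_def by simp
qed

subsection \<open>Finite dissipation\<close>

text \<open>\<open>d\<close> is an arbitrary choice among weak derivatives, so an explicit
  derivative replaces it only almost everywhere.\<close>

lemma d_AE:
  assumes "has_wderiv {0<..r0} f g"
  shows "AE r in plasma. d f r = g r"
proof -
  have "wdifferentiable {0<..r0} f" using assms unfolding wdifferentiable_def by blast
  then have "AE r in lborel. r \<in> {0<..r0} \<longrightarrow> d f r = g r"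
    unfolding d_def by (intro has_wderiv_unique_Ioc[OF has_wderiv_wderiv assms])
  then show ?thesis by (subst AE_restrict_space_iff) (auto elim: eventually_mono)
qed

lemma has_wderiv_d: "wdifferentiable {0<..r0} f \<Longrightarrow> has_wderiv {0<..r0} f (d f)"
  unfolding d_def by (rule has_wderiv_wderiv)

text \<open>\<open>D\<close> is real-valued and equals a default value on divergent integrals, so
  finiteness has to be a separate predicate. It uses the densities of the norm, with coefficient
  1.\<close>

definition finite_dissipation ::
  "int \<Rightarrow> int \<Rightarrow> (real \<Rightarrow> real) \<Rightarrow> (real \<Rightarrow> real) \<Rightarrow> (real \<Rightarrow> real) \<Rightarrow> bool" where
  "finite_dissipation m k \<xi> \<eta> \<zeta> \<longleftrightarrow>
     wdifferentiable {0<..r0} \<xi> \<and> wdifferentiable {0<..r0} \<eta> \<and> wdifferentiable {0<..r0} \<zeta> \<and>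
     integrable plasma (\<lambda>r. shear_sq 1 m k \<xi> \<eta> \<zeta> r * r) \<and>
     integrable plasma (\<lambda>r. div_sq m k \<xi> \<eta> \<zeta> r * r)"

lemma shear_sq_measurable:
  assumes "wdifferentiable {0<..r0} \<xi>" "wdifferentiable {0<..r0} \<eta>" "wdifferentiable {0<..r0} \<zeta>"
  shows "shear_sq q m k \<xi> \<eta> \<zeta> \<in> borel_measurable plasma" "div_sq m k \<xi> \<eta> \<zeta> \<in> borel_measurable plasma"
proof -
  note [measurable] = has_wderiv_measurable[OF has_wderiv_d[OF assms(1)]]
    has_wderiv_measurable[OF has_wderiv_d[OF assms(2)]] has_wderiv_measurable[OF has_wderiv_d[OF assms(3)]]
  have [measurable]: "(\<lambda>r::real. r) \<in> borel_measurable plasma" by (rule measurable_restrict_space1) simp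
  show "shear_sq q m k \<xi> \<eta> \<zeta> \<in> borel_measurable plasma" "div_sq m k \<xi> \<eta> \<zeta> \<in> borel_measurable plasma"
    unfolding shear_sq_def[abs_def] div_sq_def[abs_def] by measurable
qed

text \<open>All singular quotients are bounded by the linear vanishing on the axis. The only
  singular quotient of \<open>\<eta>\<close> carries the factor \<open>m\<close>, which is why
  \<open>\<eta> 0 = 0\<close> is asked for \<open>m \<noteq> 0\<close> only.\<close>

lemma shear_sq_bounded:
  assumes "\<xi> \<in> Cinf_on 0 r0" "\<eta> \<in> Cinf_on 0 r0" "\<zeta> \<in> Cinf_on 0 r0"
    and zero: "\<xi> 0 = 0" "\<zeta> 0 = 0" "m \<noteq> 0 \<Longrightarrow> \<eta> 0 = 0"
  shows "\<exists>C. AE r in plasma. shear_sq 1 m k \<xi> \<eta> \<zeta> r \<le> C \<and> div_sq m k \<xi> \<eta> \<zeta> r \<le> C"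
proof -
  obtain \<xi>' B1 where 1: "\<And>r. r \<in> {0..r0} \<Longrightarrow> (\<xi> has_real_derivative \<xi>' r) (at r within {0..r0})"
    "continuous_on {0..r0} \<xi>'" "B1 \<ge> 0"
    "\<And>r. r \<in> {0..r0} \<Longrightarrow> \<bar>\<xi> r\<bar> \<le> B1" "\<And>r. r \<in> {0..r0} \<Longrightarrow> \<bar>\<xi>' r\<bar> \<le> B1"
    "\<And>r. \<xi> 0 = 0 \<Longrightarrow> r \<in> {0..r0} \<Longrightarrow> \<bar>\<xi> r\<bar> \<le> B1 * r"
    using Cinf_on_deriv_bounds[OF assms(1) r0_pos] by metis
  obtain \<eta>' B2 where 2: "\<And>r. r \<in> {0..r0} \<Longrightarrow> (\<eta> has_real_derivative \<eta>' r) (at r within {0..r0})"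
    "continuous_on {0..r0} \<eta>'" "B2 \<ge> 0"
    "\<And>r. r \<in> {0..r0} \<Longrightarrow> \<bar>\<eta> r\<bar> \<le> B2" "\<And>r. r \<in> {0..r0} \<Longrightarrow> \<bar>\<eta>' r\<bar> \<le> B2"
    "\<And>r. \<eta> 0 = 0 \<Longrightarrow> r \<in> {0..r0} \<Longrightarrow> \<bar>\<eta> r\<bar> \<le> B2 * r"
    using Cinf_on_deriv_bounds[OF assms(2) r0_pos] by metis
  obtain \<zeta>' B3 where 3: "\<And>r. r \<in> {0..r0} \<Longrightarrow> (\<zeta> has_real_derivative \<zeta>' r) (at r within {0..r0})"
    "continuous_on {0..r0} \<zeta>'" "B3 \<ge> 0"
    "\<And>r. r \<in> {0..r0} \<Longrightarrow> \<bar>\<zeta> r\<bar> \<le> B3" "\<And>r. r \<in> {0..r0} \<Longrightarrow> \<bar>\<zeta>' r\<bar> \<le> B3"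
    "\<And>r. \<zeta> 0 = 0 \<Longrightarrow> r \<in> {0..r0} \<Longrightarrow> \<bar>\<zeta> r\<bar> \<le> B3 * r"
    using Cinf_on_deriv_bounds[OF assms(3) r0_pos] by metis
  define B where "B = B1 + B2 + B3"
  define Bm where "Bm = \<bar>real_of_int m\<bar> * B"
  define Bk where "Bk = \<bar>real_of_int k\<bar> * B"
  \<comment> \<open>\<open>T\<close> dominates each of the seven linear expressions, whose largest
    coefficients are 3 for the terms without \<open>m\<close> and \<open>k\<close> and 2 for those
    with \<open>m\<close> or \<open>k\<close>.\<close>
  define T where "T = 3 * B + 2 * Bm + 2 * Bk"
  have B: "B1 \<le> B" "B2 \<le> B" "B3 \<le> B" "B \<ge> 0" "Bm \<ge> 0" "Bk \<ge> 0"
    using 1(3) 2(3) 3(3) by (auto simp: B_def Bm_def Bk_def)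
  have "AE r in plasma. d \<xi> r = \<xi>' r" by (intro d_AE has_wderiv_Ioc_DERIV 1)
  moreover have "AE r in plasma. d \<eta> r = \<eta>' r" by (intro d_AE has_wderiv_Ioc_DERIV 2)
  moreover have "AE r in plasma. d \<zeta> r = \<zeta>' r" by (intro d_AE has_wderiv_Ioc_DERIV 3)
  moreover have "AE r in plasma. r \<in> {0<..<r0}" by (rule AE_I2) (simp add: space_restrict_space)
  ultimately have "AE r in plasma. shear_sq 1 m k \<xi> \<eta> \<zeta> r \<le> 6 * T\<^sup>2 \<and> div_sq m k \<xi> \<eta> \<zeta> r \<le> 6 * T\<^sup>2"
  proof eventually_elim
    case (elim r)
    then have r: "r \<in> {0..r0}" "r > 0" by auto
    have div: "\<bar>x / r\<bar> \<le> B" if "\<bar>x\<bar> \<le> B' * r" "B' \<le> B" for x B'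
    proof -
      have "\<bar>x / r\<bar> \<le> B'" using that r by (simp add: field_simps)
      then show ?thesis using that by simp
    qed
    have b: "\<bar>d \<xi> r\<bar> \<le> B" "\<bar>d \<eta> r\<bar> \<le> B" "\<bar>d \<zeta> r\<bar> \<le> B"
      using 1(5)[OF r(1)] 2(5)[OF r(1)] 3(5)[OF r(1)] elim B by linarith+
    have q: "\<bar>\<xi> r / r\<bar> \<le> B" "\<bar>\<zeta> r / r\<bar> \<le> B"
      using div[OF 1(6)[OF zero(1) r(1)] B(1)] div[OF 3(6)[OF zero(2) r(1)] B(3)] by auto
    have mm: "\<bar>real_of_int m / r * x\<bar> \<le> Bm" if "\<bar>x / r\<bar> \<le> B" for x
    proof -
      have "\<bar>real_of_int m / r * x\<bar> = \<bar>real_of_int m\<bar> * \<bar>x / r\<bar>" by (simp add: abs_mult)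
      also have "\<dots> \<le> Bm" unfolding Bm_def using that by (intro mult_left_mono) auto
      finally show ?thesis .
    qed
    have kk: "\<bar>real_of_int k * x\<bar> \<le> Bk" if "\<bar>x\<bar> \<le> B" for x
      unfolding Bk_def abs_mult using that by (intro mult_left_mono) auto
    have m: "\<bar>real_of_int m / r * \<xi> r\<bar> \<le> Bm" "\<bar>real_of_int m / r * \<zeta> r\<bar> \<le> Bm" by (intro mm q)+
    have me: "\<bar>real_of_int m / r * \<eta> r\<bar> \<le> Bm"
    proof (cases "m = 0")
      case False
      then show ?thesis by (intro mm div[OF 2(6)[OF zero(3) r(1)] B(2)])
    qed (use B in simp)
    have k: "\<bar>real_of_int k * \<xi> r\<bar> \<le> Bk" "\<bar>real_of_int k * \<eta> r\<bar> \<le> Bk" "\<bar>real_of_int k * \<zeta> r\<bar> \<le> Bk"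
      using 1(4)[OF r(1)] 2(4)[OF r(1)] 3(4)[OF r(1)] B by (intro kk; linarith)+
    note bounds = b q m me k
    have m2: "2 * real_of_int m / r * \<zeta> r = 2 * (real_of_int m / r * \<zeta> r)" by simp
    have k2: "2 * real_of_int k * \<eta> r = 2 * (real_of_int k * \<eta> r)" by simp
    have x2: "2 * \<xi> r / r = 2 * (\<xi> r / r)" by simp
    have "\<bar>- 2 * d \<xi> r + \<xi> r / r + m / r * \<zeta> r - k * \<eta> r\<bar> \<le> T"
      "\<bar>d \<xi> r - 2 * \<xi> r / r - 2 * real_of_int m / r * \<zeta> r - k * \<eta> r\<bar> \<le> T"
      "\<bar>d \<xi> r + \<xi> r / r + m / r * \<zeta> r + 2 * real_of_int k * \<eta> r\<bar> \<le> T"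
      "\<bar>- d \<zeta> r + \<zeta> r / r + m / r * \<xi> r\<bar> \<le> T"
      "\<bar>d \<eta> r + k * \<xi> r\<bar> \<le> T"
      "\<bar>m / r * \<eta> r - k * \<zeta> r\<bar> \<le> T"
      "\<bar>d \<xi> r + \<xi> r / r + m / r * \<zeta> r - k * \<eta> r\<bar> \<le> T"
      unfolding T_def m2 k2 x2 using bounds[THEN abs_le_D1] bounds[THEN abs_le_D2] B
      by (intro abs_leI; linarith)+
    note sq = this[THEN sq_le_sq_if_abs_le]
    have "div_sq m k \<xi> \<eta> \<zeta> r \<le> T\<^sup>2" unfolding div_sq_def by (rule sq(7))
    moreover have "shear_sq 1 m k \<xi> \<eta> \<zeta> r \<le> T\<^sup>2 + T\<^sup>2 + T\<^sup>2 + T\<^sup>2 + T\<^sup>2 + T\<^sup>2"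
      unfolding shear_sq_def mult_1 by (intro add_mono sq)
    ultimately show ?case using zero_le_power2[of T] by linarith
  qed
  then show ?thesis by blast
qed

text \<open>Every squared expression is linear in the triple, and \<open>u = v - w\<close> implies
  \<open>u^2 \<le> 2 * v^2 + 2 * w^2\<close>.\<close>

lemma shear_sq_diff_le:
  assumes "has_wderiv {0<..r0} \<xi>\<^sub>1 x\<^sub>1" "has_wderiv {0<..r0} \<eta>\<^sub>1 y\<^sub>1" "has_wderiv {0<..r0} \<zeta>\<^sub>1 z\<^sub>1"
    "has_wderiv {0<..r0} \<xi> x" "has_wderiv {0<..r0} \<eta> y" "has_wderiv {0<..r0} \<zeta> z"
  shows "AE r in plasma.
    shear_sq 1 m k \<xi> \<eta> \<zeta> r \<le> 2 * shear_sq 1 m k \<xi>\<^sub>1 \<eta>\<^sub>1 \<zeta>\<^sub>1 r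
      + 2 * shear_sq 1 m k (\<lambda>r. \<xi>\<^sub>1 r - \<xi> r) (\<lambda>r. \<eta>\<^sub>1 r - \<eta> r) (\<lambda>r. \<zeta>\<^sub>1 r - \<zeta> r) r \<and>
    div_sq m k \<xi> \<eta> \<zeta> r \<le> 2 * div_sq m k \<xi>\<^sub>1 \<eta>\<^sub>1 \<zeta>\<^sub>1 r
      + 2 * div_sq m k (\<lambda>r. \<xi>\<^sub>1 r - \<xi> r) (\<lambda>r. \<eta>\<^sub>1 r - \<eta> r) (\<lambda>r. \<zeta>\<^sub>1 r - \<zeta> r) r"
  using d_AE[OF assms(1)] d_AE[OF assms(2)] d_AE[OF assms(3)] d_AE[OF assms(4)] d_AE[OF assms(5)] d_AE[OF assms(6)]
    d_AE[OF has_wderiv_diff[OF assms(1,4)]] d_AE[OF has_wderiv_diff[OF assms(2,5)]] d_AE[OF has_wderiv_diff[OF assms(3,6)]]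
proof eventually_elim
  case (elim r)
  have dd: "d (\<lambda>r. \<xi>\<^sub>1 r - \<xi> r) r = d \<xi>\<^sub>1 r - d \<xi> r" "d (\<lambda>r. \<eta>\<^sub>1 r - \<eta> r) r = d \<eta>\<^sub>1 r - d \<eta> r"
    "d (\<lambda>r. \<zeta>\<^sub>1 r - \<zeta> r) r = d \<zeta>\<^sub>1 r - d \<zeta> r" using elim by simp_all
  have sum6: "a1 + a2 + a3 + a4 + a5 + a6 \<le> 2 * (b1 + b2 + b3 + b4 + b5 + b6) + 2 * (c1 + c2 + c3 + c4 + c5 + c6)"
    if "a1 \<le> 2 * b1 + 2 * c1" "a2 \<le> 2 * b2 + 2 * c2" "a3 \<le> 2 * b3 + 2 * c3"
      "a4 \<le> 2 * b4 + 2 * c4" "a5 \<le> 2 * b5 + 2 * c5" "a6 \<le> 2 * b6 + 2 * c6"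
    for a1 a2 a3 a4 a5 a6 b1 b2 b3 b4 b5 b6 c1 c2 c3 c4 c5 c6 :: real
  proof -
    have "a1 + a2 + a3 + a4 + a5 + a6 \<le> (2 * b1 + 2 * c1) + (2 * b2 + 2 * c2) + (2 * b3 + 2 * c3)
        + (2 * b4 + 2 * c4) + (2 * b5 + 2 * c5) + (2 * b6 + 2 * c6)"
      by (intro add_mono that)
    also have "\<dots> = 2 * (b1 + b2 + b3 + b4 + b5 + b6) + 2 * (c1 + c2 + c3 + c4 + c5 + c6)"
      by (simp add: distrib_left)
    finally show ?thesis .
  qed
  have le: "u\<^sup>2 \<le> 2 * v\<^sup>2 + 2 * w\<^sup>2" if "u = v - w" for u v w :: real
    using that power2_diff_le[of v w] by simp
  have "(- 2 * d \<xi> r + \<xi> r / r + m / r * \<zeta> r - k * \<eta> r)\<^sup>2 \<le> 2 * (- 2 * d \<xi>\<^sub>1 r + \<xi>\<^sub>1 r / r + m / r * \<zeta>\<^sub>1 r - k * \<eta>\<^sub>1 r)\<^sup>2 +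
      2 * (- 2 * (d \<xi>\<^sub>1 r - d \<xi> r) + (\<xi>\<^sub>1 r - \<xi> r) / r + m / r * (\<zeta>\<^sub>1 r - \<zeta> r) - k * (\<eta>\<^sub>1 r - \<eta> r))\<^sup>2"
    "(d \<xi> r - 2 * \<xi> r / r - 2 * real_of_int m / r * \<zeta> r - k * \<eta> r)\<^sup>2 \<le> 2 * (d \<xi>\<^sub>1 r - 2 * \<xi>\<^sub>1 r / r - 2 * real_of_int m / r * \<zeta>\<^sub>1 r - k * \<eta>\<^sub>1 r)\<^sup>2 +
      2 * ((d \<xi>\<^sub>1 r - d \<xi> r) - 2 * (\<xi>\<^sub>1 r - \<xi> r) / r - 2 * real_of_int m / r * (\<zeta>\<^sub>1 r - \<zeta> r) - k * (\<eta>\<^sub>1 r - \<eta> r))\<^sup>2"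
    "(d \<xi> r + \<xi> r / r + m / r * \<zeta> r + 2 * real_of_int k * \<eta> r)\<^sup>2 \<le> 2 * (d \<xi>\<^sub>1 r + \<xi>\<^sub>1 r / r + m / r * \<zeta>\<^sub>1 r + 2 * real_of_int k * \<eta>\<^sub>1 r)\<^sup>2 +
      2 * ((d \<xi>\<^sub>1 r - d \<xi> r) + (\<xi>\<^sub>1 r - \<xi> r) / r + m / r * (\<zeta>\<^sub>1 r - \<zeta> r) + 2 * real_of_int k * (\<eta>\<^sub>1 r - \<eta> r))\<^sup>2"
    "(- d \<zeta> r + \<zeta> r / r + m / r * \<xi> r)\<^sup>2 \<le> 2 * (- d \<zeta>\<^sub>1 r + \<zeta>\<^sub>1 r / r + m / r * \<xi>\<^sub>1 r)\<^sup>2 +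
      2 * (- (d \<zeta>\<^sub>1 r - d \<zeta> r) + (\<zeta>\<^sub>1 r - \<zeta> r) / r + m / r * (\<xi>\<^sub>1 r - \<xi> r))\<^sup>2"
    "(d \<eta> r + k * \<xi> r)\<^sup>2 \<le> 2 * (d \<eta>\<^sub>1 r + k * \<xi>\<^sub>1 r)\<^sup>2 + 2 * ((d \<eta>\<^sub>1 r - d \<eta> r) + k * (\<xi>\<^sub>1 r - \<xi> r))\<^sup>2"
    "(m / r * \<eta> r - k * \<zeta> r)\<^sup>2 \<le> 2 * (m / r * \<eta>\<^sub>1 r - k * \<zeta>\<^sub>1 r)\<^sup>2 + 2 * (m / r * (\<eta>\<^sub>1 r - \<eta> r) - k * (\<zeta>\<^sub>1 r - \<zeta> r))\<^sup>2"
    "(d \<xi> r + \<xi> r / r + m / r * \<zeta> r - k * \<eta> r)\<^sup>2 \<le> 2 * (d \<xi>\<^sub>1 r + \<xi>\<^sub>1 r / r + m / r * \<zeta>\<^sub>1 r - k * \<eta>\<^sub>1 r)\<^sup>2 +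
      2 * ((d \<xi>\<^sub>1 r - d \<xi> r) + (\<xi>\<^sub>1 r - \<xi> r) / r + m / r * (\<zeta>\<^sub>1 r - \<zeta> r) - k * (\<eta>\<^sub>1 r - \<eta> r))\<^sup>2"
    by (rule le, simp add: diff_divide_distrib right_diff_distrib)+
  then show ?case unfolding shear_sq_def div_sq_def dd mult_1 by (intro conjI sum6)
qed

lemma shear_sq_nonneg: "q \<ge> 0 \<Longrightarrow> shear_sq q m k \<xi> \<eta> \<zeta> r \<ge> 0" and div_sq_nonneg: "div_sq m k \<xi> \<eta> \<zeta> r \<ge> 0"
  unfolding shear_sq_def div_sq_def by simp_all

text \<open>A limit triple is a smooth approximant minus an error of norm below 1. The approximant
  has bounded densities on a bounded interval, the error integrable ones.\<close>

lemma finite_dissipation_completion: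
  assumes u: "(\<xi>, \<eta>, \<zeta>) \<in> completion m k S"
    and S: "\<And>\<xi> \<eta> \<zeta>. (\<xi>, \<eta>, \<zeta>) \<in> S \<Longrightarrow> \<xi> \<in> Cinf_on 0 r0 \<and> \<eta> \<in> Cinf_on 0 r0 \<and> \<zeta> \<in> Cinf_on 0 r0 \<and>
       \<xi> 0 = 0 \<and> \<zeta> 0 = 0 \<and> (m \<noteq> 0 \<longrightarrow> \<eta> 0 = 0)"
  shows "finite_dissipation m k \<xi> \<eta> \<zeta>"
proof -
  obtain \<xi>n \<eta>n \<zeta>n where w: "wdifferentiable {0<..r0} \<xi>" "wdifferentiable {0<..r0} \<eta>" "wdifferentiable {0<..r0} \<zeta>"
    and n: "\<And>n::nat. (\<xi>n n, \<eta>n n, \<zeta>n n) \<in> S"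
    and lim: "(\<lambda>n. sqnorm m k (\<lambda>r. \<xi>n n r - \<xi> r) (\<lambda>r. \<eta>n n r - \<eta> r) (\<lambda>r. \<zeta>n n r - \<zeta> r)) \<longlonglongrightarrow> 0"
    using u unfolding completion_def by blast
  have "\<forall>\<^sub>F n in sequentially. sqnorm m k (\<lambda>r. \<xi>n n r - \<xi> r) (\<lambda>r. \<eta>n n r - \<eta> r) (\<lambda>r. \<zeta>n n r - \<zeta> r) < 1"
    using order_tendstoD(2)[OF lim, of 1] by simp
  then obtain N where N: "sqnorm m k (\<lambda>r. \<xi>n N r - \<xi> r) (\<lambda>r. \<eta>n N r - \<eta> r) (\<lambda>r. \<zeta>n N r - \<zeta> r) < 1"
    using eventually_sequentially by auto
  let ?s = "shear_sq 1 m k (\<lambda>r. \<xi>n N r - \<xi> r) (\<lambda>r. \<eta>n N r - \<eta> r) (\<lambda>r. \<zeta>n N r - \<zeta> r)"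
  let ?v = "div_sq m k (\<lambda>r. \<xi>n N r - \<xi> r) (\<lambda>r. \<eta>n N r - \<eta> r) (\<lambda>r. \<zeta>n N r - \<zeta> r)"
  have fin: "(\<integral>\<^sup>+r. ennreal (?s r * r) \<partial>plasma) < 1" "(\<integral>\<^sup>+r. ennreal (?v r * r) \<partial>plasma) < 1"
    using N unfolding sqnorm_def
    by (auto simp: nn_integral_restrict_space add.assoc intro: le_less_trans[rotated])
  note Sn = S[OF n[of N]]
  obtain C where C: "AE r in plasma. shear_sq 1 m k (\<xi>n N) (\<eta>n N) (\<zeta>n N) r \<le> C \<and> div_sq m k (\<xi>n N) (\<eta>n N) (\<zeta>n N) r \<le> C"
    using shear_sq_bounded[of "\<xi>n N" "\<eta>n N" "\<zeta>n N" m k] Sn by blast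
  have wn: "\<exists>f'. has_wderiv {0<..r0} f f'" if "f \<in> Cinf_on 0 r0" for f
    using Cinf_on_deriv_bounds[OF that r0_pos] has_wderiv_Ioc_DERIV by metis
  obtain x1 y1 z1 where w1: "has_wderiv {0<..r0} (\<xi>n N) x1" "has_wderiv {0<..r0} (\<eta>n N) y1" "has_wderiv {0<..r0} (\<zeta>n N) z1"
    using wn Sn by metis
  note le = shear_sq_diff_le[OF w1 has_wderiv_d[OF w(1)] has_wderiv_d[OF w(2)] has_wderiv_d[OF w(3)], of m k]
  have wd: "wdifferentiable {0<..r0} (\<lambda>r. \<xi>n N r - \<xi> r)" "wdifferentiable {0<..r0} (\<lambda>r. \<eta>n N r - \<eta> r)" "wdifferentiable {0<..r0} (\<lambda>r. \<zeta>n N r - \<zeta> r)"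
    unfolding wdifferentiable_def using has_wderiv_diff w1 has_wderiv_d w by metis+
  note [measurable] = shear_sq_measurable[OF w] shear_sq_measurable[OF wd]
  have [measurable]: "(\<lambda>r::real. r) \<in> borel_measurable plasma" by (rule measurable_restrict_space1) simp
  have int: "integrable plasma (\<lambda>r. F r * r)"
    if F[measurable]: "F \<in> borel_measurable plasma" and G[measurable]: "G \<in> borel_measurable plasma" and nn: "\<And>r. F r \<ge> 0" "\<And>r. G r \<ge> 0"
      and le: "AE r in plasma. F r \<le> 2 * C + 2 * G r" and fin: "(\<integral>\<^sup>+r. ennreal (G r * r) \<partial>plasma) < 1" for F G
  proof (rule Bochner_Integration.integrable_bound)
    show "integrable plasma (\<lambda>r. 2 * C * r + 2 * (G r * r))"
    proof (intro Bochner_Integration.integrable_add integrable_mult_right)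
      show "integrable plasma (\<lambda>r::real. r)"
        unfolding lborel_on_Ioo_eq_Icc by (intro integrable_Icc_continuous continuous_intros)
      show "integrable plasma (\<lambda>r. G r * r)"
      proof (rule integrableI_nonneg)
        show "AE r in plasma. 0 \<le> G r * r" using nn by (intro AE_I2) (auto simp: space_restrict_space)
        show "(\<integral>\<^sup>+r. ennreal (G r * r) \<partial>plasma) < \<infinity>" using fin by (rule less_trans) simp
      qed measurable
    qed
    show "AE r in plasma. norm (F r * r) \<le> norm (2 * C * r + 2 * (G r * r))"
      using le AE_space
    proof eventually_elim
      case (elim r)
      then have "r > 0" by (simp add: space_restrict_space)
      have "F r * r \<le> (2 * C + 2 * G r) * r" using elim \<open>r > 0\<close> by (intro mult_right_mono) auto
      also have "\<dots> = 2 * C * r + 2 * (G r * r)" by (simp add: algebra_simps)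
      finally show ?case using nn \<open>r > 0\<close> by simp
    qed
  qed measurable
  have "AE r in plasma. shear_sq 1 m k \<xi> \<eta> \<zeta> r \<le> 2 * C + 2 * ?s r" "AE r in plasma. div_sq m k \<xi> \<eta> \<zeta> r \<le> 2 * C + 2 * ?v r"
    using le C by (eventually_elim, linarith)+
  then have "integrable plasma (\<lambda>r. shear_sq 1 m k \<xi> \<eta> \<zeta> r * r)" "integrable plasma (\<lambda>r. div_sq m k \<xi> \<eta> \<zeta> r * r)"
    by (intro int[OF _ _ _ _ _ fin(1)] int[OF _ _ _ _ _ fin(2)] shear_sq_nonneg div_sq_nonneg; simp)+
  with w show ?thesis unfolding finite_dissipation_def by blast
qed

lemma finite_dissipation_X: "(\<xi>, \<eta>, \<zeta>) \<in> X k \<Longrightarrow> finite_dissipation 0 k \<xi> \<eta> \<zeta>"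
  unfolding X_def by (erule finite_dissipation_completion) auto

lemma finite_dissipation_Y: "(\<xi>, \<eta>, \<zeta>) \<in> Y m k \<Longrightarrow> finite_dissipation m k \<xi> \<eta> \<zeta>"
  unfolding Y_def by (erule finite_dissipation_completion) auto

end

text \<open>If \<open>F\<close> is not integrable, its integral is 0, which still lies above the
  bound since \<open>g\<close> is nonnegative. Energy densities of unknown integrability are treated
  this way.\<close>

lemma integral_ge_minus:
  fixes F g :: "'a \<Rightarrow> real"
  assumes "integrable M g" "\<And>x. x \<in> space M \<Longrightarrow> g x \<ge> 0" "\<And>x. x \<in> space M \<Longrightarrow> F x \<ge> - g x"
  shows "integral\<^sup>L M F \<ge> - integral\<^sup>L M g"
proof (cases "integrable M F")
  case True
  then have "(\<integral>x. - g x \<partial>M) \<le> integral\<^sup>L M F" using assms by (intro integral_mono) auto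
  then show ?thesis by simp
next
  case False
  moreover have "integral\<^sup>L M g \<ge> 0" using assms by (intro Bochner_Integration.integral_nonneg)
  ultimately show ?thesis by (simp add: not_integrable_integral_eq)
qed

section \<open>Coercivity of the dissipation\<close>

context z_pinch begin

lemma D_eq_integral:
  "D m k \<xi> \<eta> \<zeta> = 2 * pi\<^sup>2 * (LINT r|plasma. \<epsilon> * shear_sq (2/9) m k \<xi> \<eta> \<zeta> r * r)
     + 2 * pi\<^sup>2 * (LINT r|plasma. \<delta> * div_sq m k \<xi> \<eta> \<zeta> r * r)"
  unfolding D_def by (simp add: set_integral_lborel_on)

lemma D_nonneg: "D m k \<xi> \<eta> \<zeta> \<ge> 0"
  unfolding D_eq_integral using epsilon_pos delta_pos
  by (intro add_nonneg_nonneg mult_nonneg_nonneg Bochner_Integration.integral_nonneg shear_sq_nonneg div_sq_nonneg)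
    (auto simp: space_restrict_space)

text \<open>The first square controls the ends of the plasma interval; the other two are what
  integration by parts against \<open>\<eta>\<close> and \<open>\<zeta>\<close> consumes.\<close>

definition dissipation_part ::
  "int \<Rightarrow> int \<Rightarrow> (real \<Rightarrow> real) \<Rightarrow> (real \<Rightarrow> real) \<Rightarrow> (real \<Rightarrow> real) \<Rightarrow> real \<Rightarrow> real" where
  "dissipation_part m k \<xi> \<eta> \<zeta> r =
     (d \<xi> r)\<^sup>2 + (d \<eta> r + k * \<xi> r)\<^sup>2 + (- d \<zeta> r + \<zeta> r / r + m / r * \<xi> r)\<^sup>2"

text \<open>The square of \<open>d \<xi> r\<close> is no summand of the dissipation, but
  \<open>3 * d \<xi> r\<close> is the divergence minus the first shear expression. The resulting
  factor 2/9 explains the 9/2 in the minimum; for \<open>q = 2/9\<close> the constant becomes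
  \<open>min \<alpha> \<beta>\<close>.\<close>

lemma dissipation_part_le:
  fixes m k :: int
  assumes "\<alpha> \<ge> 0" "\<beta> \<ge> 0" "q \<ge> 0"
  shows "min (q * \<alpha> * (9/2)) (min \<alpha> \<beta>) * dissipation_part m k \<xi> \<eta> \<zeta> r
    \<le> \<alpha> * shear_sq q m k \<xi> \<eta> \<zeta> r + \<beta> * div_sq m k \<xi> \<eta> \<zeta> r"
proof -
  define c where "c = min (q * \<alpha> * (9/2)) (min \<alpha> \<beta>)"
  have c: "c \<ge> 0" "c \<le> q * \<alpha> * (9/2)" "c \<le> \<alpha>" "c \<le> \<beta>" using assms by (auto simp: c_def)
  define u where "u = - 2 * d \<xi> r + \<xi> r / r + m / r * \<zeta> r - k * \<eta> r"
  define v where "v = d \<xi> r + \<xi> r / r + m / r * \<zeta> r - k * \<eta> r"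
  define G where "G = (- d \<zeta> r + \<zeta> r / r + m / r * \<xi> r)\<^sup>2"
  define H where "H = (d \<eta> r + k * \<xi> r)\<^sup>2"
  have "3 * d \<xi> r = v - u" by (simp add: u_def v_def)
  then have "(3 * d \<xi> r)\<^sup>2 \<le> 2 * v\<^sup>2 + 2 * u\<^sup>2" using power2_diff_le[of v u] by simp
  then have "(d \<xi> r)\<^sup>2 \<le> 2/9 * u\<^sup>2 + 2/9 * v\<^sup>2" by (simp add: power_mult_distrib)
  then have "c * (d \<xi> r)\<^sup>2 \<le> c * (2/9 * u\<^sup>2 + 2/9 * v\<^sup>2)" using c(1) by (rule mult_left_mono)
  also have "\<dots> = 2/9 * c * u\<^sup>2 + 2/9 * c * v\<^sup>2" by (simp add: algebra_simps)
  also have "\<dots> \<le> q * \<alpha> * u\<^sup>2 + \<beta> * v\<^sup>2" using c by (intro add_mono mult_right_mono) auto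
  finally have 1: "c * (d \<xi> r)\<^sup>2 \<le> \<alpha> * (q * u\<^sup>2) + \<beta> * v\<^sup>2" by (simp add: mult_ac)
  have 2: "c * G \<le> \<alpha> * G" "c * H \<le> \<alpha> * H" using c by (auto intro!: mult_right_mono simp: G_def H_def)
  have "q * u\<^sup>2 + G + H \<le> shear_sq q m k \<xi> \<eta> \<zeta> r"
    unfolding shear_sq_def u_def G_def H_def using assms(3) by simp
  then have "\<alpha> * (q * u\<^sup>2 + G + H) \<le> \<alpha> * shear_sq q m k \<xi> \<eta> \<zeta> r" using assms(1) by (rule mult_left_mono)
  moreover have "c * dissipation_part m k \<xi> \<eta> \<zeta> r = c * (d \<xi> r)\<^sup>2 + c * H + c * G"
    unfolding dissipation_part_def G_def H_def by (simp add: distrib_left)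
  moreover have "div_sq m k \<xi> \<eta> \<zeta> r = v\<^sup>2" by (simp add: div_sq_def v_def)
  ultimately show ?thesis using 1 2 unfolding c_def[symmetric] by (simp add: distrib_left)
qed

lemma measurable_id_plasma [measurable]: "(\<lambda>r::real. r) \<in> borel_measurable plasma"
  by (rule measurable_restrict_space1) simp

text \<open>The pointwise bound is used twice: with \<open>q = 1\<close>, where the norm of the
  space supplies integrability, and with \<open>q = 2/9\<close>, where it compares with
  \<open>D\<close>.\<close>

lemma dissipation_part_integral:
  assumes fd: "finite_dissipation m k \<xi> \<eta> \<zeta>"
  shows "integrable plasma (\<lambda>r. dissipation_part m k \<xi> \<eta> \<zeta> r * r)"
    and "integrable plasma (\<lambda>r. (d \<xi> r)\<^sup>2 * r)"
    and "2 * pi\<^sup>2 * min \<epsilon> \<delta> * (LINT r|plasma. dissipation_part m k \<xi> \<eta> \<zeta> r * r) \<le> D m k \<xi> \<eta> \<zeta>"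
proof -
  have w: "wdifferentiable {0<..r0} \<xi>" "wdifferentiable {0<..r0} \<eta>" "wdifferentiable {0<..r0} \<zeta>"
    and i: "integrable plasma (\<lambda>r. shear_sq 1 m k \<xi> \<eta> \<zeta> r * r)" "integrable plasma (\<lambda>r. div_sq m k \<xi> \<eta> \<zeta> r * r)"
    using fd unfolding finite_dissipation_def by auto
  note [measurable] = has_wderiv_measurable[OF has_wderiv_d[OF w(1)]]
    has_wderiv_measurable[OF has_wderiv_d[OF w(2)]] has_wderiv_measurable[OF has_wderiv_d[OF w(3)]]
    shear_sq_measurable[OF w]
  show iF: "integrable plasma (\<lambda>r. dissipation_part m k \<xi> \<eta> \<zeta> r * r)"
  proof (rule Bochner_Integration.integrable_bound[OF Bochner_Integration.integrable_add[OF i]])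
    show "(\<lambda>r. dissipation_part m k \<xi> \<eta> \<zeta> r * r) \<in> borel_measurable plasma"
      unfolding dissipation_part_def by measurable
    show "AE r in plasma. norm (dissipation_part m k \<xi> \<eta> \<zeta> r * r)
        \<le> norm (shear_sq 1 m k \<xi> \<eta> \<zeta> r * r + div_sq m k \<xi> \<eta> \<zeta> r * r)"
    proof (rule AE_I2)
      fix r assume "r \<in> space plasma"
      then have r: "r > 0" by (simp add: space_restrict_space)
      have "dissipation_part m k \<xi> \<eta> \<zeta> r \<le> shear_sq 1 m k \<xi> \<eta> \<zeta> r + div_sq m k \<xi> \<eta> \<zeta> r"
        using dissipation_part_le[of 1 1 1 m k \<xi> \<eta> \<zeta> r] by simp
      then have "dissipation_part m k \<xi> \<eta> \<zeta> r * r \<le> (shear_sq 1 m k \<xi> \<eta> \<zeta> r + div_sq m k \<xi> \<eta> \<zeta> r) * r"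
        using r by (intro mult_right_mono) auto
      moreover have "0 \<le> dissipation_part m k \<xi> \<eta> \<zeta> r * r" using r unfolding dissipation_part_def by simp
      ultimately show "norm (dissipation_part m k \<xi> \<eta> \<zeta> r * r)
        \<le> norm (shear_sq 1 m k \<xi> \<eta> \<zeta> r * r + div_sq m k \<xi> \<eta> \<zeta> r * r)"
        by (simp add: distrib_right)
    qed
  qed
  show "integrable plasma (\<lambda>r. (d \<xi> r)\<^sup>2 * r)"
  proof (rule Bochner_Integration.integrable_bound[OF iF])
    show "AE r in plasma. norm ((d \<xi> r)\<^sup>2 * r) \<le> norm (dissipation_part m k \<xi> \<eta> \<zeta> r * r)"
      unfolding dissipation_part_def by (intro AE_I2) (auto simp: abs_mult space_restrict_space intro!: mult_right_mono)
  qed measurable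
  have i\<epsilon>: "integrable plasma (\<lambda>r. \<epsilon> * shear_sq (2/9) m k \<xi> \<eta> \<zeta> r * r)"
  proof (rule Bochner_Integration.integrable_bound[OF integrable_mult_right[OF i(1), of \<epsilon>]])
    show "AE r in plasma. norm (\<epsilon> * shear_sq (2/9) m k \<xi> \<eta> \<zeta> r * r) \<le> norm (\<epsilon> * (shear_sq 1 m k \<xi> \<eta> \<zeta> r * r))"
    proof (rule AE_I2)
      fix r assume "r \<in> space plasma"
      then have r: "r > 0" by (simp add: space_restrict_space)
      have "shear_sq (2/9) m k \<xi> \<eta> \<zeta> r \<le> shear_sq 1 m k \<xi> \<eta> \<zeta> r"
        unfolding shear_sq_def by (intro add_mono mult_right_mono) auto
      then show "norm (\<epsilon> * shear_sq (2/9) m k \<xi> \<eta> \<zeta> r * r) \<le> norm (\<epsilon> * (shear_sq 1 m k \<xi> \<eta> \<zeta> r * r))"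
        using r epsilon_pos shear_sq_nonneg[of "2/9" m k \<xi> \<eta> \<zeta> r] shear_sq_nonneg[of 1 m k \<xi> \<eta> \<zeta> r]
        by (simp add: abs_mult mult_right_mono)
    qed
  qed measurable
  have i\<delta>: "integrable plasma (\<lambda>r. \<delta> * div_sq m k \<xi> \<eta> \<zeta> r * r)"
    using integrable_mult_right[OF i(2), of \<delta>] by (simp add: mult.assoc)
  have "(LINT r|plasma. min \<epsilon> \<delta> * (dissipation_part m k \<xi> \<eta> \<zeta> r * r)) \<le>
    (LINT r|plasma. \<epsilon> * shear_sq (2/9) m k \<xi> \<eta> \<zeta> r * r + \<delta> * div_sq m k \<xi> \<eta> \<zeta> r * r)"
  proof (rule integral_mono)
    fix r assume "r \<in> space plasma"
    then have r: "r > 0" by (simp add: space_restrict_space)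
    have "min \<epsilon> \<delta> * dissipation_part m k \<xi> \<eta> \<zeta> r
      \<le> \<epsilon> * shear_sq (2/9) m k \<xi> \<eta> \<zeta> r + \<delta> * div_sq m k \<xi> \<eta> \<zeta> r"
      using dissipation_part_le[of \<epsilon> \<delta> "2/9" m k \<xi> \<eta> \<zeta> r] epsilon_pos delta_pos by simp
    then have "min \<epsilon> \<delta> * dissipation_part m k \<xi> \<eta> \<zeta> r * r
      \<le> (\<epsilon> * shear_sq (2/9) m k \<xi> \<eta> \<zeta> r + \<delta> * div_sq m k \<xi> \<eta> \<zeta> r) * r"
      using r by (intro mult_right_mono) auto
    then show "min \<epsilon> \<delta> * (dissipation_part m k \<xi> \<eta> \<zeta> r * r)
      \<le> \<epsilon> * shear_sq (2/9) m k \<xi> \<eta> \<zeta> r * r + \<delta> * div_sq m k \<xi> \<eta> \<zeta> r * r"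
      by (simp add: distrib_right mult.assoc)
  qed (intro integrable_mult_right iF Bochner_Integration.integrable_add i\<epsilon> i\<delta>)+
  also have "\<dots> = (LINT r|plasma. \<epsilon> * shear_sq (2/9) m k \<xi> \<eta> \<zeta> r * r) + (LINT r|plasma. \<delta> * div_sq m k \<xi> \<eta> \<zeta> r * r)"
    by (rule Bochner_Integration.integral_add[OF i\<epsilon> i\<delta>])
  finally have "2 * pi\<^sup>2 * (min \<epsilon> \<delta> * (LINT r|plasma. dissipation_part m k \<xi> \<eta> \<zeta> r * r)) \<le>
    2 * pi\<^sup>2 * ((LINT r|plasma. \<epsilon> * shear_sq (2/9) m k \<xi> \<eta> \<zeta> r * r) + (LINT r|plasma. \<delta> * div_sq m k \<xi> \<eta> \<zeta> r * r))"
    by (intro mult_left_mono) auto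
  then show "2 * pi\<^sup>2 * min \<epsilon> \<delta> * (LINT r|plasma. dissipation_part m k \<xi> \<eta> \<zeta> r * r) \<le> D m k \<xi> \<eta> \<zeta>"
    unfolding D_eq_integral by (simp add: distrib_left mult.assoc)
qed

lemma J_eq_integral: "J \<xi> \<eta> \<zeta> = 2 * pi\<^sup>2 * (LINT r|plasma. \<rho> r * ((\<xi> r)\<^sup>2 + (\<eta> r)\<^sup>2 + (\<zeta> r)\<^sup>2) * r)"
  unfolding J_def by (simp add: set_integral_lborel_on)

text \<open>The constant depends on \<open>\<tau>\<close> but not on \<open>m\<close>,
  \<open>k\<close> or the triple. The plain bound later makes the infimum finite; the bound with the
  factor |m| + |k| makes the excess over \<open>\<tau> * D\<close> small for large mode
  numbers.\<close>

lemma L2_norm_le_dissipation: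
  assumes \<tau>: "\<tau> > 0"
  shows "\<exists>C>0. \<forall>m k \<xi> \<eta> \<zeta>. finite_dissipation m k \<xi> \<eta> \<zeta> \<longrightarrow> J \<xi> \<eta> \<zeta> = 1 \<longrightarrow>
    integrable plasma (\<lambda>r. (\<xi> r)\<^sup>2) \<and>
    (LINT r|plasma. (\<xi> r)\<^sup>2) \<le> \<tau> * D m k \<xi> \<eta> \<zeta> + C \<and>
    (\<bar>real_of_int m\<bar> + \<bar>real_of_int k\<bar>) * ((LINT r|plasma. (\<xi> r)\<^sup>2) - \<tau> * D m k \<xi> \<eta> \<zeta>)
      \<le> C * (D m k \<xi> \<eta> \<zeta> + 1)"
proof -
  \<comment> \<open>This is the factor by which \<open>D\<close> dominates the integral of
    \<open>dissipation_part\<close>; running the tail estimate with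
    \<open>\<tau> * c\<^sub>0\<close> turns its gradient term into
    \<open>\<tau> * D\<close>.\<close>
  define c\<^sub>0 where "c\<^sub>0 = 2 * pi\<^sup>2 * min \<epsilon> \<delta>"
  have c0: "c\<^sub>0 > 0" using epsilon_pos delta_pos by (simp add: c\<^sub>0_def)
  obtain a b where ab: "0 < a" "a < b" "b < r0" and tail: "\<And>f g. has_wderiv {0<..r0} f g \<Longrightarrow>
      integrable plasma (\<lambda>s. (g s)\<^sup>2 * s) \<Longrightarrow>
      integrable plasma (\<lambda>r. (f r)\<^sup>2) \<and>
      (LINT r|plasma. (f r)\<^sup>2) \<le> (\<tau> * c\<^sub>0) * (LINT s|plasma. (g s)\<^sup>2 * s) + 2 * (LINT r|lborel_on {a<..<b}. (f r)\<^sup>2)"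
    using L2_norm_le_interior[OF r0_pos, of "\<tau> * c\<^sub>0"] \<tau> c0 by auto
  \<comment> \<open>The larger interval leaves room for the cut-off to fall to zero, yet stays away
    from 0 and \<open>r0\<close>, so \<open>\<rho> r * r\<close> has a positive minimum on
    it.\<close>
  define a' where "a' = a / 2"
  define b' where "b' = (b + r0) / 2"
  have ab': "0 < a'" "a' < a" "b < b'" "b' < r0" using ab by (auto simp: a'_def b'_def)
  let ?N = "lborel_on {a'..b'}"
  have sub: "{a'..b'} \<subseteq> {0<..<r0}" "{a'..b'} \<subseteq> {0<..r0}" using ab' by auto
  have "continuous_on {a'..b'} (\<lambda>r. \<rho> r * r)"
    by (intro continuous_intros continuous_on_subset[OF rho_props(1)]) (use ab' in auto)
  then obtain t where t: "t \<in> {a'..b'}" "\<And>r. r \<in> {a'..b'} \<Longrightarrow> \<rho> t * t \<le> \<rho> r * r"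
    using continuous_attains_inf[of "{a'..b'}" "\<lambda>r. \<rho> r * r"] ab ab' by auto
  define \<rho>\<^sub>0 where "\<rho>\<^sub>0 = \<rho> t * t"
  have \<rho>0: "\<rho>\<^sub>0 > 0" using rho_props(2)[of t] t(1) ab' by (simp add: \<rho>\<^sub>0_def)
  obtain K1 where K1: "K1 > 0" "\<And>\<kappa> \<xi> \<xi>' v v'. has_wderiv {a'..b'} \<xi> \<xi>' \<Longrightarrow> has_wderiv {a'..b'} v v' \<Longrightarrow>
     integrable ?N (\<lambda>r. (\<xi>' r)\<^sup>2) \<Longrightarrow> integrable ?N (\<lambda>r. (v' r - \<kappa> * 1 * \<xi> r)\<^sup>2) \<Longrightarrow>
     \<bar>\<kappa>\<bar> * (LINT r|lborel_on {a<..<b}. (\<xi> r)\<^sup>2) \<le>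
       K1 * (LINT r|?N. (\<xi> r)\<^sup>2 + (v r)\<^sup>2 + (\<xi>' r)\<^sup>2 + (v' r - \<kappa> * 1 * \<xi> r)\<^sup>2)"
    using interior_estimate[OF ab'(2) ab(2) ab'(3), of "\<lambda>r. 1" 1] by fastforce
  have "continuous_on {a'..b'} (\<lambda>r. 1 / r)" using ab' by (intro continuous_intros) auto
  moreover have "1 / b' \<le> 1 / r" if "r \<in> {a'..b'}" for r using that ab' by (intro divide_left_mono) auto
  moreover have "1 / b' > 0" using ab ab' by simp
  ultimately obtain K2 where K2: "K2 > 0" "\<And>\<kappa> \<xi> \<xi>' v v'. has_wderiv {a'..b'} \<xi> \<xi>' \<Longrightarrow> has_wderiv {a'..b'} v v' \<Longrightarrow>
     integrable ?N (\<lambda>r. (\<xi>' r)\<^sup>2) \<Longrightarrow> integrable ?N (\<lambda>r. (v' r - \<kappa> * (1 / r) * \<xi> r)\<^sup>2) \<Longrightarrow>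
     \<bar>\<kappa>\<bar> * (LINT r|lborel_on {a<..<b}. (\<xi> r)\<^sup>2) \<le>
       K2 * (LINT r|?N. (\<xi> r)\<^sup>2 + (v r)\<^sup>2 + (\<xi>' r)\<^sup>2 + (v' r - \<kappa> * (1 / r) * \<xi> r)\<^sup>2)"
    using interior_estimate[OF ab'(2) ab(2) ab'(3), of "\<lambda>r. 1 / r" "1 / b'"] by meson
  \<comment> \<open>\<open>C1\<close> bounds the integral of \<open>Z\<close> through
    \<open>J = 1\<close>; \<open>C2\<close> bounds that of \<open>F\<close> by \<open>D\<close>,
    since \<open>r \<ge> a'\<close> removes the weight; \<open>C3\<close> pays for replacing the
    \<open>\<zeta>\<close> residual by its dissipated part and \<open>\<zeta> r / r\<close>;
    \<open>C4\<close> collects the doubled estimates for \<open>k\<close> and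
    \<open>m\<close>.\<close>
  define C1 where "C1 = 1 / (2 * pi\<^sup>2 * \<rho>\<^sub>0)"
  define C2 where "C2 = 1 / (a' * c\<^sub>0)"
  define C3 where "C3 = 2 + 2 / a'\<^sup>2"
  define C4 where "C4 = 2 * (K1 + K2 * C3) * (C1 + C2)"
  have C: "C1 > 0" "C2 > 0" "C3 \<ge> 1" "C4 > 0"
    using \<rho>0 c0 ab' K1(1) K2(1) by (auto simp: C1_def C2_def C3_def C4_def intro!: mult_pos_pos add_pos_pos)
  show ?thesis
  proof (intro exI[of _ "2 * C1 + C4"] conjI allI impI)
    show "2 * C1 + C4 > 0" using C by simp
    fix m k :: int and \<xi> \<eta> \<zeta>
    assume fd: "finite_dissipation m k \<xi> \<eta> \<zeta>" and J: "J \<xi> \<eta> \<zeta> = 1"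
    have w: "has_wderiv {0<..r0} \<xi> (d \<xi>)" "has_wderiv {0<..r0} \<eta> (d \<eta>)" "has_wderiv {0<..r0} \<zeta> (d \<zeta>)"
      using fd has_wderiv_d unfolding finite_dissipation_def by auto
    have w': "has_wderiv {a'..b'} \<xi> (d \<xi>)" "has_wderiv {a'..b'} \<eta> (d \<eta>)" "has_wderiv {a'..b'} \<zeta> (d \<zeta>)"
      using w sub(2) has_wderiv_mono by blast+
    have c: "continuous_on {a'..b'} \<xi>" "continuous_on {a'..b'} \<eta>" "continuous_on {a'..b'} \<zeta>"
      using w' has_wderiv_continuous_Icc by auto
    note F = dissipation_part_integral[OF fd]
    define F where "F = dissipation_part m k \<xi> \<eta> \<zeta>"
    define Z where "Z = (\<lambda>r. (\<xi> r)\<^sup>2 + (\<eta> r)\<^sup>2 + (\<zeta> r)\<^sup>2)"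
    define Dv where "Dv = D m k \<xi> \<eta> \<zeta>"
    have D0: "Dv \<ge> 0" using D_nonneg by (simp add: Dv_def)
    have F0: "F r \<ge> 0" and Z0: "Z r \<ge> 0" for r by (auto simp: F_def dissipation_part_def Z_def)
    have iFr: "integrable plasma (\<lambda>r. F r * r)" using F(1) by (simp add: F_def)
    have FD: "c\<^sub>0 * (LINT r|plasma. F r * r) \<le> Dv" using F(3) by (simp add: F_def c\<^sub>0_def Dv_def)
    have meas: "f \<in> borel_measurable ?N" if "f \<in> borel_measurable plasma" for f :: "real \<Rightarrow> real"
    proof -
      have "f \<in> borel_measurable (restrict_space plasma {a'..b'})" using that by (rule measurable_restrict_space1)
      moreover have "restrict_space plasma {a'..b'} = ?N"
        using sub(1) by (simp add: restrict_restrict_space Int_absorb1)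
      ultimately show ?thesis by simp
    qed
    note mpl = has_wderiv_measurable[OF w(1)] has_wderiv_measurable[OF w(2)] has_wderiv_measurable[OF w(3)]
    note [measurable] = mpl[THEN meas] meas[OF measurable_id_plasma]
    have iNFr: "integrable ?N (\<lambda>r. F r * r)" by (rule integrable_lborel_on_subset[OF iFr sub(1)]) auto
    have iNF: "integrable ?N F"
    proof (rule Bochner_Integration.integrable_bound)
      show "integrable ?N (\<lambda>r. 1 / a' * (F r * r))" by (intro integrable_mult_right iNFr)
      show "F \<in> borel_measurable ?N" unfolding F_def dissipation_part_def[abs_def] by measurable
      show "AE r in ?N. norm (F r) \<le> norm (1 / a' * (F r * r))"
      proof (rule AE_I2)
        fix r assume "r \<in> space ?N"
        then have r: "r \<ge> a'" by (simp add: space_restrict_space)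
        have "F r * a' \<le> F r * r" using r F0 by (intro mult_left_mono)
        then show "norm (F r) \<le> norm (1 / a' * (F r * r))" using F0[of r] r ab' by (simp add: field_simps)
      qed
    qed
    have F_le: "integral\<^sup>L ?N F \<le> C2 * Dv"
    proof -
      have "a' * integral\<^sup>L ?N F = (LINT r|?N. a' * F r)" by simp
      also have "\<dots> \<le> (LINT r|?N. F r * r)"
      proof (intro integral_mono integrable_mult_right iNF iNFr)
        fix r assume "r \<in> space ?N"
        then have "F r * a' \<le> F r * r" using F0 by (intro mult_left_mono) (auto simp: space_restrict_space)
        then show "a' * F r \<le> F r * r" by (simp add: mult.commute)
      qed
      also have "\<dots> \<le> (LINT r|plasma. F r * r)"
        by (rule integral_lborel_on_mono_set[OF iFr sub(1)]) (use F0 in auto)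
      finally have "c\<^sub>0 * (a' * integral\<^sup>L ?N F) \<le> c\<^sub>0 * (LINT r|plasma. F r * r)"
        using c0 by (intro mult_left_mono) auto
      then have "c\<^sub>0 * (a' * integral\<^sup>L ?N F) \<le> Dv" using FD by simp
      then show ?thesis using c0 ab' by (simp add: C2_def field_simps)
    qed
    have iNZ: "integrable ?N Z" unfolding Z_def by (intro integrable_Icc_continuous continuous_intros c)
    have Z_le: "integral\<^sup>L ?N Z \<le> C1"
    proof -
      have JZ: "2 * pi\<^sup>2 * (LINT r|plasma. \<rho> r * Z r * r) = 1" using J unfolding J_eq_integral Z_def by simp
      \<comment> \<open>A density that is not integrable would have integral 0 and contradict
        \<open>J = 1\<close>.\<close>
      have iZ: "integrable plasma (\<lambda>r. \<rho> r * Z r * r)"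
      proof (rule ccontr)
        assume "\<not> ?thesis"
        then show False using JZ by (simp add: not_integrable_integral_eq)
      qed
      have "\<rho>\<^sub>0 * integral\<^sup>L ?N Z = (LINT r|?N. \<rho>\<^sub>0 * Z r)" by simp
      also have "\<dots> \<le> (LINT r|?N. \<rho> r * Z r * r)"
      proof (intro integral_mono integrable_mult_right iNZ)
        show "integrable ?N (\<lambda>r. \<rho> r * Z r * r)" by (rule integrable_lborel_on_subset[OF iZ sub(1)]) auto
        fix r assume "r \<in> space ?N"
        then have "\<rho>\<^sub>0 * Z r \<le> (\<rho> r * r) * Z r" unfolding \<rho>\<^sub>0_def using Z0
          by (intro mult_right_mono t) (auto simp: space_restrict_space)
        then show "\<rho>\<^sub>0 * Z r \<le> \<rho> r * Z r * r" by (simp add: mult_ac)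
      qed
      also have "\<dots> \<le> (LINT r|plasma. \<rho> r * Z r * r)"
        by (rule integral_lborel_on_mono_set[OF iZ sub(1)]) (use Z0 rho_props(3) in auto)
      finally have "2 * pi\<^sup>2 * (\<rho>\<^sub>0 * integral\<^sup>L ?N Z) \<le> 2 * pi\<^sup>2 * (LINT r|plasma. \<rho> r * Z r * r)"
        by (intro mult_left_mono) auto
      then have "2 * pi\<^sup>2 * (\<rho>\<^sub>0 * integral\<^sup>L ?N Z) \<le> 1" unfolding JZ .
      then show ?thesis using \<rho>0 unfolding C1_def by (simp add: field_simps)
    qed
    define X where "X = (LINT r|lborel_on {a<..<b}. (\<xi> r)\<^sup>2)"
    have X0: "X \<ge> 0" unfolding X_def by (rule Bochner_Integration.integral_nonneg) auto
    have i\<xi>: "integrable ?N (\<lambda>r. (\<xi> r)\<^sup>2)" by (intro integrable_Icc_continuous continuous_intros c)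
    have X_le: "X \<le> C1"
    proof -
      have "X \<le> (LINT r|?N. (\<xi> r)\<^sup>2)" unfolding X_def
        by (rule integral_lborel_on_mono_set[OF i\<xi>]) (use ab' in auto)
      also have "\<dots> \<le> integral\<^sup>L ?N Z" by (intro integral_mono i\<xi> iNZ) (auto simp: Z_def)
      finally show ?thesis using Z_le by simp
    qed
    have ZF: "integral\<^sup>L ?N (\<lambda>r. Z r + F r) \<le> (C1 + C2) * (Dv + 1)"
    proof -
      have "integral\<^sup>L ?N (\<lambda>r. Z r + F r) \<le> C1 + C2 * Dv" using iNZ iNF F_le Z_le by simp
      also have "\<dots> \<le> (C1 + C2) * (Dv + 1)" using C D0 by (simp add: algebra_simps)
      finally show ?thesis .
    qed
    have iZF: "integrable ?N (\<lambda>r. Z r + F r)" using iNZ iNF by simp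
    have int_sq: "integrable ?N f" and int_sq_le: "integral\<^sup>L ?N f \<le> B * (LINT r|?N. Z r + F r)"
      if [measurable]: "f \<in> borel_measurable ?N" and f: "\<And>r. r \<in> {a'..b'} \<Longrightarrow> 0 \<le> f r \<and> f r \<le> B * (Z r + F r)" for f B
    proof -
      show *: "integrable ?N f"
      proof (rule Bochner_Integration.integrable_bound[OF integrable_mult_right[OF iZF, of B]])
        show "AE r in ?N. norm (f r) \<le> norm (B * (Z r + F r))"
          using f by (intro AE_I2) (fastforce simp: space_restrict_space)
      qed measurable
      have "integral\<^sup>L ?N f \<le> (LINT r|?N. B * (Z r + F r))"
        by (intro integral_mono * integrable_mult_right iZF) (use f in \<open>auto simp: space_restrict_space\<close>)
      then show "integral\<^sup>L ?N f \<le> B * (LINT r|?N. Z r + F r)" by (simp only: integral_mult_right_zero)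
    qed
    have xle: "(d \<xi> r)\<^sup>2 \<le> 1 * (Z r + F r)" for r
      unfolding F_def dissipation_part_def Z_def by simp
    have i\<xi>': "integrable ?N (\<lambda>r. (d \<xi> r)\<^sup>2)" by (rule int_sq[where B = 1]) (use xle in auto)
    have k_le: "\<bar>real_of_int k\<bar> * X \<le> K1 * ((C1 + C2) * (Dv + 1))"
    proof -
      \<comment> \<open>The interior estimate is applied to \<open>\<eta>\<close> with
        \<open>\<kappa> = - k\<close> and weight 1, so that the residual is exactly a dissipated
        quantity.\<close>
      have h: "d \<eta> r - - real_of_int k * 1 * \<xi> r = d \<eta> r + k * \<xi> r" for r by simp
      have "\<bar>- real_of_int k\<bar> * X \<le> K1 * (LINT r|?N. (\<xi> r)\<^sup>2 + (\<eta> r)\<^sup>2 + (d \<xi> r)\<^sup>2 + (d \<eta> r - - real_of_int k * 1 * \<xi> r)\<^sup>2)"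
        unfolding X_def
      proof (rule K1(2)[OF w'(1,2) i\<xi>'])
        show "integrable ?N (\<lambda>r. (d \<eta> r - - real_of_int k * 1 * \<xi> r)\<^sup>2)" unfolding h
          by (rule int_sq[where B = 1]) (auto simp: F_def dissipation_part_def Z_def)
      qed
      also have "\<dots> \<le> K1 * (1 * (LINT r|?N. Z r + F r))" unfolding h
        using K1(1) by (intro mult_left_mono int_sq_le) (auto simp: F_def dissipation_part_def Z_def)
      also have "\<dots> \<le> K1 * ((C1 + C2) * (Dv + 1))" using K1(1) ZF by (intro mult_left_mono) auto
      finally show ?thesis by simp
    qed
    have m_le: "\<bar>real_of_int m\<bar> * X \<le> K2 * (C3 * ((C1 + C2) * (Dv + 1)))"
    proof -
      \<comment> \<open>For \<open>\<zeta>\<close> the choice is \<open>\<kappa> = m\<close> with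
        weight \<open>1 / r\<close>; the residual is then \<open>\<zeta> r / r - g r\<close>, where
        \<open>g\<close> is dissipated and the quotient is harmless because
        \<open>r \<ge> a'\<close>.\<close>
      define g where "g = (\<lambda>r. - d \<zeta> r + \<zeta> r / r + m / r * \<xi> r)"
      have G: "(d \<zeta> r - real_of_int m * (1 / r) * \<xi> r)\<^sup>2 \<le> 2 * (\<zeta> r / r)\<^sup>2 + 2 * (g r)\<^sup>2" for r
        using power2_diff_le[of "\<zeta> r / r" "g r"] by (simp add: g_def)
      have \<zeta>_le: "(\<zeta> r / r)\<^sup>2 \<le> 1 / a'\<^sup>2 * (\<zeta> r)\<^sup>2" if "r \<in> {a'..b'}" for r
      proof -
        have "a'\<^sup>2 \<le> r\<^sup>2" using that ab' by (intro power_mono) auto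
        then have "(\<zeta> r)\<^sup>2 / r\<^sup>2 \<le> (\<zeta> r)\<^sup>2 / a'\<^sup>2" using ab' that by (intro divide_left_mono) auto
        then show ?thesis by (simp add: power_divide)
      qed
      have GC: "(\<xi> r)\<^sup>2 + (\<zeta> r)\<^sup>2 + (d \<xi> r)\<^sup>2 + (d \<zeta> r - real_of_int m * (1 / r) * \<xi> r)\<^sup>2 \<le> C3 * (Z r + F r)"
        if r: "r \<in> {a'..b'}" for r
      proof -
        have "(\<xi> r)\<^sup>2 + (\<zeta> r)\<^sup>2 + (d \<xi> r)\<^sup>2 + (d \<zeta> r - real_of_int m * (1 / r) * \<xi> r)\<^sup>2
          \<le> (\<xi> r)\<^sup>2 + (\<zeta> r)\<^sup>2 + (d \<xi> r)\<^sup>2 + (2 * (1 / a'\<^sup>2 * (\<zeta> r)\<^sup>2) + 2 * (g r)\<^sup>2)"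
          using G[of r] \<zeta>_le[OF r] by linarith
        also have "\<dots> \<le> 2 * (Z r + F r) + 2 / a'\<^sup>2 * (\<zeta> r)\<^sup>2"
          unfolding Z_def F_def dissipation_part_def g_def by simp
        also have "\<dots> \<le> 2 * (Z r + F r) + 2 / a'\<^sup>2 * (Z r + F r)"
          using F0[of r] by (intro add_mono mult_left_mono) (auto simp: Z_def)
        also have "\<dots> = C3 * (Z r + F r)" by (simp add: C3_def distrib_right)
        finally show ?thesis .
      qed
      have "\<bar>real_of_int m\<bar> * X \<le> K2 * (LINT r|?N. (\<xi> r)\<^sup>2 + (\<zeta> r)\<^sup>2 + (d \<xi> r)\<^sup>2 + (d \<zeta> r - real_of_int m * (1 / r) * \<xi> r)\<^sup>2)"
        unfolding X_def
      proof (rule K2(2)[OF w'(1,3) i\<xi>'])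
        show "integrable ?N (\<lambda>r. (d \<zeta> r - real_of_int m * (1 / r) * \<xi> r)\<^sup>2)"
        proof (rule int_sq[where B = C3])
          fix r assume r: "r \<in> {a'..b'}"
          show "0 \<le> (d \<zeta> r - real_of_int m * (1 / r) * \<xi> r)\<^sup>2 \<and> (d \<zeta> r - real_of_int m * (1 / r) * \<xi> r)\<^sup>2 \<le> C3 * (Z r + F r)"
            using GC[OF r] zero_le_power2[of "\<xi> r"] zero_le_power2[of "\<zeta> r"] zero_le_power2[of "d \<xi> r"]
              zero_le_power2[of "d \<zeta> r - real_of_int m * (1 / r) * \<xi> r"] by linarith
        qed measurable
      qed
      also have "\<dots> \<le> K2 * (C3 * (LINT r|?N. Z r + F r))"
      proof (intro mult_left_mono int_sq_le)
        fix r assume r: "r \<in> {a'..b'}"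
        show "0 \<le> (\<xi> r)\<^sup>2 + (\<zeta> r)\<^sup>2 + (d \<xi> r)\<^sup>2 + (d \<zeta> r - real_of_int m * (1 / r) * \<xi> r)\<^sup>2 \<and>
          (\<xi> r)\<^sup>2 + (\<zeta> r)\<^sup>2 + (d \<xi> r)\<^sup>2 + (d \<zeta> r - real_of_int m * (1 / r) * \<xi> r)\<^sup>2 \<le> C3 * (Z r + F r)"
          using GC[OF r] by simp
      qed (use K2(1) in \<open>simp_all, measurable\<close>)
      also have "\<dots> \<le> K2 * (C3 * ((C1 + C2) * (Dv + 1)))" using K2(1) C ZF by (intro mult_left_mono) auto
      finally show ?thesis .
    qed
    have t1: "integrable plasma (\<lambda>r. (\<xi> r)\<^sup>2)"
      and t2: "(LINT r|plasma. (\<xi> r)\<^sup>2) \<le> (\<tau> * c\<^sub>0) * (LINT s|plasma. (d \<xi> s)\<^sup>2 * s) + 2 * X"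
      using tail[OF w(1) F(2)] by (auto simp: X_def)
    show "integrable plasma (\<lambda>r. (\<xi> r)\<^sup>2)" by (rule t1)
    have "(LINT s|plasma. (d \<xi> s)\<^sup>2 * s) \<le> (LINT s|plasma. F s * s)"
      by (intro integral_mono F(2) iFr mult_right_mono)
        (auto simp: F_def dissipation_part_def space_restrict_space)
    then have "\<tau> * c\<^sub>0 * (LINT s|plasma. (d \<xi> s)\<^sup>2 * s) \<le> \<tau> * c\<^sub>0 * (LINT s|plasma. F s * s)"
      using \<tau> c0 by (intro mult_left_mono) auto
    also have "\<dots> \<le> \<tau> * Dv" using FD \<tau> by (simp add: mult.assoc)
    finally have t3: "(LINT r|plasma. (\<xi> r)\<^sup>2) - \<tau> * Dv \<le> 2 * X" using t2 by simp
    show "(LINT r|plasma. (\<xi> r)\<^sup>2) \<le> \<tau> * D m k \<xi> \<eta> \<zeta> + (2 * C1 + C4)"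
      using t3 X_le C unfolding Dv_def by simp
    have "(\<bar>real_of_int m\<bar> + \<bar>real_of_int k\<bar>) * ((LINT r|plasma. (\<xi> r)\<^sup>2) - \<tau> * Dv)
      \<le> (\<bar>real_of_int m\<bar> + \<bar>real_of_int k\<bar>) * (2 * X)" using t3 by (intro mult_left_mono) auto
    also have "\<dots> = 2 * (\<bar>real_of_int m\<bar> * X) + 2 * (\<bar>real_of_int k\<bar> * X)" by (simp add: algebra_simps)
    also have "\<dots> \<le> 2 * (K2 * (C3 * ((C1 + C2) * (Dv + 1)))) + 2 * (K1 * ((C1 + C2) * (Dv + 1)))"
      using k_le m_le by simp
    also have "\<dots> = C4 * (Dv + 1)" unfolding C4_def by (simp add: algebra_simps)
    also have "\<dots> \<le> (2 * C1 + C4) * (Dv + 1)" using C D0 by (intro mult_right_mono) auto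
    finally show "(\<bar>real_of_int m\<bar> + \<bar>real_of_int k\<bar>) * ((LINT r|plasma. (\<xi> r)\<^sup>2) - \<tau> * D m k \<xi> \<eta> \<zeta>)
      \<le> (2 * C1 + C4) * (D m k \<xi> \<eta> \<zeta> + 1)" unfolding Dv_def .
  qed
qed

section \<open>Lower bounds for the potential energies\<close>

text \<open>Setting \<open>s = 0\<close> removes the dissipation. Both squares have nonnegative
  coefficients, and in the pressure term the factor \<open>r\<close> of the measure cancels
  \<open>1 / r\<close>.\<close>

lemma E0_ge:
  assumes P: "\<And>r. r \<in> {0..r0} \<Longrightarrow> \<bar>p' r\<bar> \<le> P" and \<xi>: "integrable plasma (\<lambda>r. (\<xi> r)\<^sup>2)"
  shows "E0 k \<xi> \<eta> \<zeta> 0 \<ge> - (4 * pi\<^sup>2 * P) * (LINT r|plasma. (\<xi> r)\<^sup>2)"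
proof -
  have P0: "P \<ge> 0" using P[of 0] r0_pos by auto
  have "- (LINT r|plasma. 2 * P * (\<xi> r)\<^sup>2) \<le> (LINT r|plasma. (2 * p' r * (\<xi> r)\<^sup>2 / r
        + (B\<theta> r)\<^sup>2 * (k * \<eta> r - 1 / r * (d (\<lambda>t. t * \<xi> t) r - 2 * \<xi> r))\<^sup>2
        + \<gamma> * p r * (1 / r * d (\<lambda>t. t * \<xi> t) r - k * \<eta> r)\<^sup>2) * r)" (is "_ \<le> (LINT r|plasma. ?F r)")
  proof (rule integral_ge_minus)
    fix r assume "r \<in> space plasma"
    then have r: "0 < r" "r < r0" by (auto simp: space_restrict_space)
    have "- p' r * (\<xi> r)\<^sup>2 \<le> P * (\<xi> r)\<^sup>2" using P[of r] r by (intro mult_right_mono) auto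
    moreover have "0 \<le> ((B\<theta> r)\<^sup>2 * (k * \<eta> r - 1 / r * (d (\<lambda>t. t * \<xi> t) r - 2 * \<xi> r))\<^sup>2
        + \<gamma> * p r * (1 / r * d (\<lambda>t. t * \<xi> t) r - k * \<eta> r)\<^sup>2) * r"
      using r gamma_gt_1 p_props(3)[of r] by (intro mult_nonneg_nonneg add_nonneg_nonneg) auto
    moreover have "?F r = 2 * (p' r * (\<xi> r)\<^sup>2) + ((B\<theta> r)\<^sup>2 * (k * \<eta> r - 1 / r * (d (\<lambda>t. t * \<xi> t) r - 2 * \<xi> r))\<^sup>2
        + \<gamma> * p r * (1 / r * d (\<lambda>t. t * \<xi> t) r - k * \<eta> r)\<^sup>2) * r"
      using r by (simp add: distrib_right add.assoc)
    ultimately show "- (2 * P * (\<xi> r)\<^sup>2) \<le> ?F r" by linarith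
  qed (use \<xi> P0 in auto)
  then have "2 * pi\<^sup>2 * - (LINT r|plasma. 2 * P * (\<xi> r)\<^sup>2) \<le> 2 * pi\<^sup>2 * (LINT r|plasma. ?F r)"
    by (intro mult_left_mono) auto
  then show ?thesis unfolding E0_def by (simp add: set_integral_lborel_on)
qed

text \<open>Apart from the pressure term, every contribution, including that of the vacuum, has a
  nonnegative density. The four integrals are estimated separately, so each may take its default
  value 0 without harm.\<close>

lemma E_ge:
  assumes P: "\<And>r. r \<in> {0..r0} \<Longrightarrow> \<bar>p' r\<bar> \<le> P" and \<xi>: "integrable plasma (\<lambda>r. (\<xi> r)\<^sup>2)"
  shows "E m k \<xi> \<eta> \<zeta> Q 0 \<ge> - (4 * pi\<^sup>2 * P) * (LINT r|plasma. (\<xi> r)\<^sup>2)"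
proof -
  let ?m = "real_of_int m" and ?k = "real_of_int k"
  have P0: "P \<ge> 0" using P[of 0] r0_pos by auto
  have mk: "0 \<le> ?m\<^sup>2 + ?k\<^sup>2 * r\<^sup>2" for r :: real by simp
  have 1: "- (LINT r|plasma. 2 * P * (\<xi> r)\<^sup>2) \<le> (LINT r|plasma. (2 * p' r + ?m\<^sup>2 * (B\<theta> r)\<^sup>2 / r) * (\<xi> r)\<^sup>2)"
  proof (rule integral_ge_minus)
    fix r assume "r \<in> space plasma"
    then have r: "0 < r" "r < r0" by (auto simp: space_restrict_space)
    have "- p' r * (\<xi> r)\<^sup>2 \<le> P * (\<xi> r)\<^sup>2" using P[of r] r by (intro mult_right_mono) auto
    moreover have "0 \<le> ?m\<^sup>2 * (B\<theta> r)\<^sup>2 / r * (\<xi> r)\<^sup>2" using r by simp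
    ultimately show "- (2 * P * (\<xi> r)\<^sup>2) \<le> (2 * p' r + ?m\<^sup>2 * (B\<theta> r)\<^sup>2 / r) * (\<xi> r)\<^sup>2"
      by (simp add: distrib_right)
  qed (use \<xi> P0 in auto)
  have 2: "0 \<le> (LINT r|plasma. ((?m\<^sup>2 + ?k\<^sup>2 * r\<^sup>2) *
          (B\<theta> r / r * \<eta> r
           + (- ?k * B\<theta> r * d (\<lambda>t. t * \<xi> t) r + 2 * ?k * B\<theta> r * \<xi> r) / (?m\<^sup>2 + ?k\<^sup>2 * r\<^sup>2))\<^sup>2
        + \<gamma> * p r * (1 / r * d (\<lambda>t. t * \<xi> t) r - ?k * \<eta> r + ?m * \<zeta> r / r)\<^sup>2) * r)"
  proof (rule Bochner_Integration.integral_nonneg)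
    fix r assume "r \<in> space plasma"
    then have r: "0 < r" "r < r0" by (auto simp: space_restrict_space)
    show "0 \<le> ((?m\<^sup>2 + ?k\<^sup>2 * r\<^sup>2) *
          (B\<theta> r / r * \<eta> r
           + (- ?k * B\<theta> r * d (\<lambda>t. t * \<xi> t) r + 2 * ?k * B\<theta> r * \<xi> r) / (?m\<^sup>2 + ?k\<^sup>2 * r\<^sup>2))\<^sup>2
        + \<gamma> * p r * (1 / r * d (\<lambda>t. t * \<xi> t) r - ?k * \<eta> r + ?m * \<zeta> r / r)\<^sup>2) * r"
      using r gamma_gt_1 p_props(3)[of r] mk[of r]
      by (intro mult_nonneg_nonneg add_nonneg_nonneg zero_le_power2) auto
  qed
  have 3: "0 \<le> (LINT r|plasma. ?m\<^sup>2 * (B\<theta> r)\<^sup>2 / (r * (?m\<^sup>2 + ?k\<^sup>2 * r\<^sup>2)) * (\<xi> r - r * d \<xi> r)\<^sup>2)"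
  proof (rule Bochner_Integration.integral_nonneg)
    fix r assume "r \<in> space plasma"
    then have r: "0 < r" by (auto simp: space_restrict_space)
    show "0 \<le> ?m\<^sup>2 * (B\<theta> r)\<^sup>2 / (r * (?m\<^sup>2 + ?k\<^sup>2 * r\<^sup>2)) * (\<xi> r - r * d \<xi> r)\<^sup>2"
      using r mk[of r] by (intro mult_nonneg_nonneg divide_nonneg_nonneg zero_le_power2) auto
  qed
  have 4: "0 \<le> (LINT r|lborel_on {r0<..<rw}. (\<bar>Q r\<bar>\<^sup>2 + 1 / (?m\<^sup>2 + ?k\<^sup>2 * r\<^sup>2) * \<bar>dv (\<lambda>t. t * Q t) r\<bar>\<^sup>2) * r)"
  proof (rule Bochner_Integration.integral_nonneg)
    fix r assume "r \<in> space (lborel_on {r0<..<rw})"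
    then have r: "0 < r" using r0_pos by (auto simp: space_restrict_space)
    show "0 \<le> (\<bar>Q r\<bar>\<^sup>2 + 1 / (?m\<^sup>2 + ?k\<^sup>2 * r\<^sup>2) * \<bar>dv (\<lambda>t. t * Q t) r\<bar>\<^sup>2) * r"
      using r mk[of r] by (intro mult_nonneg_nonneg add_nonneg_nonneg divide_nonneg_nonneg zero_le_power2) auto
  qed
  have "2 * pi\<^sup>2 * - (LINT r|plasma. 2 * P * (\<xi> r)\<^sup>2) \<le> 2 * pi\<^sup>2 * (LINT r|plasma. (2 * p' r + ?m\<^sup>2 * (B\<theta> r)\<^sup>2 / r) * (\<xi> r)\<^sup>2)"
    using 1 by (intro mult_left_mono) auto
  moreover have "0 \<le> 2 * pi\<^sup>2 * x" if "x \<ge> 0" for x :: real using that by simp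
  note this[OF 2] this[OF 3] this[OF 4]
  moreover have "2 * pi\<^sup>2 * - (LINT r|plasma. 2 * P * (\<xi> r)\<^sup>2) = - (4 * pi\<^sup>2 * P) * (LINT r|plasma. (\<xi> r)\<^sup>2)" by simp
  ultimately show ?thesis
    unfolding E_def set_integral_lborel_on(1)[OF greaterThanLessThan_borel] by linarith
qed

end

section \<open>Infima of affine functions\<close>

text \<open>Models the energy as an affine function of \<open>s\<close>, with the potential energy
  as intercept \<open>a\<close> and the dissipation as slope \<open>b\<close>. Boundedness is asked
  for \<open>s > 0\<close>, where the slope can compensate a negative intercept.\<close>

locale affine_family =
  fixes S :: "'a set" and a b :: "'a \<Rightarrow> real"
  assumes nonempty: "S \<noteq> {}" and slope_nonneg: "\<And>x. x \<in> S \<Longrightarrow> b x \<ge> 0"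
    and below: "\<And>s. s > 0 \<Longrightarrow> \<exists>B. \<forall>x\<in>S. B \<le> a x + s * b x"
begin

definition L :: "real \<Rightarrow> real" where "L s = (INF x\<in>S. a x + s * b x)"

lemma bdd: "s > 0 \<Longrightarrow> bdd_below ((\<lambda>x. a x + s * b x) ` S)"
  using below[of s] by (auto simp: bdd_below_def)

lemma L_le: "s > 0 \<Longrightarrow> x \<in> S \<Longrightarrow> L s \<le> a x + s * b x"
  unfolding L_def by (rule cINF_lower[OF bdd])

lemma L_ge: "(\<And>x. x \<in> S \<Longrightarrow> B \<le> a x + s * b x) \<Longrightarrow> B \<le> L s"
  unfolding L_def by (rule cINF_greatest[OF nonempty])

lemma L_mono:
  assumes "0 < s" "s \<le> t"
  shows "L s \<le> L t"
proof (rule L_ge)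
  fix x assume x: "x \<in> S"
  have "s * b x \<le> t * b x" using assms slope_nonneg[OF x] by (intro mult_right_mono)
  then show "L s \<le> a x + t * b x" using L_le[OF assms(1) x] by simp
qed

text \<open>An infimum of affine functions is concave, and a finite concave function on an open
  interval is continuous.\<close>

lemma L_continuous: "continuous_on {0<..} L"
proof -
  have "convex_on {0<..} (\<lambda>s. - L s)"
  proof (rule convex_onI)
    fix u s t :: real assume u: "0 < u" "u < 1" and st: "s \<in> {0<..}" "t \<in> {0<..}"
    have "(1 - u) * L s + u * L t \<le> L ((1 - u) * s + u * t)"
    proof (rule L_ge)
      fix x assume x: "x \<in> S"
      have "(1 - u) * L s + u * L t \<le> (1 - u) * (a x + s * b x) + u * (a x + t * b x)"
        using u st x by (intro add_mono mult_left_mono L_le) auto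
      also have "\<dots> = a x + ((1 - u) * s + u * t) * b x" by (simp add: algebra_simps)
      finally show "(1 - u) * L s + u * L t \<le> a x + ((1 - u) * s + u * t) * b x" .
    qed
    then show "- L ((1 - u) *\<^sub>R s + u *\<^sub>R t) \<le> (1 - u) * - L s + u * - L t" by simp
  qed simp
  then have "continuous_on {0<..} (\<lambda>s. - L s)" by (rule convex_on_continuous[OF open_greaterThan])
  then have "continuous_on {0<..} (\<lambda>s. - (- L s))" by (rule continuous_on_minus)
  then show ?thesis by simp
qed

text \<open>Since \<open>L\<close> is nondecreasing, \<open>sqrt (- L s)\<close> is nonincreasing in
  \<open>s\<close> and meets the identity at most once.\<close>

lemma fixed_point_unique:
  assumes "s > 0" "s = sqrt (- L s)" "t > 0" "t = sqrt (- L t)"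
  shows "s = t"
proof -
  have "t \<le> s" if "0 < s" "s \<le> t" "s = sqrt (- L s)" "t = sqrt (- L t)" for s t
    using L_mono[OF that(1,2)] that by (metis neg_le_iff_le real_sqrt_le_mono)
  then show ?thesis using assms by (metis linear order_antisym)
qed

text \<open>Intermediate value theorem for \<open>L s + s^2\<close>, whose zeros with
  \<open>s > 0\<close> are the fixed points.\<close>

lemma fixed_point_exists:
  assumes s1: "s\<^sub>1 > 0" "L s\<^sub>1 < 0"
  shows "\<exists>s>0. L s < 0 \<and> s = sqrt (- L s)"
proof -
  define q where "q = - L s\<^sub>1"
  have q: "q > 0" using s1 by (simp add: q_def)
  \<comment> \<open>Below \<open>s\<^sub>1\<close> monotonicity gives \<open>L u \<le> - q\<close>
    while \<open>u^2 \<le> q\<close>; above it \<open>L v \<ge> - q\<close> while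
    \<open>v^2 \<ge> q\<close>.\<close>
  define u where "u = min s\<^sub>1 (sqrt q)"
  define v where "v = s\<^sub>1 + sqrt q"
  have u: "u > 0" "u \<le> v" using s1 q by (auto simp: u_def v_def)
  have "u\<^sup>2 \<le> (sqrt q)\<^sup>2" using u by (intro power_mono) (auto simp: u_def)
  then have lo: "L u + u\<^sup>2 \<le> 0" using L_mono[of u s\<^sub>1] u q by (simp add: u_def q_def)
  have "(sqrt q)\<^sup>2 \<le> v\<^sup>2" using s1 q by (intro power_mono) (auto simp: v_def)
  then have hi: "0 \<le> L v + v\<^sup>2" using L_mono[of s\<^sub>1 v] s1 q by (simp add: v_def q_def)
  have "continuous_on {u..v} (\<lambda>s. L s + s\<^sup>2)"
    by (intro continuous_intros continuous_on_subset[OF L_continuous]) (use u in auto)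
  then obtain s where s: "u \<le> s" "s \<le> v" "L s + s\<^sup>2 = 0"
    using IVT'[of "\<lambda>s. L s + s\<^sup>2" u 0 v] lo hi u by auto
  then have "s > 0" "L s = - s\<^sup>2" using u by auto
  then show ?thesis by (intro exI[of _ s]) auto
qed

end

section \<open>Positive integrals and polynomial trial functions\<close>

lemma integral_Ioo_pos:
  fixes f :: "real \<Rightarrow> real"
  assumes c: "c > 0" and f: "continuous_on {0..c} f" and pos: "\<And>r. r \<in> {0<..<c} \<Longrightarrow> f r > 0"
  shows "integral\<^sup>L (lborel_on {0<..<c}) f > 0"
proof -
  let ?I = "{c/4..c/2}"
  have i: "integrable (lborel_on {0<..<c}) f"
    unfolding lborel_on_Ioo_eq_Icc by (rule integrable_Icc_continuous[OF f])
  have cI: "continuous_on ?I f" by (rule continuous_on_subset[OF f]) (use c in auto)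
  obtain t where t: "t \<in> ?I" "\<And>r. r \<in> ?I \<Longrightarrow> f t \<le> f r"
    using continuous_attains_inf[OF compact_Icc _ cI] c by auto
  have "t \<in> {0<..<c}" using t(1) c by auto
  then have "f t > 0" by (rule pos)
  then have "0 < (c/4) * f t" using c by simp
  also have "\<dots> = (LINT r|lborel_on ?I. f t)"
    using c by (simp add: measure_restrict_space space_restrict_space)
  also have "\<dots> \<le> integral\<^sup>L (lborel_on ?I) f"
    by (intro integral_mono integrable_Icc_continuous cI)
      (auto intro!: t(2) integrable_Icc_continuous simp: space_restrict_space)
  also have "\<dots> \<le> integral\<^sup>L (lborel_on {0<..<c}) f"
    by (rule integral_lborel_on_mono_set[OF i]) (use c pos in \<open>auto intro: less_imp_le\<close>)
  finally show ?thesis .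
qed

lemma Cinf_on_poly: "poly q \<in> Cinf_on a b"
proof -
  have "\<exists>D :: nat \<Rightarrow> real \<Rightarrow> real. D 0 = poly q \<and>
     (\<forall>n. \<forall>r\<in>{a..b}. (D n has_real_derivative D (Suc n) r) (at r within {a..b}))"
    by (rule exI[of _ "\<lambda>n. poly ((pderiv ^^ n) q)"]) (auto intro: DERIV_subset[OF poly_DERIV])
  then show ?thesis by (simp add: Cinf_on_def)
qed

lemma Cinf_on_monom: "(\<lambda>r. c * r ^ n) \<in> Cinf_on a b"
  using Cinf_on_poly[of "monom c n" a b] by (simp add: poly_monom[abs_def])

context z_pinch begin

subsection \<open>The growth rates as fixed points\<close>

text \<open>The constant sequence converges. Its error is the zero triple, whose norm is 0 although
  \<open>d\<close> of the zero function vanishes only almost everywhere.\<close>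

lemma completion_superset:
  assumes "(\<xi>, \<eta>, \<zeta>) \<in> S" "\<xi> \<in> Cinf_on 0 r0" "\<eta> \<in> Cinf_on 0 r0" "\<zeta> \<in> Cinf_on 0 r0"
  shows "(\<xi>, \<eta>, \<zeta>) \<in> completion m k S"
proof -
  have w: "wdifferentiable {0<..r0} f" if "f \<in> Cinf_on 0 r0" for f
    unfolding wdifferentiable_def using Cinf_on_deriv_bounds[OF that r0_pos] has_wderiv_Ioc_DERIV by metis
  have "has_wderiv {0<..r0} (\<lambda>r. 0) (\<lambda>r. 0)" by (rule has_wderiv_DERIV) auto
  then have d0: "AE r in plasma. d (\<lambda>r. 0) r = 0" by (rule d_AE)
  have "(\<integral>\<^sup>+r. ennreal (shear_sq 1 m k (\<lambda>r. 0) (\<lambda>r. 0) (\<lambda>r. 0) r * r) \<partial>plasma) = (\<integral>\<^sup>+r. 0 \<partial>plasma)"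
    by (rule nn_integral_cong_AE, use d0 in eventually_elim) (simp add: shear_sq_def)
  moreover have "(\<integral>\<^sup>+r. ennreal (div_sq m k (\<lambda>r. 0) (\<lambda>r. 0) (\<lambda>r. 0) r * r) \<partial>plasma) = (\<integral>\<^sup>+r. 0 \<partial>plasma)"
    by (rule nn_integral_cong_AE, use d0 in eventually_elim) (simp add: div_sq_def)
  ultimately have "sqnorm m k (\<lambda>r. 0) (\<lambda>r. 0) (\<lambda>r. 0) = 0"
    unfolding sqnorm_def by (simp add: nn_integral_restrict_space)
  then have "(\<lambda>n. sqnorm m k (\<lambda>r. (\<lambda>_. \<xi>) n r - \<xi> r) (\<lambda>r. (\<lambda>_. \<eta>) n r - \<eta> r) (\<lambda>r. (\<lambda>_. \<zeta>) n r - \<zeta> r))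
      \<longlonglongrightarrow> 0" by simp
  moreover have "\<forall>n::nat. ((\<lambda>_. \<xi>) n, (\<lambda>_. \<eta>) n, (\<lambda>_. \<zeta>) n) \<in> S" using assms(1) by simp
  ultimately have "\<exists>\<xi>n \<eta>n \<zeta>n. (\<forall>n::nat. (\<xi>n n, \<eta>n n, \<zeta>n n) \<in> S) \<and>
      (\<lambda>n. sqnorm m k (\<lambda>r. \<xi>n n r - \<xi> r) (\<lambda>r. \<eta>n n r - \<eta> r) (\<lambda>r. \<zeta>n n r - \<zeta> r)) \<longlonglongrightarrow> 0"
    by (intro exI conjI)
  then show ?thesis unfolding completion_def using assms w by simp
qed

lemma J_scale: "J (\<lambda>r. c * \<xi> r) (\<lambda>r. c * \<eta> r) (\<lambda>r. c * \<zeta> r) = c\<^sup>2 * J \<xi> \<eta> \<zeta>"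
proof -
  have "(LINT r|plasma. \<rho> r * ((c * \<xi> r)\<^sup>2 + (c * \<eta> r)\<^sup>2 + (c * \<zeta> r)\<^sup>2) * r)
     = (LINT r|plasma. c\<^sup>2 * (\<rho> r * ((\<xi> r)\<^sup>2 + (\<eta> r)\<^sup>2 + (\<zeta> r)\<^sup>2) * r))"
    by (rule Bochner_Integration.integral_cong) (simp_all add: algebra_simps power_mult_distrib)
  also have "\<dots> = c\<^sup>2 * (LINT r|plasma. \<rho> r * ((\<xi> r)\<^sup>2 + (\<eta> r)\<^sup>2 + (\<zeta> r)\<^sup>2) * r)"
    by (rule integral_mult_right_zero)
  finally show ?thesis unfolding J_eq_integral by simp
qed

lemma J_pos:
  assumes "continuous_on {0..r0} \<xi>" "continuous_on {0..r0} \<eta>" "continuous_on {0..r0} \<zeta>"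
    and pos: "\<And>r. r \<in> {0<..<r0} \<Longrightarrow> \<eta> r \<noteq> 0"
  shows "J \<xi> \<eta> \<zeta> > 0"
proof -
  have "0 < (LINT r|plasma. \<rho> r * ((\<xi> r)\<^sup>2 + (\<eta> r)\<^sup>2 + (\<zeta> r)\<^sup>2) * r)"
  proof (rule integral_Ioo_pos[OF r0_pos])
    show "continuous_on {0..r0} (\<lambda>r. \<rho> r * ((\<xi> r)\<^sup>2 + (\<eta> r)\<^sup>2 + (\<zeta> r)\<^sup>2) * r)"
      by (intro continuous_intros assms rho_props)
    fix r assume r: "r \<in> {0<..<r0}"
    then have "(\<xi> r)\<^sup>2 + (\<eta> r)\<^sup>2 + (\<zeta> r)\<^sup>2 > 0" using pos[OF r] by (simp add: add_nonneg_pos add_pos_nonneg)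
    then show "0 < \<rho> r * ((\<xi> r)\<^sup>2 + (\<eta> r)\<^sup>2 + (\<zeta> r)\<^sup>2) * r" using r rho_props(2)[of r] by simp
  qed
  then show ?thesis unfolding J_eq_integral by simp
qed

section \<open>The variational problem as an affine family\<close>

text \<open>For \<open>m = 0\<close> a dummy vacuum component is attached, so that both kinds of
  constraint sets have one type and can be treated together.\<close>

definition trials ::
  "int \<Rightarrow> int \<Rightarrow> (((real \<Rightarrow> real) \<times> (real \<Rightarrow> real) \<times> (real \<Rightarrow> real)) \<times> (real \<Rightarrow> real)) set" where
  "trials m k = (if m = 0 then A1 k \<times> {\<lambda>_. 0} else A2 m k)"

definition potential ::
  "int \<Rightarrow> int \<Rightarrow> (((real \<Rightarrow> real) \<times> (real \<Rightarrow> real) \<times> (real \<Rightarrow> real)) \<times> (real \<Rightarrow> real)) \<Rightarrow> real" where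
  "potential m k = (\<lambda>((\<xi>, \<eta>, \<zeta>), Q). if m = 0 then E0 k \<xi> \<eta> \<zeta> 0 else E m k \<xi> \<eta> \<zeta> Q 0)"

definition dissipation ::
  "int \<Rightarrow> int \<Rightarrow> (((real \<Rightarrow> real) \<times> (real \<Rightarrow> real) \<times> (real \<Rightarrow> real)) \<times> (real \<Rightarrow> real)) \<Rightarrow> real" where
  "dissipation m k = (\<lambda>((\<xi>, \<eta>, \<zeta>), Q). D m k \<xi> \<eta> \<zeta>)"

text \<open>\<open>I\<close> stands for the integral of the square of \<open>\<xi>\<close> over the
  plasma; hiding it behind an existential frees the later arguments from the triple.
  \<open>C\<close> is chosen before \<open>m\<close> and \<open>k\<close>.\<close>

lemma trials_bounds:
  assumes P: "\<And>r. r \<in> {0..r0} \<Longrightarrow> \<bar>p' r\<bar> \<le> P" and "P > 0" "\<tau> > 0"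
  shows "\<exists>C>0. \<forall>m k. \<forall>x\<in>trials m k. \<exists>I.
    potential m k x \<ge> - (4 * pi\<^sup>2 * P) * I \<and> I \<le> \<tau> * dissipation m k x + C \<and>
    (\<bar>real_of_int m\<bar> + \<bar>real_of_int k\<bar>) * (I - \<tau> * dissipation m k x) \<le> C * (dissipation m k x + 1)"
proof -
  obtain C where C: "C > 0" "\<And>m k \<xi> \<eta> \<zeta>. finite_dissipation m k \<xi> \<eta> \<zeta> \<Longrightarrow> J \<xi> \<eta> \<zeta> = 1 \<Longrightarrow>
    integrable plasma (\<lambda>r. (\<xi> r)\<^sup>2) \<and>
    (LINT r|plasma. (\<xi> r)\<^sup>2) \<le> \<tau> * D m k \<xi> \<eta> \<zeta> + C \<and>
    (\<bar>real_of_int m\<bar> + \<bar>real_of_int k\<bar>) * ((LINT r|plasma. (\<xi> r)\<^sup>2) - \<tau> * D m k \<xi> \<eta> \<zeta>)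
      \<le> C * (D m k \<xi> \<eta> \<zeta> + 1)"
    using L2_norm_le_dissipation[OF assms(3)] by blast
  show ?thesis
  proof (rule exI[of _ C], intro conjI allI ballI)
    fix m k x assume x: "x \<in> trials m k"
    obtain \<xi> \<eta> \<zeta> Q where x_eq: "x = ((\<xi>, \<eta>, \<zeta>), Q)" by (metis prod.exhaust)
    have fd: "finite_dissipation m k \<xi> \<eta> \<zeta>" and J: "J \<xi> \<eta> \<zeta> = 1"
      using x finite_dissipation_X finite_dissipation_Y
      unfolding x_eq trials_def A1_def A2_def by (auto split: if_splits)
    note 1 = C(2)[OF fd J]
    have "potential m k x \<ge> - (4 * pi\<^sup>2 * P) * (LINT r|plasma. (\<xi> r)\<^sup>2)"
      using E0_ge[OF P] E_ge[OF P] 1 unfolding potential_def x_eq by auto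
    then show "\<exists>I. potential m k x \<ge> - (4 * pi\<^sup>2 * P) * I \<and> I \<le> \<tau> * dissipation m k x + C \<and>
      (\<bar>real_of_int m\<bar> + \<bar>real_of_int k\<bar>) * (I - \<tau> * dissipation m k x) \<le> C * (dissipation m k x + 1)"
      using 1 unfolding dissipation_def x_eq by (intro exI[of _ "LINT r|plasma. (\<xi> r)\<^sup>2"]) simp
  qed (rule C)
qed

text \<open>A multiple of the triple (0, r, 0) with zero vacuum field: it satisfies all axis
  conditions, and \<open>\<xi> = 0\<close> makes the interface condition trivial.\<close>

lemma trials_nonempty: "trials m k \<noteq> {}"
proof -
  define c where "c = 1 / sqrt (J (\<lambda>r. 0) (\<lambda>r. r) (\<lambda>r. 0))"
  have "J (\<lambda>r. 0) (\<lambda>r. r) (\<lambda>r. 0) > 0" by (rule J_pos) (auto intro: continuous_intros)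
  then have "c\<^sup>2 * J (\<lambda>r. 0) (\<lambda>r. r) (\<lambda>r. 0) = 1" by (simp add: c_def power_divide)
  then have J: "J (\<lambda>r. 0) (\<lambda>r. c * r) (\<lambda>r. 0) = 1" using J_scale[of c "\<lambda>r. 0" "\<lambda>r. r" "\<lambda>r. 0"] by simp
  have C: "(\<lambda>r. 0) \<in> Cinf_on 0 r0" "(\<lambda>r. c * r) \<in> Cinf_on 0 r0"
    using Cinf_on_monom[of 0 0 0 r0] Cinf_on_monom[of c 1 0 r0] by simp_all
  have X: "((\<lambda>r. 0), (\<lambda>r. c * r), (\<lambda>r. 0)) \<in> X k"
    unfolding X_def by (rule completion_superset) (use C in auto)
  have Y: "((\<lambda>r. 0), (\<lambda>r. c * r), (\<lambda>r. 0)) \<in> Y m k"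
    unfolding Y_def by (rule completion_superset) (use C in auto)
  have "has_wderiv {r0..rw} (\<lambda>r. 0) (\<lambda>r. 0)" by (rule has_wderiv_DERIV) auto
  note w0 = this
  then have w: "wdifferentiable {r0..rw} (\<lambda>r. 0)" unfolding wdifferentiable_def by blast
  note wd = has_wderiv_unique_Icc[OF w0 has_wderiv_wderiv[OF w]]
  \<comment> \<open>Even for the zero function \<open>wderiv\<close> is known only up to a null set,
    so membership in \<open>H1\<close> needs an argument.\<close>
  have "integrable lborel (\<lambda>r. indicator {r0..rw} r *\<^sub>R (wderiv {r0..rw} (\<lambda>r. 0) r)\<^sup>2)"
  proof (rule integrable_cong_AE_imp[where g = "\<lambda>_. 0"])
    have "integrable (lborel_on {r0..rw}) (wderiv {r0..rw} (\<lambda>r. 0))"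
      by (rule has_wderiv_Icc(1)[OF has_wderiv_wderiv[OF w] order_refl]) (use r0_less_rw in simp)
    then have "(\<lambda>r. (wderiv {r0..rw} (\<lambda>r. 0) r)\<^sup>2) \<in> borel_measurable (lborel_on {r0..rw})" by measurable
    then show "(\<lambda>r. indicator {r0..rw} r *\<^sub>R (wderiv {r0..rw} (\<lambda>r. 0) r)\<^sup>2) \<in> borel_measurable lborel"
      by (subst (asm) borel_measurable_restrict_space_iff) auto
    show "AE r in lborel. 0 = indicator {r0..rw} r *\<^sub>R (wderiv {r0..rw} (\<lambda>r. 0) r)\<^sup>2"
      using wd by eventually_elim (auto simp: indicator_def)
  qed simp
  then have H: "(\<lambda>r. 0) \<in> H1 r0 rw" using w by (simp add: H1_def set_integrable_def)
  have "((\<lambda>r. 0, \<lambda>r. c * r, \<lambda>r. 0), \<lambda>r. 0) \<in> trials m k"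
    using J X Y H unfolding trials_def A1_def A2_def by auto
  then show ?thesis by blast
qed

lemma lam_eq_INF: "lam m k s = (INF x\<in>trials m k. potential m k x + s * dissipation m k x)"
proof (cases "m = 0")
  case True
  have "(\<lambda>(\<xi>, \<eta>, \<zeta>). E0 k \<xi> \<eta> \<zeta> s) ` A1 k
    = (\<lambda>x. potential m k x + s * dissipation m k x) ` (A1 k \<times> {\<lambda>_. 0})"
    using True by (force simp: potential_def dissipation_def E0_def image_iff)
  then show ?thesis using True unfolding lam_def trials_def by simp
next
  case False
  have "(\<lambda>((\<xi>, \<eta>, \<zeta>), Q). E m k \<xi> \<eta> \<zeta> Q s) = (\<lambda>x. potential m k x + s * dissipation m k x)"
    using False by (auto simp: potential_def dissipation_def E_def fun_eq_iff)
  then show ?thesis using False unfolding lam_def trials_def by simp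
qed

lemma affine_family_trials: "affine_family (trials m k) (potential m k) (dissipation m k)"
proof
  show "trials m k \<noteq> {}" by (rule trials_nonempty)
  show "dissipation m k x \<ge> 0" for x unfolding dissipation_def using D_nonneg by (auto split: prod.splits)
  fix s :: real assume s: "s > 0"
  obtain P where P: "P > 0" "\<And>r. r \<in> {0..r0} \<Longrightarrow> \<bar>p' r\<bar> \<le> P" using p'_bounded by auto
  define h where "h = 4 * pi\<^sup>2 * P"
  have h: "h > 0" using P by (simp add: h_def)
  \<comment> \<open>With \<open>\<tau> = s / h\<close> the dissipation lost in the lower bound is
    exactly the available \<open>s * dissipation m k x\<close>.\<close>
  have "s / h > 0" using s h by simp
  from trials_bounds[OF P(2) P(1) this]
  obtain C where C: "\<And>x. x \<in> trials m k \<Longrightarrow> \<exists>I. potential m k x \<ge> - h * I \<and> I \<le> s / h * dissipation m k x + C"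
    unfolding h_def by blast
  show "\<exists>B. \<forall>x\<in>trials m k. B \<le> potential m k x + s * dissipation m k x"
  proof (intro exI[of _ "- h * C"] ballI)
    fix x assume "x \<in> trials m k"
    then obtain I where I: "potential m k x \<ge> - h * I" "I \<le> s / h * dissipation m k x + C" using C by blast
    have "h * I \<le> h * (s / h * dissipation m k x + C)" using h I(2) by (intro mult_left_mono) auto
    also have "\<dots> = s * dissipation m k x + h * C" using h by (simp add: distrib_left)
    finally show "- h * C \<le> potential m k x + s * dissipation m k x" using I(1) by simp
  qed
qed

lemma lam_mono: "0 < s \<Longrightarrow> s \<le> t \<Longrightarrow> lam m k s \<le> lam m k t"
  using affine_family.L_mono[OF affine_family_trials] unfolding affine_family.L_def[OF affine_family_trials] lam_eq_INF .

lemma \<mu>_eq: "is_growth_rate m k s \<Longrightarrow> \<mu> m k = s"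
  unfolding \<mu>_def is_growth_rate_def
  using affine_family.fixed_point_unique[OF affine_family_trials, of s m k]
  unfolding affine_family.L_def[OF affine_family_trials] lam_eq_INF[symmetric]
  by (intro the_equality) auto

section \<open>A trial triple of negative energy\<close>

text \<open>Exchanging almost everywhere equal densities requires both to be measurable, and one of
  them contains the magnetic term. Continuity away from the axis is enough.\<close>

lemma B\<theta>_measurable: "B\<theta> \<in> borel_measurable plasma"
proof (rule measurable_lborel_on_continuous)
  let ?f = "\<lambda>s. s\<^sup>2 * p' s"
  have c: "continuous_on {0..r0} ?f" by (intro continuous_intros p'_cont)
  have "(LBINT s:{0..r}. ?f s) = integral {0..r} ?f" if "r \<in> {0<..<r0}" for r
    by (rule set_borel_integral_eq_integral, rule borel_integrable_atLeastAtMost', rule continuous_on_subset[OF c])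
      (use that in auto)
  then have "B\<theta> r = sqrt (- (2 / r\<^sup>2) * integral {0..r} ?f)" if "r \<in> {0<..<r0}" for r
    using that unfolding B\<theta>_def by simp
  moreover have "continuous_on {0..r0} (\<lambda>r. integral {0..r} ?f)"
    by (intro indefinite_integral_continuous_1 integrable_continuous_interval c)
  then have "continuous_on {0<..<r0} (\<lambda>r. integral {0..r} ?f)" by (rule continuous_on_subset) auto
  then have "continuous_on {0<..<r0} (\<lambda>r. sqrt (- (2 / r\<^sup>2) * integral {0..r} ?f))"
    by (intro continuous_intros) auto
  ultimately show "continuous_on {0<..<r0} B\<theta>" using continuous_on_cong by (metis (no_types, lifting))
qed simp

text \<open>
  For \<open>m = 0\<close>, \<open>k = 1\<close> the choice \<open>\<eta> = \<xi>' - \<xi> / r\<close> annihilates the magnetic term. With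
  \<open>\<xi> = r ^ (n + 1)\<close> an integration by parts, using \<open>p r0 = 0\<close>, turns the remaining energy into a
  multiple of \<open>(\<gamma> - (n + 1)) * \<integral> p r ^ (2 n + 1)\<close>, which is negative for large \<open>n\<close>.
\<close>

lemma negative_potential: "\<exists>x\<in>trials 0 1. potential 0 1 x < 0"
proof -
  \<comment> \<open>Rounding up gives \<open>n + 1 > \<gamma>\<close>, which fixes the sign, and
    \<open>n \<ge> 1\<close>, so that \<open>\<eta>\<close> has no zero in the plasma and
    \<open>J_pos\<close> applies.\<close>
  define n where "n = nat \<lceil>\<gamma>\<rceil>"
  have n: "real n + 1 > \<gamma>" "n \<ge> 1" unfolding n_def using gamma_gt_1 by linarith+
  define c where "c = 1 / sqrt (J (\<lambda>r. r ^ (n + 1)) (\<lambda>r. n * r ^ n) (\<lambda>r. 0))"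
  have Jp: "J (\<lambda>r. r ^ (n + 1)) (\<lambda>r. n * r ^ n) (\<lambda>r. 0) > 0"
    by (rule J_pos) (use n in \<open>auto intro!: continuous_intros\<close>)
  then have c: "c > 0" "c\<^sup>2 * J (\<lambda>r. r ^ (n + 1)) (\<lambda>r. n * r ^ n) (\<lambda>r. 0) = 1"
    by (auto simp: c_def power_divide)
  define \<xi> where "\<xi> = (\<lambda>r. c * r ^ (n + 1))"
  define \<eta> where "\<eta> = (\<lambda>r. c * (real n * r ^ n))"
  define \<zeta> where "\<zeta> = (\<lambda>r::real. 0::real)"
  have J: "J \<xi> \<eta> \<zeta> = 1"
    using J_scale[of c "\<lambda>r. r ^ (n + 1)" "\<lambda>r. n * r ^ n" "\<lambda>r. 0"] c unfolding \<xi>_def \<eta>_def \<zeta>_def by simp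
  have Cinf: "\<xi> \<in> Cinf_on 0 r0" "\<eta> \<in> Cinf_on 0 r0" "\<zeta> \<in> Cinf_on 0 r0"
    using Cinf_on_monom[of c "n + 1" 0 r0] Cinf_on_monom[of "c * n" n 0 r0] Cinf_on_monom[of 0 0 0 r0]
    unfolding \<xi>_def \<eta>_def \<zeta>_def by (simp_all add: mult.assoc)
  have "(\<xi>, \<eta>, \<zeta>) \<in> X 1" unfolding X_def
    by (rule completion_superset) (use Cinf in \<open>auto simp: \<xi>_def \<zeta>_def\<close>)
  then have mem: "((\<xi>, \<eta>, \<zeta>), \<lambda>_. 0) \<in> trials 0 1" using J by (simp add: trials_def A1_def)
  have "has_wderiv {0<..r0} (\<lambda>t. t * \<xi> t) (\<lambda>r. c * (real n + 2) * r ^ (n + 1))"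
  proof (rule has_wderiv_DERIV)
    have eq: "(\<lambda>t. t * \<xi> t) = (\<lambda>t. c * t ^ (n + 2))" by (auto simp: \<xi>_def)
    show "((\<lambda>t. t * \<xi> t) has_real_derivative c * (real n + 2) * x ^ (n + 1)) (at x within {0<..r0})" for x
    proof -
      have "((\<lambda>t. c * t ^ (n + 2)) has_real_derivative c * (real (n + 2) * x ^ (n + 2 - Suc 0))) (at x within {0<..r0})"
        by (rule DERIV_cmult[OF DERIV_pow])
      moreover have "c * (real (n + 2) * x ^ (n + 2 - Suc 0)) = c * (real n + 2) * x ^ (n + 1)" by simp
      ultimately show ?thesis unfolding eq by (simp only:)
    qed
  qed (intro continuous_intros)
  note d\<xi> = d_AE[OF this]
  have wd\<xi>: "wdifferentiable {0<..r0} (\<lambda>t. t * \<xi> t)"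
    unfolding wdifferentiable_def using \<open>has_wderiv {0<..r0} (\<lambda>t. t * \<xi> t) _\<close> by blast
  define V where "V = (\<lambda>r. 2 * p' r * (\<xi> r)\<^sup>2 / r
        + (B\<theta> r)\<^sup>2 * (real_of_int 1 * \<eta> r - 1 / r * (d (\<lambda>t. t * \<xi> t) r - 2 * \<xi> r))\<^sup>2
        + \<gamma> * p r * (1 / r * d (\<lambda>t. t * \<xi> t) r - real_of_int 1 * \<eta> r)\<^sup>2)"
  \<comment> \<open>\<open>F\<close> is the derivative of \<open>p r * r ^ (2 * n + 2)\<close>,
    which vanishes at both ends. \<open>W\<close> is the energy density with the \<open>p'\<close>
    term traded for \<open>F\<close>, so that only the multiple of \<open>G\<close> survives
    integration.\<close>
  define F where "F = (\<lambda>r. p' r * r ^ (2 * n + 2) + (2 * real n + 2) * p r * r ^ (2 * n + 1))"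
  define G where "G = (\<lambda>r. p r * r ^ (2 * n + 1))"
  define W where "W = (\<lambda>r. c\<^sup>2 * (2 * F r - 4 * (real n + 1 - \<gamma>) * G r))"
  have V: "AE r in plasma. W r = V r * r"
    using d\<xi> AE_space
  proof eventually_elim
    case (elim r)
    then have r: "r > 0" by (simp add: space_restrict_space)
    have q: "1 / r * d (\<lambda>t. t * \<xi> t) r = c * (real n + 2) * r ^ n" "1 / r * \<xi> r = c * r ^ n"
      using r elim by (simp_all add: \<xi>_def)
    have z: "real_of_int 1 * \<eta> r - 1 / r * (d (\<lambda>t. t * \<xi> t) r - 2 * \<xi> r) = 0"
    proof -
      have "1 / r * (d (\<lambda>t. t * \<xi> t) r - 2 * \<xi> r) = 1 / r * d (\<lambda>t. t * \<xi> t) r - 2 * (1 / r * \<xi> r)"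
        by (simp add: right_diff_distrib)
      then show ?thesis unfolding q by (simp add: \<eta>_def algebra_simps)
    qed
    have y: "1 / r * d (\<lambda>t. t * \<xi> t) r - real_of_int 1 * \<eta> r = 2 * c * r ^ n"
      unfolding q by (simp add: \<eta>_def algebra_simps)
    have "V r * r = 2 * p' r * (\<xi> r)\<^sup>2 + \<gamma> * p r * (2 * c * r ^ n)\<^sup>2 * r"
      unfolding V_def z y using r by (simp add: distrib_right)
    also have "(\<xi> r)\<^sup>2 = c\<^sup>2 * r ^ (2 * n + 2)"
    proof -
      have "r ^ (2 * n + 2) = (r ^ (n + 1))\<^sup>2" unfolding power_mult[symmetric] by (simp add: algebra_simps)
      then show ?thesis by (simp add: \<xi>_def power_mult_distrib)
    qed
    also have "\<gamma> * p r * (2 * c * r ^ n)\<^sup>2 * r = 4 * c\<^sup>2 * \<gamma> * G r"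
    proof -
      have "r ^ (2 * n + 1) = (r ^ n)\<^sup>2 * r" unfolding power_mult[symmetric] by (simp add: algebra_simps)
      then have "G r = p r * ((r ^ n)\<^sup>2 * r)" by (simp only: G_def)
      then show ?thesis by (simp add: power_mult_distrib)
    qed
    finally show ?case unfolding W_def F_def by (simp add: G_def algebra_simps)
  qed
  have cG: "continuous_on {0..r0} G" and cF: "continuous_on {0..r0} F"
    unfolding G_def F_def by (intro continuous_intros p_props p'_cont)+
  have iG: "integrable plasma G" and iF: "integrable plasma F"
    unfolding lborel_on_Ioo_eq_Icc by (intro integrable_Icc_continuous cG cF)+
  have "has_wderiv {0..r0} (\<lambda>r. p r * r ^ (2 * n + 2)) F"
  proof (rule has_wderiv_DERIV[OF _ cF])
    fix r assume r: "r \<in> {0..r0}"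
    show "((\<lambda>r. p r * r ^ (2 * n + 2)) has_real_derivative F r) (at r within {0..r0})"
    proof -
      have "((\<lambda>r. p r * r ^ (2 * n + 2)) has_real_derivative
          p' r * r ^ (2 * n + 2) + real (2 * n + 2) * r ^ (2 * n + 2 - Suc 0) * p r) (at r within {0..r0})"
        by (rule DERIV_mult[OF p_deriv[OF r] DERIV_pow])
      moreover have "p' r * r ^ (2 * n + 2) + real (2 * n + 2) * r ^ (2 * n + 2 - Suc 0) * p r = F r"
        unfolding F_def by simp
      ultimately show ?thesis by (simp only:)
    qed
  qed
  then have F0: "integral\<^sup>L plasma F = 0"
    using has_wderiv_Ioo(2)[of "{0..r0}" "\<lambda>r. p r * r ^ (2 * n + 2)" F 0 r0] r0_pos p_props(2) by simp
  have Gp: "integral\<^sup>L plasma G > 0"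
    by (rule integral_Ioo_pos[OF r0_pos cG]) (auto simp: G_def p_props(3))
  have "potential 0 1 ((\<xi>, \<eta>, \<zeta>), \<lambda>_. 0) = 2 * pi\<^sup>2 * (LINT r|plasma. V r * r)"
    unfolding potential_def E0_def V_def by (simp add: set_integral_lborel_on)
  also have "(LINT r|plasma. V r * r) = integral\<^sup>L plasma W"
  proof -
    have cont: "f \<in> borel_measurable plasma" if "continuous_on {0..r0} f" for f :: "real \<Rightarrow> real"
      by (rule measurable_lborel_on_continuous[OF continuous_on_subset[OF that]]) auto
    have "continuous_on {0..r0} \<xi>" "continuous_on {0..r0} \<eta>"
      unfolding \<xi>_def \<eta>_def by (intro continuous_intros)+
    note [measurable] = cont[OF this(1)] cont[OF this(2)] cont[OF p_props(1)] cont[OF p'_cont]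
      has_wderiv_measurable(2)[OF has_wderiv_d[OF wd\<xi>]] B\<theta>_measurable
    have "(\<lambda>r. V r * r) \<in> borel_measurable plasma" unfolding V_def by measurable
    moreover have "W \<in> borel_measurable plasma" unfolding W_def using iG iF by measurable
    ultimately show ?thesis by (rule integral_cong_AE) (use V in \<open>auto elim: eventually_mono\<close>)
  qed
  also have "integral\<^sup>L plasma W = c\<^sup>2 * (2 * integral\<^sup>L plasma F - 4 * (real n + 1 - \<gamma>) * integral\<^sup>L plasma G)"
    unfolding W_def integral_mult_right_zero using iF iG
    by (subst Bochner_Integration.integral_diff) auto
  also have "\<dots> = - (c\<^sup>2 * 4 * (real n + 1 - \<gamma>) * integral\<^sup>L plasma G)" unfolding F0 by simp
  finally have "potential 0 1 ((\<xi>, \<eta>, \<zeta>), \<lambda>_. 0) = - (2 * pi\<^sup>2 * (c\<^sup>2 * 4 * (real n + 1 - \<gamma>) * integral\<^sup>L plasma G))"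
    by simp
  moreover have "0 < 2 * pi\<^sup>2 * (c\<^sup>2 * 4 * (real n + 1 - \<gamma>) * integral\<^sup>L plasma G)"
    using Gp c n by simp
  ultimately have "potential 0 1 ((\<xi>, \<eta>, \<zeta>), \<lambda>_. 0) < 0" by simp
  with mem show ?thesis by blast
qed

section \<open>Existence and maximality of growth rates\<close>

lemma growth_rate_0_1: "\<exists>s. is_growth_rate 0 1 s"
proof -
  interpret affine_family "trials 0 1" "potential 0 1" "dissipation 0 1" by (rule affine_family_trials)
  have L: "L s = lam 0 1 s" for s unfolding L_def lam_eq_INF ..
  obtain x where x: "x \<in> trials 0 1" "potential 0 1 x < 0" using negative_potential by blast
  \<comment> \<open>So small that the dissipation consumes at most half of the negative potential;
    the summand 1 covers vanishing dissipation.\<close>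
  define s where "s = - potential 0 1 x / (2 * (dissipation 0 1 x + 1))"
  have dn: "dissipation 0 1 x \<ge> 0" by (rule slope_nonneg[OF x(1)])
  then have s: "s > 0" using x unfolding s_def by (intro divide_pos_pos) auto
  have "s * dissipation 0 1 x \<le> s * (dissipation 0 1 x + 1)" using s by simp
  also have "\<dots> = - potential 0 1 x / 2" using dn by (simp add: s_def field_simps)
  finally have "potential 0 1 x + s * dissipation 0 1 x < 0" using x(2) by simp
  then have "L s < 0" using L_le[OF s x(1)] by simp
  then show ?thesis using fixed_point_exists[OF s] unfolding is_growth_rate_def L by blast
qed

text \<open>For |m| + |k| beyond \<open>h * C / e\<close> the value \<open>lam m k s\<^sub>0\<close>
  is at least \<open>- s\<^sub>0^2 / 2\<close>, whereas monotonicity and a growth rate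
  \<open>s \<ge> s\<^sub>0\<close> would push it down to \<open>- s\<^sub>0^2\<close>.\<close>

lemma growth_rates_vanish:
  assumes s0: "s\<^sub>0 > 0"
  shows "\<exists>R. \<forall>m k s. is_growth_rate m k s \<longrightarrow> s \<ge> s\<^sub>0 \<longrightarrow> \<bar>real_of_int m\<bar> + \<bar>real_of_int k\<bar> \<le> R"
proof -
  obtain P where P: "P > 0" "\<And>r. r \<in> {0..r0} \<Longrightarrow> \<bar>p' r\<bar> \<le> P" using p'_bounded by auto
  define h where "h = 4 * pi\<^sup>2 * P"
  have h: "h > 0" using P by (simp add: h_def)
  \<comment> \<open>The loss \<open>h * \<tau>\<close> then uses half of the available slope
    \<open>s\<^sub>0\<close>; the other half is kept for the remainder.\<close>
  define \<tau> where "\<tau> = s\<^sub>0 / (2 * h)"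
  have \<tau>: "\<tau> > 0" "h * \<tau> = s\<^sub>0 / 2" using s0 h by (auto simp: \<tau>_def)
  obtain C where C: "C > 0" "\<And>m k x. x \<in> trials m k \<Longrightarrow> \<exists>I. potential m k x \<ge> - h * I \<and>
    (\<bar>real_of_int m\<bar> + \<bar>real_of_int k\<bar>) * (I - \<tau> * dissipation m k x) \<le> C * (dissipation m k x + 1)"
    using trials_bounds[OF P(2) P(1) \<tau>(1)] unfolding h_def by blast
  \<comment> \<open>The remainder is at most \<open>e * (y + 1)\<close>: the first bound on
    \<open>e\<close> fits \<open>e * y\<close> into the other half of the slope, the second fits the
    constant into \<open>s\<^sub>0^2 / 2\<close>.\<close>
  define e where "e = min (s\<^sub>0 / 2) (s\<^sub>0\<^sup>2 / 2)"
  have e: "e > 0" "e \<le> s\<^sub>0 / 2" "e \<le> s\<^sub>0\<^sup>2 / 2" using s0 by (auto simp: e_def)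
  show ?thesis
  proof (intro exI[of _ "h * C / e"] allI impI, rule ccontr)
    fix m k s assume g: "is_growth_rate m k s" and s: "s \<ge> s\<^sub>0"
      and big: "\<not> \<bar>real_of_int m\<bar> + \<bar>real_of_int k\<bar> \<le> h * C / e"
    interpret affine_family "trials m k" "potential m k" "dissipation m k" by (rule affine_family_trials)
    define N where "N = \<bar>real_of_int m\<bar> + \<bar>real_of_int k\<bar>"
    have "h * C / e > 0" using h C e by simp
    moreover have "h * C / e < N" using big by (simp add: N_def)
    ultimately have N: "N > 0" "h * C < e * N" using e by (linarith, simp add: field_simps)
    have "- (s\<^sub>0\<^sup>2 / 2) \<le> L s\<^sub>0"
    proof (rule L_ge)
      fix x assume x: "x \<in> trials m k"
      define y where "y = dissipation m k x"
      have y: "y \<ge> 0" using slope_nonneg[OF x] by (simp add: y_def)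
      obtain I where I: "potential m k x \<ge> - h * I" "N * (I - \<tau> * y) \<le> C * (y + 1)"
        using C(2)[OF x] unfolding N_def y_def by blast
      have "N * (h * (I - \<tau> * y)) = h * (N * (I - \<tau> * y))" by simp
      also have "\<dots> \<le> h * (C * (y + 1))" using I(2) h by (intro mult_left_mono) auto
      also have "\<dots> = (h * C) * (y + 1)" by simp
      also have "\<dots> \<le> (e * N) * (y + 1)" using N y by (intro mult_right_mono) auto
      also have "\<dots> = N * (e * (y + 1))" by simp
      finally have "h * (I - \<tau> * y) \<le> e * (y + 1)" using N by simp
      then have "h * I \<le> (h * \<tau>) * y + e * y + e" by (simp add: algebra_simps)
      also have "\<dots> \<le> s\<^sub>0 / 2 * y + s\<^sub>0 / 2 * y + s\<^sub>0\<^sup>2 / 2"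
        unfolding \<tau>(2) using e y by (intro add_mono mult_right_mono) auto
      also have "\<dots> = s\<^sub>0 * y + s\<^sub>0\<^sup>2 / 2" by (simp add: field_simps)
      finally show "- (s\<^sub>0\<^sup>2 / 2) \<le> potential m k x + s\<^sub>0 * dissipation m k x"
        using I(1) unfolding y_def by simp
    qed
    also have "L s\<^sub>0 = lam m k s\<^sub>0" unfolding L_def lam_eq_INF ..
    also have "\<dots> \<le> lam m k s" by (rule lam_mono[OF s0 s])
    also have "\<dots> = - s\<^sup>2" using g unfolding is_growth_rate_def by (metis less_eq_real_def minus_minus neg_0_le_iff_le real_sqrt_pow2)
    also have "\<dots> \<le> - s\<^sub>0\<^sup>2" using s s0 by (simp add: power_mono)
    finally show False using s0 by simp
  qed
qed

lemma biggest_growing_mode: "\<exists>(ms, ks)\<in>growing_modes. \<forall>(m, k)\<in>growing_modes. \<mu> m k \<le> \<mu> ms ks"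
proof -
  obtain s\<^sub>0 where g0: "is_growth_rate 0 1 s\<^sub>0" using growth_rate_0_1 by blast
  then have s0: "s\<^sub>0 > 0" "\<mu> 0 1 = s\<^sub>0" using \<mu>_eq by (auto simp: is_growth_rate_def)
  obtain R where R: "\<And>m k s. is_growth_rate m k s \<Longrightarrow> s \<ge> s\<^sub>0 \<Longrightarrow> \<bar>real_of_int m\<bar> + \<bar>real_of_int k\<bar> \<le> R"
    using growth_rates_vanish[OF s0(1)] by blast
  \<comment> \<open>The rate of the known mode (0, 1) is the threshold, so \<open>T\<close> contains
    that mode and every growing mode outside \<open>T\<close> is slower than it.\<close>
  define T where "T = {(m, k) \<in> growing_modes. \<mu> m k \<ge> s\<^sub>0}"
  have "T \<subseteq> {- \<lceil>R\<rceil>..\<lceil>R\<rceil>} \<times> {- \<lceil>R\<rceil>..\<lceil>R\<rceil>}"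
  proof (clarify, unfold T_def growing_modes_def, clarify)
    fix m k s assume g: "is_growth_rate m k s" and "s\<^sub>0 \<le> \<mu> m k"
    then have "\<bar>real_of_int m\<bar> + \<bar>real_of_int k\<bar> \<le> R" using R[OF g] \<mu>_eq[OF g] by simp
    then show "m \<in> {- \<lceil>R\<rceil>..\<lceil>R\<rceil>} \<and> k \<in> {- \<lceil>R\<rceil>..\<lceil>R\<rceil>}" by (auto; linarith)
  qed
  then have fin: "finite T" by (rule finite_subset) simp
  have mem: "(0, 1) \<in> T" using g0 s0 by (auto simp: T_def growing_modes_def)
  let ?M = "Max ((\<lambda>(m, k). \<mu> m k) ` T)"
  have "?M \<in> (\<lambda>(m, k). \<mu> m k) ` T" using fin mem by (intro Max_in) auto
  then obtain ms ks where ms: "(ms, ks) \<in> T" "?M = \<mu> ms ks" by auto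
  have le: "\<mu> m k \<le> \<mu> ms ks" if "(m, k) \<in> T" for m k
    unfolding ms(2)[symmetric] using fin that by (intro Max_ge) force+
  have "\<mu> m k \<le> \<mu> ms ks" if "(m, k) \<in> growing_modes" for m k
  proof (cases "\<mu> m k \<ge> s\<^sub>0")
    case True
    then show ?thesis using that by (intro le) (simp add: T_def)
  next
    case False
    then show ?thesis using le[OF mem] s0 by simp
  qed
  then show ?thesis using ms(1) unfolding T_def by blast
qed

end

theorem proposition4p3:
  fixes r0 rw A \<gamma> \<epsilon> \<delta> :: real and p :: "real \<Rightarrow> real"
  assumes "z_pinch r0 rw A \<gamma> \<epsilon> \<delta> p"
  shows "\<exists>(ms, ks) \<in> z_pinch.growing_modes r0 rw A \<gamma> \<epsilon> \<delta> p.
           \<forall>(m, k) \<in> z_pinch.growing_modes r0 rw A \<gamma> \<epsilon> \<delta> p.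
             z_pinch.\<mu> r0 rw A \<gamma> \<epsilon> \<delta> p m k \<le> z_pinch.\<mu> r0 rw A \<gamma> \<epsilon> \<delta> p ms ks"
  by (rule z_pinch.biggest_growing_mode[OF assms])

end
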